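(* Consider $\min_{x\in\mathbb{R}^d}\psi(x):=f(x)+\varphi(x)$ and suppose that the composite regularity assumption (with Lipschitz constant $\mathsf{L}$), the sample loss assumption on $\mathbb{R}^d$ (with exponent $q>2$), and the bounded variance assumption stated in the context hold. Fix $\lambda>0$ and let $\{x^k\}_k$ be generated by the normal map-based proximal stochastic gradient method $$z^{k+1}=z^k-\alpha_k\big[\nabla f(x^k;\xi^k)+\lambda^{-1}(z^k-x^k)\big],\qquad x^{k+1}=\operatorname{prox}_{\lambda\varphi}(z^{k+1}),\qquad k\ge0,$$ with step-sizes satisfying $$\alpha_k\in\big(0,(\mathsf{L}+\lambda^{-1})^{-1}\big),\qquad\sum_{k=0}^\infty\alpha_k=\infty,\qquad\sum_{k=0}^\infty r_{k+1}^{q/2}<\infty\quad\text{where}\quad r_k:=\sum_{i=k}^\infty\alpha_i^2 .$$ If $z^0$ is drawn from any distribution with a density (with respect to Lebesgue measure) and $x^0=\operatorname{prox}_{\lambda\varphi}(z^0)$, then $$\mathbb{P}\Big(\lim_{k\to\infty}x^k\in\mathcal{X}^*\Big)=0,$$ where $\mathcal{X}^*$ is the set of active strict saddles of $\psi$.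
   Context: $\operatorname{prox}_{\lambda\varphi}(z):=\operatorname{argmin}_{y\in\mathbb{R}^d}\varphi(y)+\frac1{2\lambda}\|z-y\|^2$. $\partial\psi=\nabla f+\partial\varphi$ is the limiting subdifferential, $\partial\varphi$ the convex subdifferential. The initial point $z^0$ is independent of the samples $\{\xi^k\}_k$. The maps $(x,\xi)\mapsto\nabla f(x;\xi)$ and $(x,\xi)\mapsto\nabla^2f(x;\xi)$ are jointly measurable. The event in the conclusion is that $\{x^k\}_k$ converges with limit in $\mathcal{X}^*$. Composite regularity assumption. $f:\mathbb{R}^d\to\mathbb{R}$ is $\mathcal{C}^2$ and $\nabla f$ is $\mathsf{L}$-Lipschitz on $\mathbb{R}^d$; $\varphi:\mathbb{R}^d\to(-\infty,\infty]$ is proper, closed and convex; and $\|\nabla f(x;\xi)-\nabla f(y;\xi)\|\le\mathsf{L}\|x-y\|$ for all $x,y\in\mathbb{R}^d$, $\xi\in\Xi$. Sample loss assumption. $(\Xi,\mathcal{A},\mathbb{P}_\Xi)$ is a probability space and $\{\xi^k\}_{k\in\mathbb{N}}$ are i.i.d. with law $\mathbb{P}_\Xi$. For each $\xi\in\Xi$, $f(\cdot;\xi):\mathbb{R}^d\to\mathbb{R}$ is $\mathcal{C}^2$, and $f(x)=\mathbb{E}[f(x;\xi)]$. Moreover: for every compact $\mathcal{Q}\subset\mathbb{R}^d$ there is $L_{\mathcal{Q}}<\infty$ with $\|\nabla^2f(x;\xi)-\nabla^2f(y;\xi)\|\le L_{\mathcal{Q}}\|x-y\|$ for all $x,y\in\mathcal{Q}$,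 $\xi\in\Xi$; for every fixed $\bar x$ and $k$, $\mathbb{E}[\nabla f(\bar x;\xi^k)]=\nabla f(\bar x)$ and $\mathbb{E}[\nabla^2f(\bar x;\xi^k)]=\nabla^2f(\bar x)$; there is $q>2$ such that for every fixed $\bar x$ and $k$, $\mathbb{E}[\|\nabla f(\bar x;\xi^k)-\nabla f(\bar x)\|^2]<\infty$ and $\mathbb{E}[\|\nabla^2f(\bar x;\xi^k)-\nabla^2f(\bar x)\|^q]<\infty$. Bounded variance assumption. With $\mathcal{F}_k:=\sigma(z^0,\xi^0,\dots,\xi^{k-1})$ and $\mathbb{E}_k[\cdot]:=\mathbb{E}[\cdot\mid\mathcal{F}_k]$: for every $k$, $\mathbb{E}_k[\nabla f(x^k;\xi^k)]=\nabla f(x^k)$, and there is $\sigma\ge0$ with $\mathbb{E}_k[\|\nabla f(x^k;\xi^k)-\nabla f(x^k)\|^2]\le\sigma^2$ almost surely. Both $f$ and $\varphi$ are bounded from below. Active strict saddles. The second subderivative of $\psi$ at $x$ relative to $v$ in direction $h$ is $\mathrm{d}^2\psi(x|v)(h):=\liminf_{t\downarrow0,\ \tilde h\to h}\frac{\psi(x+t\tilde h)-\psi(x)-t\langle v,\tilde h\rangle}{\frac12t^2}$. A set $\mathcal{M}\subset\mathbb{R}^d$ is an active manifold for $\psi$ at $\bar x$ if there is a neighborhood $\mathcal{U}$ of $\bar x$ such that $\mathcal{M}\cap\mathcal{U}$ is a $\mathcal{C}^2$-manifold, $\psi|_{\mathcal{M}\cap\mathcal{U}}$ is $\mathcal{C}^2$,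 and $\inf_{x\in\mathcal{U}\setminus\mathcal{M}}\operatorname{dist}(0,\partial\psi(x))>0$ (with $\operatorname{dist}(0,\emptyset)=+\infty$). The point $\bar x$ is an active strict saddle if $0\in\partial\psi(\bar x)$, $\psi$ admits an active manifold at $\bar x$, and $\min_{\|h\|=1}\mathrm{d}^2\psi(\bar x|0)(h)<0$. *)

theory Defs
  imports "HOL-Probability.Probability"
begin

section \<open>Gradients, Hessians and \<open>C\<^sup>2\<close> maps\<close>

text \<open>Hessians are elements of the space of bounded linear operators, so that the norm on them is the
  operator norm. Taking Bochner expectations of random Hessians requires the following instance.\<close>

instance blinfun :: (euclidean_space, euclidean_space) second_countable_topology
proof
  let ?r = "\<lambda>m::nat. 1 / (real m + 1)"
  have "\<exists>K. finite K \<and> cball (0::'a \<Rightarrow>\<^sub>L 'b) (real n) \<subseteq> (\<Union>x\<in>K. ball x (?r m))" for n m :: nat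
    using compact_imp_seq_compact[OF compact_cball[of "0::'a \<Rightarrow>\<^sub>L 'b" "real n"]]
      seq_compact_imp_totally_bounded[of "cball (0::'a \<Rightarrow>\<^sub>L 'b) (real n)"]
    by (metis add_increasing less_eq_real_def of_nat_0_le_iff zero_less_divide_1_iff
        add_nonneg_pos zero_less_one)
  then obtain K where K: "\<And>n m :: nat. finite (K n m)"
      "\<And>n m :: nat. cball (0::'a \<Rightarrow>\<^sub>L 'b) (real n) \<subseteq> (\<Union>x\<in>K n m. ball x (?r m))"
    by metis
  define D where "D = (\<Union>n m. K n m)"
  have "countable D"
    unfolding D_def using K(1) by (simp add: countable_finite)
  define B where "B = (\<lambda>(d, m). ball d (?r m)) ` (D \<times> UNIV)"
  have "countable B"
    unfolding B_def using \<open>countable D\<close> by auto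
  have dense: "\<exists>d\<in>D. dist d x < ?r m" for x m
  proof -
    obtain n :: nat where "norm x \<le> real n"
      using real_arch_simple by blast
    then show ?thesis
      using K(2)[of n m] unfolding D_def by (force simp: mem_cball)
  qed
  have "topological_basis B"
  proof (rule topological_basisI)
    fix S :: "('a \<Rightarrow>\<^sub>L 'b) set" and x
    assume "open S" "x \<in> S"
    then obtain e where e: "e > 0" "ball x e \<subseteq> S"
      using open_contains_ball by blast
    obtain m :: nat where m: "?r m < e / 2"
      using reals_Archimedean[of "e / 2"] e by (auto simp: field_simps)
    obtain d where d: "d \<in> D" "dist d x < ?r m"
      using dense by blast
    have "ball d (?r m) \<subseteq> ball x e"
    proof
      fix y assume "y \<in> ball d (?r m)"
      then have "dist d y < ?r m" by simp
      then show "y \<in> ball x e"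
        using dist_triangle2[of x y d] d(2) m by (simp add: dist_commute)
    qed
    then show "\<exists>U\<in>B. x \<in> U \<and> U \<subseteq> S"
      using d e unfolding B_def by (intro bexI[of _ "ball d (?r m)"]) auto
  qed (auto simp: B_def)
  then show "\<exists>B::('a \<Rightarrow>\<^sub>L 'b) set set. countable B \<and> open = generate_topology B"
    using \<open>countable B\<close> topological_basis_imp_subbasis by blast
qed

definition grad :: "('a::real_inner \<Rightarrow> real) \<Rightarrow> 'a \<Rightarrow> 'a" where
  "grad f x = (THE g. GDERIV f x :> g)"

definition hess :: "('a::real_inner \<Rightarrow> real) \<Rightarrow> 'a \<Rightarrow> 'a \<Rightarrow>\<^sub>L 'a" where
  "hess f x = Blinfun (frechet_derivative (grad f) (at x))"

definition C2_on :: "('a::real_normed_vector \<Rightarrow> 'b::real_normed_vector) \<Rightarrow> 'a set \<Rightarrow> bool" where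
  "C2_on F U \<longleftrightarrow> open U \<and>
    (\<exists>F' :: 'a \<Rightarrow> 'a \<Rightarrow>\<^sub>L 'b. \<exists>F'' :: 'a \<Rightarrow> 'a \<Rightarrow>\<^sub>L ('a \<Rightarrow>\<^sub>L 'b).
      (\<forall>x\<in>U. (F has_derivative blinfun_apply (F' x)) (at x)) \<and>
      (\<forall>x\<in>U. (F' has_derivative blinfun_apply (F'' x)) (at x)) \<and>
      continuous_on U F'')"

lemma grad_GDERIV:
  fixes f :: "'a::euclidean_space \<Rightarrow> real"
  assumes "f differentiable (at x)"
  shows "GDERIV f x :> grad f x"
proof -
  obtain f' where f': "(f has_derivative f') (at x)"
    using assms by (auto simp: differentiable_def)
  then interpret bounded_linear f' by (rule has_derivative_bounded_linear)
  have "f' h = h \<bullet> (\<Sum>b\<in>Basis. f' b *\<^sub>R b)" for h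
  proof -
    have "f' h = f' (\<Sum>b\<in>Basis. (h \<bullet> b) *\<^sub>R b)"
      by (simp add: euclidean_representation)
    then show ?thesis
      by (simp add: sum scale inner_sum_right mult.commute)
  qed
  then have ex: "GDERIV f x :> (\<Sum>b\<in>Basis. f' b *\<^sub>R b)"
    unfolding gderiv_def by (intro has_derivative_eq_rhs[OF f'] ext)
  have "g = g'" if "GDERIV f x :> g" "GDERIV f x :> g'" for g g'
  proof -
    have "(\<lambda>h. h \<bullet> g) = (\<lambda>h. h \<bullet> g')"
      using that unfolding gderiv_def by (rule has_derivative_unique)
    then show ?thesis
      by (metis euclidean_eqI inner_commute)
  qed
  then show ?thesis
    unfolding grad_def using ex by (metis theI')
qed

lemma C2_on_UNIV_grad:
  fixes f :: "'a::euclidean_space \<Rightarrow> real"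
  assumes "C2_on f UNIV"
  shows "GDERIV f x :> grad f x" and "(grad f has_derivative blinfun_apply (hess f x)) (at x)"
    and "isCont f x" and "isCont (grad f) x"
proof -
  from assms obtain F' :: "'a \<Rightarrow> 'a \<Rightarrow>\<^sub>L real" and F'' :: "'a \<Rightarrow> 'a \<Rightarrow>\<^sub>L ('a \<Rightarrow>\<^sub>L real)"
    where F': "\<And>x. (f has_derivative blinfun_apply (F' x)) (at x)"
      and F'': "\<And>x. (F' has_derivative blinfun_apply (F'' x)) (at x)"
    unfolding C2_on_def by auto
  show g: "GDERIV f x :> grad f x" for x
    using grad_GDERIV F' differentiable_def by blast
  have F'_grad: "blinfun_apply (F' x) = (\<lambda>h. h \<bullet> grad f x)" for x
    using F' g unfolding gderiv_def by (metis has_derivative_unique)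
  have grad_eq: "grad f x = (\<Sum>b\<in>Basis. F' x b *\<^sub>R b)" for x
  proof -
    have "F' x b = grad f x \<bullet> b" for b
      unfolding F'_grad by (rule inner_commute)
    then show ?thesis
      by (simp add: euclidean_representation)
  qed
  have "(grad f has_derivative (\<lambda>h. \<Sum>b\<in>Basis. blinfun_apply (F'' x h) b *\<^sub>R b)) (at x)"
    unfolding grad_eq[abs_def]
    by (intro has_derivative_sum has_derivative_scaleR_left
        bounded_linear.has_derivative[OF blinfun.bounded_linear_left] F'')
  then have d: "(grad f has_derivative frechet_derivative (grad f) (at x)) (at x)"
    using differentiableI frechet_derivative_works by blast
  then show "(grad f has_derivative blinfun_apply (hess f x)) (at x)"
    unfolding hess_def bounded_linear_Blinfun_apply[OF has_derivative_bounded_linear[OF d]] .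
  then show "isCont (grad f) x"
    by (rule has_derivative_continuous)
  show "isCont f x"
    using F' by (rule has_derivative_continuous)
qed


section \<open>Extended-real-valued convex functions and the proximity operator\<close>

definition epigraph_ext :: "('a \<Rightarrow> ereal) \<Rightarrow> ('a \<times> real) set" where
  "epigraph_ext \<phi> = {(x, t). \<phi> x \<le> ereal t}"

definition proper_fun :: "('a \<Rightarrow> ereal) \<Rightarrow> bool" where
  "proper_fun \<phi> \<longleftrightarrow> (\<forall>x. \<phi> x \<noteq> - \<infinity>) \<and> (\<exists>x. \<phi> x \<noteq> \<infinity>)"

definition closed_fun :: "('a::topological_space \<Rightarrow> ereal) \<Rightarrow> bool" where
  "closed_fun \<phi> \<longleftrightarrow> closed (epigraph_ext \<phi>)"

definition convex_fun :: "('a::real_vector \<Rightarrow> ereal) \<Rightarrow> bool" where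
  "convex_fun \<phi> \<longleftrightarrow> convex (epigraph_ext \<phi>)"

definition prox :: "real \<Rightarrow> ('a::real_normed_vector \<Rightarrow> ereal) \<Rightarrow> 'a \<Rightarrow> 'a" where
  "prox lam \<phi> z = (ARG_MIN (\<lambda>y. \<phi> y + ereal (1 / (2 * lam) * (norm (z - y))\<^sup>2)) y. True)"


section \<open>Subdifferentials\<close>

definition convex_subdiff :: "('a::real_inner \<Rightarrow> ereal) \<Rightarrow> 'a \<Rightarrow> 'a set" where
  "convex_subdiff \<phi> x = {v. \<bar>\<phi> x\<bar> \<noteq> \<infinity> \<and> (\<forall>y. \<phi> x + ereal (v \<bullet> (y - x)) \<le> \<phi> y)}"

definition regular_subdiff :: "('a::real_inner \<Rightarrow> ereal) \<Rightarrow> 'a \<Rightarrow> 'a set" where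
  "regular_subdiff \<psi> x = {v. \<bar>\<psi> x\<bar> \<noteq> \<infinity> \<and>
     0 \<le> Liminf (at x) (\<lambda>y. (\<psi> y - \<psi> x - ereal (v \<bullet> (y - x))) / ereal (norm (y - x)))}"

definition limiting_subdiff :: "('a::real_inner \<Rightarrow> ereal) \<Rightarrow> 'a \<Rightarrow> 'a set" where
  "limiting_subdiff \<psi> x = {v. \<bar>\<psi> x\<bar> \<noteq> \<infinity> \<and>
     (\<exists>X V. (\<forall>n::nat. V n \<in> regular_subdiff \<psi> (X n)) \<and>
        X \<longlonglongrightarrow> x \<and> (\<lambda>n. \<psi> (X n)) \<longlonglongrightarrow> \<psi> x \<and> V \<longlonglongrightarrow> v)}"

lemma ereal_Liminf_ge_iff:
  fixes g :: "'a \<Rightarrow> ereal"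
  shows "0 \<le> Liminf F g \<longleftrightarrow> (\<forall>e>0. eventually (\<lambda>y. - ereal e < g y) F)"
proof
  assume *: "0 \<le> Liminf F g"
  show "\<forall>e>0. eventually (\<lambda>y. - ereal e < g y) F"
    using * unfolding le_Liminf_iff by (simp add: zero_ereal_def)
next
  assume *: "\<forall>e>0. eventually (\<lambda>y. - ereal e < g y) F"
  show "0 \<le> Liminf F g"
    unfolding le_Liminf_iff
  proof (intro allI impI)
    fix y :: ereal assume "y < 0"
    then obtain e :: real where "y < ereal e" "ereal e < 0"
      using ereal_dense2 by blast
    then show "eventually (\<lambda>x. y < g x) F"
      using *[rule_format, of "-e"] by (auto simp: zero_ereal_def elim!: eventually_mono)
  qed
qed

lemma regular_subdiff_iff:
  fixes \<psi> :: "'a::real_inner \<Rightarrow> ereal"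
  assumes "\<And>y. \<psi> y \<noteq> -\<infinity>"
  shows "v \<in> regular_subdiff \<psi> x \<longleftrightarrow> \<bar>\<psi> x\<bar> \<noteq> \<infinity> \<and>
     (\<forall>e>0. eventually (\<lambda>y. \<psi> x + ereal (v \<bullet> (y - x) - e * norm (y - x)) < \<psi> y) (at x))"
proof (cases "\<bar>\<psi> x\<bar> = \<infinity>")
  case False
  then obtain c where c: "\<psi> x = ereal c" by auto
  have "- ereal e < (\<psi> y - \<psi> x - ereal (v \<bullet> (y - x))) / ereal (norm (y - x)) \<longleftrightarrow>
     \<psi> x + ereal (v \<bullet> (y - x) - e * norm (y - x)) < \<psi> y" if "y \<noteq> x" for y e
  proof (cases "\<psi> y")
    case (real d)
    then show ?thesis using that c by (auto simp: field_simps)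
  qed (use that c assms[of y] in \<open>auto\<close>)
  then have "eventually (\<lambda>y. - ereal e < (\<psi> y - \<psi> x - ereal (v \<bullet> (y - x))) / ereal (norm (y - x))) (at x)
    \<longleftrightarrow> eventually (\<lambda>y. \<psi> x + ereal (v \<bullet> (y - x) - e * norm (y - x)) < \<psi> y) (at x)" for e
    by (intro eventually_cong) (auto simp: eventually_at_filter)
  then show ?thesis
    unfolding regular_subdiff_def ereal_Liminf_ge_iff using False by simp
qed (simp add: regular_subdiff_def)

lemma GDERIV_eventually:
  assumes "GDERIV f x :> g" "e > 0"
  shows "eventually (\<lambda>y. \<bar>f y - f x - g \<bullet> (y - x)\<bar> < e * norm (y - x)) (at x)"
proof -
  have "((\<lambda>y. norm (f y - f x - (y - x) \<bullet> g) / norm (y - x)) \<longlongrightarrow> 0) (at x)"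
    using assms(1) unfolding gderiv_def has_derivative_iff_norm by auto
  then have "eventually (\<lambda>y. norm (f y - f x - (y - x) \<bullet> g) / norm (y - x) < e) (at x)"
    using assms(2) order_tendstoD(2) by blast
  moreover have "eventually (\<lambda>y. y \<noteq> x) (at x)" by (simp add: eventually_at_filter)
  ultimately show ?thesis
    by eventually_elim (auto simp: field_simps inner_commute)
qed

lemma regular_subset_limiting_subdiff: "regular_subdiff \<psi> x \<subseteq> limiting_subdiff \<psi> x"
proof
  fix v assume v: "v \<in> regular_subdiff \<psi> x"
  then have "\<bar>\<psi> x\<bar> \<noteq> \<infinity>" by (simp add: regular_subdiff_def)
  moreover have "\<exists>X V. (\<forall>n::nat. V n \<in> regular_subdiff \<psi> (X n)) \<and>
      X \<longlonglongrightarrow> x \<and> (\<lambda>n. \<psi> (X n)) \<longlonglongrightarrow> \<psi> x \<and> V \<longlonglongrightarrow> v"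
    by (rule exI[of _ "\<lambda>_. x"], rule exI[of _ "\<lambda>_. v"]) (simp add: v)
  ultimately show "v \<in> limiting_subdiff \<psi> x"
    by (simp add: limiting_subdiff_def)
qed

lemma regular_subdiff_composite:
  fixes f :: "'a::euclidean_space \<Rightarrow> real"
  assumes f: "GDERIV f x :> g" and pr: "\<And>y. \<phi> y \<noteq> -\<infinity>" and cv: "convex_fun \<phi>"
  shows "v \<in> regular_subdiff (\<lambda>y. ereal (f y) + \<phi> y) x \<longleftrightarrow> v - g \<in> convex_subdiff \<phi> x"
proof -
  let ?\<psi> = "\<lambda>y. ereal (f y) + \<phi> y"
  have npsi: "?\<psi> y \<noteq> -\<infinity>" for y using pr[of y] by (cases "\<phi> y") auto
  show ?thesis
  proof
    assume v: "v - g \<in> convex_subdiff \<phi> x"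
    then obtain c where c: "\<phi> x = ereal c" by (auto simp: convex_subdiff_def)
    have sub: "ereal (c + (v - g) \<bullet> (y - x)) \<le> \<phi> y" for y
      using v c by (auto simp: convex_subdiff_def)
    show "v \<in> regular_subdiff ?\<psi> x"
      unfolding regular_subdiff_iff[OF npsi]
    proof (intro conjI allI impI)
      fix e :: real assume "e > 0"
      from GDERIV_eventually[OF f this]
      show "eventually (\<lambda>y. ?\<psi> x + ereal (v \<bullet> (y - x) - e * norm (y - x)) < ?\<psi> y) (at x)"
      proof eventually_elim
        case (elim y)
        show ?case
          using sub[of y] elim pr[of y] c by (cases "\<phi> y") (auto simp: inner_diff_left)
      qed
    qed (simp add: c)
  next
    assume v: "v \<in> regular_subdiff ?\<psi> x"
    then have fin: "\<bar>\<phi> x\<bar> \<noteq> \<infinity>" unfolding regular_subdiff_iff[OF npsi] by auto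
    then obtain c where c: "\<phi> x = ereal c" by auto
    have "\<phi> x + ereal ((v - g) \<bullet> (y - x)) \<le> \<phi> y" for y
    proof (cases "\<phi> y")
      case (real d)
      have "c + (v - g) \<bullet> (y - x) - d \<le> 0"
      proof (cases "y = x")
        case False
        define n where "n = norm (y - x)"
        have n: "n > 0" using False by (simp add: n_def)
        have "c + (v - g) \<bullet> (y - x) - d \<le> 0 + e" if "e > 0" for e
        proof -
          define e' where "e' = e / (2 * n)"
          have e': "e' > 0" using that n by (simp add: e'_def)
          have "eventually (\<lambda>w. \<bar>f w - f x - g \<bullet> (w - x)\<bar> < e' * norm (w - x) \<and>
              ?\<psi> x + ereal (v \<bullet> (w - x) - e' * norm (w - x)) < ?\<psi> w) (at x)"
            using GDERIV_eventually[OF f e'] v e' unfolding regular_subdiff_iff[OF npsi]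
            by (auto intro: eventually_conj)
          then obtain r where r: "r > 0" "\<And>w. w \<noteq> x \<Longrightarrow> dist w x < r \<Longrightarrow>
              \<bar>f w - f x - g \<bullet> (w - x)\<bar> < e' * norm (w - x) \<and>
              ?\<psi> x + ereal (v \<bullet> (w - x) - e' * norm (w - x)) < ?\<psi> w"
            unfolding eventually_at by blast
          define t where "t = min 1 (r / (2 * n))"
          have t: "0 < t" "t \<le> 1" "t * n < r"
          proof -
            have "t * n \<le> r / (2 * n) * n" unfolding t_def using n by (intro mult_right_mono) auto
            also have "\<dots> < r" using n r(1) by simp
            finally show "t * n < r" .
          qed (use n r(1) in \<open>auto simp: t_def\<close>)
          define w where "w = x + t *\<^sub>R (y - x)"
          have w: "w - x = t *\<^sub>R (y - x)" "w \<noteq> x" "dist w x < r" "norm (w - x) = t * n"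
            using t False by (auto simp: w_def dist_norm n_def)
          have "(1 - t) *\<^sub>R (x, c) + t *\<^sub>R (y, d) \<in> epigraph_ext \<phi>"
            using cv t c real unfolding convex_fun_def
            by (intro convexD) (auto simp: epigraph_ext_def)
          moreover have "(1 - t) *\<^sub>R (x, c) + t *\<^sub>R (y, d) = (w, (1 - t) * c + t * d)"
            by (simp add: w_def algebra_simps)
          ultimately have "\<phi> w \<le> ereal ((1 - t) * c + t * d)"
            by (simp add: epigraph_ext_def)
          then obtain pw where pw: "\<phi> w = ereal pw" "pw \<le> (1 - t) * c + t * d"
            using pr[of w] by (cases "\<phi> w") auto
          have "\<bar>f w - f x - g \<bullet> (w - x)\<bar> < e' * (t * n)"
            "f x + c + v \<bullet> (w - x) - e' * (t * n) < f w + pw"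
            using r(2)[OF w(2,3)] c pw(1) w(4) by auto
          then have "c + v \<bullet> (w - x) - g \<bullet> (w - x) < 2 * (e' * (t * n)) + (1 - t) * c + t * d"
            using pw(2) by linarith
          then have "t * (c + (v - g) \<bullet> (y - x) - d) < t * (2 * e' * n)"
            unfolding w(1) by (simp add: algebra_simps inner_diff_left)
          then have "c + (v - g) \<bullet> (y - x) - d < 2 * e' * n"
            using t(1) by simp
          then show ?thesis using n by (simp add: e'_def)
        qed
        then show ?thesis by (rule field_le_epsilon)
      qed (use real c in auto)
      then show ?thesis using real c by simp
    qed (use pr[of y] in auto)
    then show "v - g \<in> convex_subdiff \<phi> x"
      using fin by (simp add: convex_subdiff_def)
  qed
qed

text \<open>For \<open>\<psi> = f + \<phi>\<close> the limiting subdifferential is the sum of the gradient of \<open>f\<close> and the convex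
  subdifferential of \<open>\<phi>\<close>.\<close>

lemma limiting_subdiff_composite:
  fixes f :: "'a::euclidean_space \<Rightarrow> real"
  assumes f: "C2_on f UNIV" and pr: "proper_fun \<phi>" and cv: "convex_fun \<phi>"
  shows "limiting_subdiff (\<lambda>y. ereal (f y) + \<phi> y) x = (\<lambda>v. grad f x + v) ` convex_subdiff \<phi> x"
proof -
  let ?\<psi> = "\<lambda>y. ereal (f y) + \<phi> y"
  have npr: "\<phi> y \<noteq> -\<infinity>" for y using pr by (simp add: proper_fun_def)
  note reg = regular_subdiff_composite[OF C2_on_UNIV_grad(1)[OF f] npr cv]
  have "v - grad f x \<in> convex_subdiff \<phi> x" if v: "v \<in> limiting_subdiff ?\<psi> x" for v
  proof -
    from v obtain X V where fin: "\<bar>?\<psi> x\<bar> \<noteq> \<infinity>"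
      and V: "\<And>n::nat. V n - grad f (X n) \<in> convex_subdiff \<phi> (X n)"
      and X: "X \<longlonglongrightarrow> x" and lim: "(\<lambda>n. ?\<psi> (X n)) \<longlonglongrightarrow> ?\<psi> x" and Vl: "V \<longlonglongrightarrow> v"
      unfolding limiting_subdiff_def reg by auto
    have fX: "(\<lambda>n. f (X n)) \<longlonglongrightarrow> f x" and gX: "(\<lambda>n. grad f (X n)) \<longlonglongrightarrow> grad f x"
      using C2_on_UNIV_grad(3,4)[OF f] X isCont_tendsto_compose by blast+
    from fin obtain c where c: "\<phi> x = ereal c" by (cases "\<phi> x") auto
    define C where "C n = real_of_ereal (\<phi> (X n))" for n
    have C: "\<phi> (X n) = ereal (C n)" for n
      using V[of n] by (auto simp: convex_subdiff_def C_def ereal_real)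
    have "(\<lambda>n. f (X n) + C n) \<longlonglongrightarrow> f x + c"
      using lim by (simp add: C c)
    from tendsto_diff[OF this fX] have Cl: "C \<longlonglongrightarrow> c" by simp
    have "ereal (c + (v - grad f x) \<bullet> (y - x)) \<le> \<phi> y" for y
    proof (cases "\<phi> y")
      case (real d)
      have "C n + (V n - grad f (X n)) \<bullet> (y - X n) \<le> d" for n
        using V[of n] C real by (auto simp: convex_subdiff_def dest!: spec[of _ y])
      moreover have "(\<lambda>n. C n + (V n - grad f (X n)) \<bullet> (y - X n)) \<longlonglongrightarrow> c + (v - grad f x) \<bullet> (y - x)"
        by (intro tendsto_intros Cl Vl gX X)
      ultimately show ?thesis
        using real by (auto intro: LIMSEQ_le_const2)
    qed (use npr[of y] in auto)
    then show ?thesis using c by (simp add: convex_subdiff_def)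
  qed
  moreover have "grad f x + s \<in> limiting_subdiff ?\<psi> x" if s: "s \<in> convex_subdiff \<phi> x" for s
  proof -
    have "grad f x + s \<in> regular_subdiff ?\<psi> x" unfolding reg using s by simp
    then show ?thesis
      by (rule subsetD[OF regular_subset_limiting_subdiff])
  qed
  ultimately show ?thesis
    by (force simp: image_iff)
qed


section \<open>Active strict saddles\<close>

definition second_subderivative ::
    "('a::real_inner \<Rightarrow> ereal) \<Rightarrow> 'a \<Rightarrow> 'a \<Rightarrow> 'a \<Rightarrow> ereal" where
  "second_subderivative \<psi> x v h =
     Liminf (at_right 0 \<times>\<^sub>F nhds h)
       (\<lambda>(t, k). (\<psi> (x + t *\<^sub>R k) - \<psi> x - ereal (t * (v \<bullet> k))) / ereal (t\<^sup>2 / 2))"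

text \<open>An embedded submanifold of class \<open>C\<^sup>2\<close> and of dimension \<open>r\<close>: near each of its points, a
  \<open>C\<^sup>2\<close> diffeomorphism between open sets maps it to an \<open>r\<close>-dimensional linear subspace.\<close>

definition C2_manifold :: "'a::euclidean_space set \<Rightarrow> bool" where
  "C2_manifold N \<longleftrightarrow> (\<exists>r. \<forall>p\<in>N. \<exists>V W S. \<exists>\<Phi> \<Psi> :: 'a \<Rightarrow> 'a.
     p \<in> V \<and> C2_on \<Phi> V \<and> C2_on \<Psi> W \<and> homeomorphism V W \<Phi> \<Psi> \<and>
     subspace S \<and> dim S = r \<and> \<Phi> ` (N \<inter> V) = S \<inter> W)"

text \<open>A function is of class \<open>C\<^sup>2\<close> on a submanifold if locally it is the restriction of a
  (real-valued) \<open>C\<^sup>2\<close> function defined on an open subset of the ambient space.\<close>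

definition C2_restricted :: "('a::euclidean_space \<Rightarrow> ereal) \<Rightarrow> 'a set \<Rightarrow> bool" where
  "C2_restricted \<psi> N \<longleftrightarrow> (\<forall>p\<in>N. \<exists>V g. p \<in> V \<and> C2_on g V \<and> (\<forall>x\<in>N \<inter> V. \<psi> x = ereal (g x)))"

text \<open>The inner infimum is the distance of \<open>0\<close> to the subdifferential; over the empty set it is
  \<open>\<infinity>\<close>, as required.\<close>

definition active_manifold :: "('a::euclidean_space \<Rightarrow> ereal) \<Rightarrow> 'a \<Rightarrow> 'a set \<Rightarrow> bool" where
  "active_manifold \<psi> x M \<longleftrightarrow> (\<exists>U. open U \<and> x \<in> U \<and>
     C2_manifold (M \<inter> U) \<and> C2_restricted \<psi> (M \<inter> U) \<and>
     0 < (INF y\<in>U - M. INF v\<in>limiting_subdiff \<psi> y. ereal (dist 0 v)))"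

definition active_strict_saddles :: "('a::euclidean_space \<Rightarrow> ereal) \<Rightarrow> 'a set" where
  "active_strict_saddles \<psi> = {x.
     0 \<in> limiting_subdiff \<psi> x \<and>
     (\<exists>M. active_manifold \<psi> x M) \<and>
     (INF h\<in>sphere 0 1. second_subderivative \<psi> x 0 h) < 0}"


section \<open>Assumptions on the stochastic composite problem\<close>

text \<open>Throughout, \<open>F x s\<close> is the sample loss \<open>f(x; s)\<close>, \<open>\<Xi>\<close> is the sample space with its law,
  \<open>M\<close> is the underlying probability space and \<open>\<xi> k\<close> is the \<open>k\<close>-th sample.\<close>

abbreviation sgrad :: "('a::euclidean_space \<Rightarrow> 's \<Rightarrow> real) \<Rightarrow> 'a \<Rightarrow> 's \<Rightarrow> 'a" where
  "sgrad F x s \<equiv> grad (\<lambda>y. F y s) x"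

abbreviation shess :: "('a::euclidean_space \<Rightarrow> 's \<Rightarrow> real) \<Rightarrow> 'a \<Rightarrow> 's \<Rightarrow> 'a \<Rightarrow>\<^sub>L 'a" where
  "shess F x s \<equiv> hess (\<lambda>y. F y s) x"

definition composite_regularity ::
    "real \<Rightarrow> ('a::euclidean_space \<Rightarrow> real) \<Rightarrow> ('a \<Rightarrow> ereal) \<Rightarrow> ('a \<Rightarrow> 's \<Rightarrow> real) \<Rightarrow> 's measure \<Rightarrow> bool"
  where
  "composite_regularity L f \<phi> F \<Xi> \<longleftrightarrow>
     C2_on f UNIV \<and> L-lipschitz_on UNIV (grad f) \<and>
     proper_fun \<phi> \<and> closed_fun \<phi> \<and> convex_fun \<phi> \<and>
     (\<forall>s\<in>space \<Xi>. L-lipschitz_on UNIV (\<lambda>x. sgrad F x s))"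

definition sample_loss ::
    "real \<Rightarrow> ('a::euclidean_space \<Rightarrow> real) \<Rightarrow> ('a \<Rightarrow> 's \<Rightarrow> real) \<Rightarrow> 's measure \<Rightarrow>
     'w measure \<Rightarrow> (nat \<Rightarrow> 'w \<Rightarrow> 's) \<Rightarrow> bool"
  where
  "sample_loss q f F \<Xi> M \<xi> \<longleftrightarrow>
     prob_space \<Xi> \<and>
     prob_space.indep_vars M (\<lambda>_. \<Xi>) \<xi> UNIV \<and> (\<forall>k. distr M \<Xi> (\<xi> k) = \<Xi>) \<and>
     (\<forall>s\<in>space \<Xi>. C2_on (\<lambda>x. F x s) UNIV) \<and>
     (\<forall>x. integrable \<Xi> (F x) \<and> f x = (LINT s|\<Xi>. F x s)) \<and>
     (\<lambda>(x, s). sgrad F x s) \<in> borel_measurable (borel \<Otimes>\<^sub>M \<Xi>) \<and>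
     (\<lambda>(x, s). shess F x s) \<in> borel_measurable (borel \<Otimes>\<^sub>M \<Xi>) \<and>
     (\<forall>Q. compact Q \<longrightarrow> (\<exists>LQ. \<forall>s\<in>space \<Xi>. \<forall>x\<in>Q. \<forall>y\<in>Q.
        norm (shess F x s - shess F y s) \<le> LQ * norm (x - y))) \<and>
     (\<forall>x k. integrable M (\<lambda>\<omega>. sgrad F x (\<xi> k \<omega>)) \<and> (LINT \<omega>|M. sgrad F x (\<xi> k \<omega>)) = grad f x) \<and>
     (\<forall>x k. integrable M (\<lambda>\<omega>. shess F x (\<xi> k \<omega>)) \<and> (LINT \<omega>|M. shess F x (\<xi> k \<omega>)) = hess f x) \<and>
     q > 2 \<and>
     (\<forall>x k. integrable M (\<lambda>\<omega>. (norm (sgrad F x (\<xi> k \<omega>) - grad f x))\<^sup>2)) \<and>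
     (\<forall>x k. integrable M (\<lambda>\<omega>. norm (shess F x (\<xi> k \<omega>) - hess f x) powr q))"

definition natural_filtration ::
    "'w measure \<Rightarrow> 's measure \<Rightarrow> ('w \<Rightarrow> 'a::topological_space) \<Rightarrow> (nat \<Rightarrow> 'w \<Rightarrow> 's) \<Rightarrow> nat \<Rightarrow> 'w measure"
  where
  "natural_filtration M \<Xi> z0 \<xi> k = sigma (space M)
     ({z0 -` A \<inter> space M | A. A \<in> sets borel} \<union>
      (\<Union>i<k. {\<xi> i -` A \<inter> space M | A. A \<in> sets \<Xi>}))"

text \<open>The conditional expectation of a vector is taken componentwise. It is not required that the
  stochastic gradient at \<open>x k\<close> be integrable, since the initial distribution may have heavy tails:
  \<open>real_cond_exp\<close> is the difference of the conditional expectations of positive and negative part,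
  both of which are finite almost surely by the bound on the conditional variance.\<close>

definition bounded_variance ::
    "('a::euclidean_space \<Rightarrow> real) \<Rightarrow> ('a \<Rightarrow> ereal) \<Rightarrow> ('a \<Rightarrow> 's \<Rightarrow> real) \<Rightarrow> 's measure \<Rightarrow>
     'w measure \<Rightarrow> (nat \<Rightarrow> 'w \<Rightarrow> 's) \<Rightarrow> ('w \<Rightarrow> 'a) \<Rightarrow> (nat \<Rightarrow> 'w \<Rightarrow> 'a) \<Rightarrow> bool"
  where
  "bounded_variance f \<phi> F \<Xi> M \<xi> z0 x \<longleftrightarrow>
     (\<forall>k. \<forall>b\<in>Basis. AE \<omega> in M.
        real_cond_exp M (natural_filtration M \<Xi> z0 \<xi> k) (\<lambda>\<omega>. sgrad F (x k \<omega>) (\<xi> k \<omega>) \<bullet> b) \<omega>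
          = grad f (x k \<omega>) \<bullet> b) \<and>
     (\<exists>\<sigma>\<ge>0. \<forall>k. AE \<omega> in M.
        nn_cond_exp M (natural_filtration M \<Xi> z0 \<xi> k)
          (\<lambda>\<omega>. ennreal ((norm (sgrad F (x k \<omega>) (\<xi> k \<omega>) - grad f (x k \<omega>)))\<^sup>2)) \<omega> \<le> ennreal (\<sigma>\<^sup>2)) \<and>
     (\<exists>c. \<forall>y. c \<le> f y) \<and> (\<exists>c::real. \<forall>y. ereal c \<le> \<phi> y)"

text \<open>Independence of two random variables with values in different types (the library's
  \<open>indep_var\<close> requires equal types): independence of the generated \<open>\<sigma>\<close>-algebras.\<close>

definition indep_of_samples ::
    "'w measure \<Rightarrow> 's measure \<Rightarrow> ('w \<Rightarrow> 'a::topological_space) \<Rightarrow> (nat \<Rightarrow> 'w \<Rightarrow> 's) \<Rightarrow> bool"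
  where
  "indep_of_samples M \<Xi> z0 \<xi> \<longleftrightarrow> prob_space.indep_set M
     (sets (vimage_algebra (space M) z0 borel))
     (sets (vimage_algebra (space M) (\<lambda>\<omega> k. \<xi> k \<omega>) (\<Pi>\<^sub>M k\<in>UNIV. \<Xi>)))"

definition normal_map_prox_sgd ::
    "('a::euclidean_space \<Rightarrow> 's \<Rightarrow> real) \<Rightarrow> ('a \<Rightarrow> ereal) \<Rightarrow> real \<Rightarrow> (nat \<Rightarrow> real) \<Rightarrow>
     'w measure \<Rightarrow> (nat \<Rightarrow> 'w \<Rightarrow> 's) \<Rightarrow> (nat \<Rightarrow> 'w \<Rightarrow> 'a) \<Rightarrow> (nat \<Rightarrow> 'w \<Rightarrow> 'a) \<Rightarrow> bool"
  where
  "normal_map_prox_sgd F \<phi> lam \<alpha> M \<xi> z x \<longleftrightarrow> (\<forall>\<omega>\<in>space M. \<forall>k.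
     x k \<omega> = prox lam \<phi> (z k \<omega>) \<and>
     z (Suc k) \<omega> = z k \<omega> - \<alpha> k *\<^sub>R (sgrad F (x k \<omega>) (\<xi> k \<omega>) + inverse lam *\<^sub>R (z k \<omega> - x k \<omega>)))"

text \<open>Finiteness of the tail sums \<open>r k\<close> is part of the condition that \<open>r (k + 1) powr (q / 2)\<close> be
  summable; it has to be stated separately because real-valued \<open>\<Sum>\<close> is arbitrary on divergent
  series.\<close>

definition step_size_condition :: "real \<Rightarrow> real \<Rightarrow> real \<Rightarrow> (nat \<Rightarrow> real) \<Rightarrow> bool" where
  "step_size_condition L lam q \<alpha> \<longleftrightarrow>
     (\<forall>k. \<alpha> k \<in> {0<..<inverse (L + inverse lam)}) \<and>
     filterlim (\<lambda>n. \<Sum>k<n. \<alpha> k) at_top sequentially \<and>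
     summable (\<lambda>i. (\<alpha> i)\<^sup>2) \<and>
     (let r = (\<lambda>k. \<Sum>i. (\<alpha> (k + i))\<^sup>2) in summable (\<lambda>k. r (k + 1) powr (q / 2)))"

end

theory Submission
  imports Defs
begin

text \<open>The proof is pathwise. Write \<open>G(w; s) = \<nabla>f(x; s) + (w - x) / \<lambda>\<close> with \<open>x = prox w\<close> for the
  sampled normal map, so that the method is \<open>z\<^sub>k\<^sub>+\<^sub>1 = z\<^sub>k - \<alpha>\<^sub>k G(z\<^sub>k; \<xi>\<^sub>k)\<close>.

  \<^emph>\<open>Reduction to a local statement.\<close> Since \<open>G\<close> is \<open>(L + 1/\<lambda>)\<close>-Lipschitz and \<open>\<alpha>\<^sub>k < 1 / (L + 1/\<lambda>)\<close>, a
  step shrinks distances at most by a fixed positive factor. Its inverse is therefore Lipschitz, and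
  preimages of Lebesgue null sets under the step are null. The start \<open>z\<^sub>0\<close> has a density and is independent of the
  samples. By Fubini's theorem it is enough to show, for almost every sample path, that the starts whose
  orbit is eventually trapped in one of countably many balls form a null set. The balls are centred at
  points \<open>x\<^sub>0 - \<lambda> \<nabla>f(x\<^sub>0)\<close>, \<open>x\<^sub>0\<close> an active strict saddle; their radii do not depend on the samples,
  and Lindelof's theorem leaves countably many of them. If \<open>x\<^sub>k\<close> converges to \<open>x\<^sub>0\<close>, then \<open>z\<^sub>k\<close> does
  converge to \<open>x\<^sub>0 - \<lambda> \<nabla>f(x\<^sub>0)\<close>: the recursion averages \<open>x\<^sub>k - \<lambda> \<nabla>f(x\<^sub>k; \<xi>\<^sub>k)\<close>, and the noise at \<open>x\<^sub>k\<close>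
  is up to a small error the noise at a fixed nearby point of a countable dense set, whose weighted series
  converges (lemma \<open>prox_convergence_imp_convergence\<close>).

  \<^emph>\<open>The trapped set is null.\<close> It is shown that two trapped starts never differ by a multiple of an
  unstable vector \<open>v\<close>. A bounded measurable set with this property has infinitely many disjoint
  translates inside a bounded set, and is therefore null (\<open>negligible_disjoint_translates\<close>). The difference \<open>d\<^sub>k\<close> of two trapped
  orbits satisfies \<open>d\<^sub>k\<^sub>+\<^sub>1 = d\<^sub>k - \<alpha>\<^sub>k (H d\<^sub>k + N\<^sub>k d\<^sub>k + s\<^sub>k)\<close>, where \<open>H = A P + (I - P) / \<lambda>\<close> with
  \<open>A = \<nabla>\<^sup>2f(x\<^sub>0)\<close> and \<open>P\<close> the derivative of \<open>prox\<close>, where \<open>N\<^sub>k = (\<nabla>\<^sup>2f(x\<^sub>0; \<xi>\<^sub>k) - A) P\<close> is a bounded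
  i.i.d. sequence of mean zero, and \<open>|s\<^sub>k| \<le> \<epsilon> |d\<^sub>k|\<close>. The noise \<open>N\<^sub>k\<close> is not small, but by Kolmogorov's
  convergence theorem its weighted tails \<open>R\<^sub>k = \<Sum>\<^sub>i\<^sub>\<ge>\<^sub>k \<alpha>\<^sub>i N\<^sub>i\<close> exist and tend to \<open>0\<close>, and the change of
  variables \<open>y\<^sub>k = (I - R\<^sub>k) d\<^sub>k\<close> cancels it to first order. An indefinite quadratic form \<open>V\<close> with
  \<open>V(v) > 0\<close> then satisfies \<open>V(y\<^sub>k\<^sub>+\<^sub>1) \<ge> (1 + 2 c \<alpha>\<^sub>k) V(y\<^sub>k)\<close>, so that \<open>y\<^sub>k\<close> is unbounded because
  \<open>\<Sum>\<alpha>\<^sub>k = \<infinity>\<close> (\<open>Lyapunov_form_exists\<close>, \<open>perturbed_unstable_orbit_unbounded\<close>).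

  \<^emph>\<open>Geometry of the active manifold.\<close> Near \<open>\<zeta> = x\<^sub>0 - \<lambda> \<nabla>f(x\<^sub>0)\<close> the normal map of \<open>f\<close> is small and is a
  subgradient of \<open>\<psi>\<close>, so \<open>prox\<close> takes values in the active manifold. The first-order conditions along the
  manifold make \<open>prox\<close> strictly differentiable at \<open>\<zeta>\<close>; its derivative \<open>P\<close> is the resolvent of the
  Hessian of \<open>\<phi>\<close> on the tangent space, hence symmetric and firmly nonexpansive. A proximal gradient step
  moves descent directions of \<open>\<psi>\<close> onto the manifold without increasing \<open>\<psi>\<close>, so the negative second
  subderivative yields a \<open>v\<close> with \<open>\<langle>P v, H v\<rangle> < 0\<close> (\<open>active_strict_saddle_prox_derivative\<close>).\<close>

section \<open>Almost sure convergence of series of independent random variables\<close>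

text \<open>The cross terms that arise on expanding squares of partial sums have this form.\<close>

lemma (in prob_space) indep_past_times_future_sum:
  fixes X :: "nat \<Rightarrow> 'a \<Rightarrow> real"
  assumes ind: "indep_vars (\<lambda>_. borel) X UNIV"
    and int: "\<And>i. integrable M (X i)" and mean: "\<And>i. expectation (X i) = 0"
    and h: "h \<in> borel_measurable (PiM {m..<j} (\<lambda>_. borel))"
    and hX: "integrable M (\<lambda>\<omega>. h (restrict (\<lambda>i. X i \<omega>) {m..<j}))"
  shows "integrable M (\<lambda>\<omega>. h (restrict (\<lambda>i. X i \<omega>) {m..<j}) * (\<Sum>i=j..<n. X i \<omega>))"
    and "expectation (\<lambda>\<omega>. h (restrict (\<lambda>i. X i \<omega>) {m..<j}) * (\<Sum>i=j..<n. X i \<omega>)) = 0"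
proof -
  have "indep_var (PiM {m..<j} (\<lambda>_. borel)) (\<lambda>\<omega>. restrict (\<lambda>i. X i \<omega>) {m..<j})
      (PiM {j..<n} (\<lambda>_. borel)) (\<lambda>\<omega>. restrict (\<lambda>i. X i \<omega>) {j..<n})"
    by (rule indep_var_restrict[OF ind]) auto
  have restrict_sum: "(\<Sum>i=j..<n. restrict (\<lambda>i. X i \<omega>) {j..<n} i) = (\<Sum>i=j..<n. X i \<omega>)" for \<omega>
    by (intro sum.cong) auto
  from indep_var_compose[OF \<open>indep_var _ _ _ _\<close> h, of "\<lambda>y. \<Sum>i=j..<n. y i" borel]
  have iv: "indep_var borel (\<lambda>\<omega>. h (restrict (\<lambda>i. X i \<omega>) {m..<j})) borel (\<lambda>\<omega>. \<Sum>i=j..<n. X i \<omega>)"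
    unfolding comp_def restrict_sum by simp
  have T: "integrable M (\<lambda>\<omega>. \<Sum>i=j..<n. X i \<omega>)"
    using int by auto
  show "integrable M (\<lambda>\<omega>. h (restrict (\<lambda>i. X i \<omega>) {m..<j}) * (\<Sum>i=j..<n. X i \<omega>))"
    by (rule indep_var_integrable[OF iv hX T])
  show "expectation (\<lambda>\<omega>. h (restrict (\<lambda>i. X i \<omega>) {m..<j}) * (\<Sum>i=j..<n. X i \<omega>)) = 0"
    using indep_var_lebesgue_integral[OF iv hX T] int mean
    by (simp add: Bochner_Integration.integral_sum)
qed

text \<open>The event is split according to the first index \<open>j\<close> at which \<open>|S j|\<close> reaches \<open>e\<close>. On each piece
  \<open>e\<^sup>2 \<le> S j\<^sup>2\<close>, and passing from \<open>S j\<^sup>2\<close> to \<open>S n\<^sup>2\<close> only adds a square and a cross term of mean zero.\<close>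

theorem (in prob_space) Kolmogorov_maximal_inequality:
  fixes X :: "nat \<Rightarrow> 'a \<Rightarrow> real"
  assumes ind: "indep_vars (\<lambda>_. borel) X UNIV"
    and sq: "\<And>i. integrable M (\<lambda>\<omega>. (X i \<omega>)\<^sup>2)"
    and mean: "\<And>i. expectation (X i) = 0"
    and e: "0 < e"
  shows "prob {\<omega>\<in>space M. \<exists>j\<in>{m..n}. e \<le> \<bar>\<Sum>i=m..<j. X i \<omega>\<bar>}
    \<le> (\<Sum>i=m..<n. expectation (\<lambda>\<omega>. (X i \<omega>)\<^sup>2)) / e\<^sup>2"
proof -
  have rv[measurable]: "X i \<in> borel_measurable M" for i
    using ind by (auto simp: indep_vars_def)
  have int: "integrable M (X i)" for i
    by (rule square_integrable_imp_integrable[OF rv sq])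
  define S where "S j \<omega> = (\<Sum>i=m..<j. X i \<omega>)" for j \<omega>
  have Sm[measurable]: "S j \<in> borel_measurable M" for j
    unfolding S_def[abs_def] by measurable
  have S2: "integrable M (\<lambda>\<omega>. (S j \<omega>)\<^sup>2)" for j
  proof (induction j)
    case (Suc j)
    have i1: "integrable M (\<lambda>\<omega>. 2 * (S j \<omega>)\<^sup>2 + 2 * (X j \<omega>)\<^sup>2)"
      using Suc sq by auto
    have le: "(S (Suc j) \<omega>)\<^sup>2 \<le> 2 * (S j \<omega>)\<^sup>2 + 2 * (X j \<omega>)\<^sup>2" for \<omega>
    proof (cases "m \<le> j")
      case True
      then have "S (Suc j) \<omega> = S j \<omega> + X j \<omega>" by (simp add: S_def)
      moreover have "0 \<le> (S j \<omega> - X j \<omega>)\<^sup>2" by simp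
      ultimately show ?thesis by (simp add: power2_eq_square algebra_simps)
    qed (simp add: S_def)
    show ?case
    proof (rule Bochner_Integration.integrable_bound[OF i1])
      show "AE \<omega> in M. norm ((S (Suc j) \<omega>)\<^sup>2) \<le> norm (2 * (S j \<omega>)\<^sup>2 + 2 * (X j \<omega>)\<^sup>2)"
        using le by (intro AE_I2) (simp add: abs_of_nonneg)
    qed measurable
  qed (simp add: S_def)
  have Sint: "integrable M (S j)" for j
    by (rule square_integrable_imp_integrable[OF Sm S2])
  have sumS: "(\<lambda>y. \<Sum>i=m..<j. y i) \<in> borel_measurable (PiM {m..<k} (\<lambda>_. borel :: real measure))"
    if "j \<le> k" for j k
    using that by (intro borel_measurable_sum measurable_component_singleton) auto
  have S_restrict: "(\<Sum>i=m..<j. restrict (\<lambda>i. X i \<omega>) {m..<k} i) = S j \<omega>" if "j \<le> k" for j k \<omega>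
    using that unfolding S_def by (intro sum.cong) auto
  have ES2: "expectation (\<lambda>\<omega>. (S j \<omega>)\<^sup>2) = (\<Sum>i=m..<j. expectation (\<lambda>\<omega>. (X i \<omega>)\<^sup>2))" for j
  proof (induction j)
    case (Suc j)
    show ?case
    proof (cases "m \<le> j")
      case True
      note * = indep_past_times_future_sum[OF ind int mean sumS[OF order_refl, of j], of "Suc j"]
      have **: "integrable M (\<lambda>\<omega>. S j \<omega> * X j \<omega>)" "expectation (\<lambda>\<omega>. S j \<omega> * X j \<omega>) = 0"
        using * by (simp_all add: S_restrict[OF order_refl] Sint del: restrict_apply)
      have "(S (Suc j) \<omega>)\<^sup>2 = (S j \<omega>)\<^sup>2 + 2 * (S j \<omega> * X j \<omega>) + (X j \<omega>)\<^sup>2" for \<omega>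
        using True by (simp add: S_def power2_eq_square algebra_simps)
      then have "expectation (\<lambda>\<omega>. (S (Suc j) \<omega>)\<^sup>2)
          = expectation (\<lambda>\<omega>. (S j \<omega>)\<^sup>2) + expectation (\<lambda>\<omega>. (X j \<omega>)\<^sup>2)"
        using ** S2 sq by simp
      then show ?thesis using Suc True by simp
    qed (simp add: S_def)
  qed (simp add: S_def)
  define A where "A j = {\<omega>\<in>space M. e \<le> \<bar>S j \<omega>\<bar> \<and> (\<forall>i\<in>{m..<j}. \<bar>S i \<omega>\<bar> < e)}" for j
  have Am[measurable]: "A j \<in> sets M" for j
    unfolding A_def by measurable
  have disj: "disjoint_family_on A {m..n}"
    unfolding disjoint_family_on_def
  proof (intro ballI impI)
    fix i j assume "i \<in> {m..n}" "j \<in> {m..n}" "i \<noteq> j"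
    then show "A i \<inter> A j = {}"
    proof (induction i j rule: linorder_wlog)
      case (le a b)
      then have "a \<in> {m..<b}" by auto
      then show ?case unfolding A_def by fastforce
    qed (simp add: Int_commute)
  qed
  have un: "{\<omega>\<in>space M. \<exists>j\<in>{m..n}. e \<le> \<bar>S j \<omega>\<bar>} = (\<Union>j\<in>{m..n}. A j)"
  proof safe
    fix \<omega> j assume *: "\<omega> \<in> space M" "j \<in> {m..n}" "e \<le> \<bar>S j \<omega>\<bar>"
    define k where "k = (LEAST k. m \<le> k \<and> e \<le> \<bar>S k \<omega>\<bar>)"
    have "m \<le> k \<and> e \<le> \<bar>S k \<omega>\<bar>"
      unfolding k_def by (rule LeastI[of _ j]) (use * in auto)
    moreover have "k \<le> j" unfolding k_def by (rule Least_le) (use * in auto)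
    moreover have "\<bar>S i \<omega>\<bar> < e" if "i \<in> {m..<k}" for i
      using not_less_Least[of i "\<lambda>k. m \<le> k \<and> e \<le> \<bar>S k \<omega>\<bar>"] that unfolding k_def by auto
    ultimately show "\<omega> \<in> (\<Union>j\<in>{m..n}. A j)"
      using * by (intro UN_I[of k]) (auto simp: A_def)
  qed (auto simp: A_def)
  have key: "e\<^sup>2 * prob (A j) \<le> expectation (\<lambda>\<omega>. indicator (A j) \<omega> * (S n \<omega>)\<^sup>2)" if j: "j \<in> {m..n}" for j
  proof -
    define h :: "(nat \<Rightarrow> real) \<Rightarrow> real" where
      "h y = (if e \<le> \<bar>\<Sum>i=m..<j. y i\<bar> \<and> (\<forall>i\<in>{m..<j}. \<bar>\<Sum>l=m..<i. y l\<bar> < e) then (\<Sum>i=m..<j. y i) else 0)" for y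
    have hm: "h \<in> borel_measurable (PiM {m..<j} (\<lambda>_. borel))"
      unfolding h_def[abs_def] by measurable
    have hX: "h (restrict (\<lambda>i. X i \<omega>) {m..<j}) = indicator (A j) \<omega> * S j \<omega>" if "\<omega> \<in> space M" for \<omega>
      using that by (auto simp: h_def S_restrict A_def less_imp_le simp del: restrict_apply)
    have i1: "integrable M (\<lambda>\<omega>. indicator (A j) \<omega> * S j \<omega>)"
      by (rule integrable_mult_indicator[OF Am Sint, simplified])
    then have "integrable M (\<lambda>\<omega>. h (restrict (\<lambda>i. X i \<omega>) {m..<j}))"
      by (subst Bochner_Integration.integrable_cong[OF refl hX]) auto
    note * = indep_past_times_future_sum[OF ind int mean hm this, of n]
    have cr: "integrable M (\<lambda>\<omega>. indicator (A j) \<omega> * S j \<omega> * (\<Sum>i=j..<n. X i \<omega>))"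
      using *(1) by (subst (asm) Bochner_Integration.integrable_cong[OF refl]) (auto simp: hX)
    have cr0: "expectation (\<lambda>\<omega>. indicator (A j) \<omega> * S j \<omega> * (\<Sum>i=j..<n. X i \<omega>)) = 0"
      using *(2) by (subst (asm) Bochner_Integration.integral_cong[OF refl]) (auto simp: hX)
    have Sn: "S n \<omega> = S j \<omega> + (\<Sum>i=j..<n. X i \<omega>)" for \<omega>
      unfolding S_def using j by (subst sum.atLeastLessThan_concat) auto
    have "e\<^sup>2 * prob (A j) = expectation (\<lambda>\<omega>. e\<^sup>2 * indicator (A j) \<omega>
         + 2 * (indicator (A j) \<omega> * S j \<omega> * (\<Sum>i=j..<n. X i \<omega>)))"
      using cr cr0 by (simp add: integrable_real_indicator emeasure_eq_measure)
    also have "\<dots> \<le> expectation (\<lambda>\<omega>. indicator (A j) \<omega> * (S n \<omega>)\<^sup>2)"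
    proof (rule integral_mono)
      show "integrable M (\<lambda>\<omega>. indicator (A j) \<omega> * (S n \<omega>)\<^sup>2)"
        by (rule integrable_mult_indicator[OF Am S2, simplified])
      fix \<omega> assume "\<omega> \<in> space M"
      have "e\<^sup>2 \<le> (S j \<omega>)\<^sup>2" if "\<omega> \<in> A j"
        using that e by (auto simp: A_def abs_le_square_iff[symmetric])
      then have "e\<^sup>2 + 2 * (S j \<omega> * (\<Sum>i=j..<n. X i \<omega>)) \<le> (S n \<omega>)\<^sup>2" if "\<omega> \<in> A j"
        using that zero_le_power2[of "\<Sum>i=j..<n. X i \<omega>"] unfolding Sn power2_sum by linarith
      then show "e\<^sup>2 * indicator (A j) \<omega> + 2 * (indicator (A j) \<omega> * S j \<omega> * (\<Sum>i=j..<n. X i \<omega>))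
          \<le> indicator (A j) \<omega> * (S n \<omega>)\<^sup>2"
        by (cases "\<omega> \<in> A j") auto
    qed (use cr in \<open>auto simp: integrable_real_indicator emeasure_eq_measure\<close>)
    finally show ?thesis .
  qed
  have "prob {\<omega>\<in>space M. \<exists>j\<in>{m..n}. e \<le> \<bar>S j \<omega>\<bar>} = (\<Sum>j=m..n. prob (A j))"
    unfolding un by (rule finite_measure_finite_Union) (use disj in auto)
  also have "e\<^sup>2 * \<dots> \<le> (\<Sum>j=m..n. expectation (\<lambda>\<omega>. indicator (A j) \<omega> * (S n \<omega>)\<^sup>2))"
    unfolding sum_distrib_left by (rule sum_mono) (rule key)
  also have "\<dots> = expectation (\<lambda>\<omega>. \<Sum>j=m..n. indicator (A j) \<omega> * (S n \<omega>)\<^sup>2)"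
    by (rule Bochner_Integration.integral_sum[symmetric])
      (rule integrable_mult_indicator[OF Am S2, simplified])
  also have "\<dots> \<le> expectation (\<lambda>\<omega>. (S n \<omega>)\<^sup>2)"
  proof (rule integral_mono)
    fix \<omega>
    have "(\<Sum>j=m..n. indicator (A j) \<omega> * (S n \<omega>)\<^sup>2) = indicator (\<Union>j\<in>{m..n}. A j) \<omega> * (S n \<omega>)\<^sup>2"
      by (simp add: sum_distrib_right[symmetric] indicator_UN_disjoint[OF _ disj])
    also have "\<dots> \<le> (S n \<omega>)\<^sup>2" by (auto simp: indicator_def)
    finally show "(\<Sum>j=m..n. indicator (A j) \<omega> * (S n \<omega>)\<^sup>2) \<le> (S n \<omega>)\<^sup>2" .
  qed (intro Bochner_Integration.integrable_sum S2 integrable_mult_indicator[OF Am S2, simplified])+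
  also note ES2
  finally show ?thesis
    unfolding S_def using e by (simp add: field_simps)
qed

text \<open>The maximal inequality bounds the probability that the partial sums beyond \<open>m\<close> ever oscillate by
  \<open>e\<close> by a tail of the series of variances, so almost surely the partial sums are Cauchy.\<close>

theorem (in prob_space) Kolmogorov_convergence:
  fixes X :: "nat \<Rightarrow> 'a \<Rightarrow> real"
  assumes ind: "indep_vars (\<lambda>_. borel) X UNIV"
    and sq: "\<And>i. integrable M (\<lambda>\<omega>. (X i \<omega>)\<^sup>2)"
    and mean: "\<And>i. expectation (X i) = 0"
    and var: "summable (\<lambda>i. expectation (\<lambda>\<omega>. (X i \<omega>)\<^sup>2))"
  shows "AE \<omega> in M. summable (\<lambda>i. X i \<omega>)"
proof -
  have rv[measurable]: "X i \<in> borel_measurable M" for i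
    using ind by (auto simp: indep_vars_def)
  define v where "v i = expectation (\<lambda>\<omega>. (X i \<omega>)\<^sup>2)" for i
  have v0: "0 \<le> v i" for i by (simp add: v_def)
  have vs: "summable v" using var by (simp add: v_def[abs_def])
  define E where "E e m = {\<omega>\<in>space M. \<exists>j\<ge>m. e \<le> \<bar>\<Sum>i=m..<j. X i \<omega>\<bar>}" for e :: real and m
  have Em[measurable]: "E e m \<in> sets M" for e m
    unfolding E_def by measurable
  have E: "prob (E e m) \<le> (\<Sum>i. v (i + m)) / e\<^sup>2" if e: "0 < e" for e m
  proof -
    define B where "B n = {\<omega>\<in>space M. \<exists>j\<in>{m..n}. e \<le> \<bar>\<Sum>i=m..<j. X i \<omega>\<bar>}" for n
    have "(\<lambda>n. prob (B n)) \<longlonglongrightarrow> prob (\<Union>n. B n)"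
    proof (rule finite_Lim_measure_incseq)
      show "range B \<subseteq> sets M" unfolding B_def by auto
      show "incseq B" unfolding B_def incseq_def by fastforce
    qed
    moreover have "(\<Union>n. B n) = E e m"
      unfolding B_def E_def by fastforce
    ultimately have lim: "(\<lambda>n. prob (B n)) \<longlonglongrightarrow> prob (E e m)" by simp
    have "prob (B n) \<le> (\<Sum>i. v (i + m)) / e\<^sup>2" for n
    proof -
      have "prob (B n) \<le> (\<Sum>i=m..<n. v i) / e\<^sup>2"
        unfolding B_def v_def by (rule Kolmogorov_maximal_inequality[OF ind sq mean e])
      also have "(\<Sum>i=m..<n. v i) = (\<Sum>i<n - m. v (i + m))"
        by (cases "m \<le> n")
          (use sum.shift_bounds_nat_ivl[of v 0 m "n - m"] in \<open>auto simp: atLeast0LessThan\<close>)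
      also have "\<dots> \<le> (\<Sum>i. v (i + m))"
        using v0 vs by (intro sum_le_suminf) (auto simp: summable_iff_shift)
      finally show ?thesis using e by (simp add: divide_right_mono)
    qed
    then show ?thesis
      by (intro LIMSEQ_le_const2[OF lim]) auto
  qed
  have "AE \<omega> in M. \<exists>m. \<omega> \<notin> E e m" if e: "0 < e" for e
  proof -
    have "prob (\<Inter>m. E e m) \<le> (\<Sum>i. v (i + m)) / e\<^sup>2" for m
      by (rule order_trans[OF _ E[OF e]]) (rule finite_measure_mono, auto)
    moreover have "(\<lambda>m. (\<Sum>i. v (i + m)) / e\<^sup>2) \<longlonglongrightarrow> 0 / e\<^sup>2"
      by (intro tendsto_intros suminf_exist_split2[OF vs]) (use e in auto)
    ultimately have "prob (\<Inter>m. E e m) \<le> 0"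
      by (intro LIMSEQ_le_const[of "\<lambda>m. (\<Sum>i. v (i + m)) / e\<^sup>2"]) auto
    then have "prob (\<Inter>m. E e m) = 0" by (simp add: measure_le_0_iff)
    then have "(\<Inter>m. E e m) \<in> null_sets M"
      by (intro null_setsI) (auto simp: emeasure_eq_measure)
    then show ?thesis
      by (rule AE_I') auto
  qed
  then have "AE \<omega> in M. \<forall>l::nat. \<exists>m. \<omega> \<notin> E (1 / Suc l) m"
    unfolding AE_all_countable by simp
  with AE_space show ?thesis
  proof eventually_elim
    case (elim \<omega>)
    show ?case unfolding summable_Cauchy
    proof (intro allI impI)
      fix e :: real assume "0 < e"
      then obtain l :: nat where l: "1 / Suc l < e / 2"
        using reals_Archimedean[of "e / 2"] by (auto simp: field_simps)
      from elim(2) obtain m where "\<omega> \<notin> E (1 / Suc l) m" by blast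
      then have *: "\<bar>\<Sum>i=m..<j. X i \<omega>\<bar> < e / 2" if "j \<ge> m" for j
        using elim(1) that l unfolding E_def by force
      have "norm (\<Sum>i=a..<b. X i \<omega>) < e" if "a \<ge> m" for a b
      proof (cases "a \<le> b")
        case True
        have "(\<Sum>i=m..<b. X i \<omega>) = (\<Sum>i=m..<a. X i \<omega>) + (\<Sum>i=a..<b. X i \<omega>)"
          using True that by (simp add: sum.atLeastLessThan_concat)
        then show ?thesis using *[of a] *[of b] that True unfolding real_norm_def by linarith
      qed (use \<open>0 < e\<close> in auto)
      then show "\<exists>N. \<forall>m\<ge>N. \<forall>n. norm (\<Sum>i=m..<n. X i \<omega>) < e" by blast
    qed
  qed
qed

section \<open>The proximity operator\<close>

lemma convex_subdiff_monotone:
  assumes "u \<in> convex_subdiff \<phi> x" "v \<in> convex_subdiff \<phi> y"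
  shows "0 \<le> (u - v) \<bullet> (x - y)"
proof -
  obtain a b where ab: "\<phi> x = ereal a" "\<phi> y = ereal b"
    using assms by (auto simp: convex_subdiff_def)
  have "a + u \<bullet> (y - x) \<le> b" "b + v \<bullet> (x - y) \<le> a"
    using assms ab unfolding convex_subdiff_def by (auto dest: spec[of _ x] spec[of _ y])
  then show ?thesis
    by (simp add: inner_diff_left inner_diff_right)
qed

text \<open>The quadratic term of the proximal objective.\<close>

lemma half_sq_norm_GDERIV:
  fixes z :: "'a::real_inner"
  assumes "lam \<noteq> 0"
  shows "GDERIV (\<lambda>y. 1 / (2 * lam) * (norm (z - y))\<^sup>2) x :> inverse lam *\<^sub>R (x - z)"
proof -
  have "((\<lambda>y. 1 / (2 * lam) * ((z - y) \<bullet> (z - y))) has_derivative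
      (\<lambda>h. 1 / (2 * lam) * ((z - x) \<bullet> (0 - h) + (0 - h) \<bullet> (z - x)))) (at x)"
    by (intro derivative_intros)
  moreover have "(\<lambda>h. 1 / (2 * lam) * ((z - x) \<bullet> (0 - h) + (0 - h) \<bullet> (z - x)))
      = (\<lambda>h. h \<bullet> (inverse lam *\<^sub>R (x - z)))"
    using assms by (auto simp: fun_eq_iff field_simps inner_diff_left inner_diff_right inner_commute)
  ultimately show ?thesis
    by (simp add: gderiv_def power2_norm_eq_inner)
qed

text \<open>Boundedness from below makes the proximal objective coercive, so minimizers can be found in a
  compact piece of the epigraph.\<close>

locale prox_function =
  fixes \<phi> :: "'a::euclidean_space \<Rightarrow> ereal"
  assumes proper: "proper_fun \<phi>" and closed: "closed_fun \<phi>" and convex: "convex_fun \<phi>"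
    and bounded_below: "\<exists>c::real. \<forall>y. ereal c \<le> \<phi> y"
begin

lemma not_MInf: "\<phi> y \<noteq> -\<infinity>"
  using proper by (auto simp: proper_fun_def)

lemma prox_minimizer_exists:
  assumes lam: "0 < lam"
  shows "\<exists>x. \<forall>y. \<phi> x + ereal (1 / (2 * lam) * (norm (z - x))\<^sup>2) \<le> \<phi> y + ereal (1 / (2 * lam) * (norm (z - y))\<^sup>2)"
proof -
  from bounded_below obtain c :: real where c: "\<And>y. ereal c \<le> \<phi> y" by blast
  obtain y0 d where d: "\<phi> y0 = ereal d"
    using proper not_MInf unfolding proper_fun_def by (metis ereal_cases)
  \<comment> \<open>Points with objective value at most \<open>v\<close> lie in the ball of radius \<open>r\<close>, and their \<open>\<phi>\<close>-values lie
      between \<open>c\<close> and \<open>v\<close>.\<close>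
  define v where "v = d + 1 / (2 * lam) * (norm (z - y0))\<^sup>2"
  have dv: "d \<le> v" using lam by (simp add: v_def)
  have cd: "c \<le> d" using c[of y0] d by simp
  define r where "r = sqrt (2 * lam * (v - c))"
  define K where "K = epigraph_ext \<phi> \<inter> (cball z r \<times> {c..v})"
  define h where "h p = snd p + 1 / (2 * lam) * (norm (z - fst p))\<^sup>2" for p :: "'a \<times> real"
  have inr: "y \<in> cball z r" if "t + 1 / (2 * lam) * (norm (z - y))\<^sup>2 \<le> v" "c \<le> t" for y t
  proof -
    have "1 / (2 * lam) * (norm (z - y))\<^sup>2 \<le> v - c" using that by linarith
    then have "(norm (z - y))\<^sup>2 \<le> 2 * lam * (v - c)" using lam by (simp add: field_simps)
    then have "norm (z - y) \<le> r" unfolding r_def by (rule real_le_rsqrt)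
    then show ?thesis by (simp add: dist_norm)
  qed
  have "compact K"
    unfolding K_def using closed unfolding closed_fun_def
    by (intro closed_Int_compact compact_Times) auto
  moreover have y0: "(y0, d) \<in> K"
    using d dv cd inr[of d y0] by (auto simp: K_def epigraph_ext_def v_def)
  moreover have "continuous_on K h"
    unfolding h_def by (intro continuous_intros)
  ultimately obtain p where p: "p \<in> K" "\<And>p'. p' \<in> K \<Longrightarrow> h p \<le> h p'"
    using continuous_attains_inf[of K h] by blast
  obtain x t where xt: "p = (x, t)" by (cases p)
  have "\<phi> x + ereal (1 / (2 * lam) * (norm (z - x))\<^sup>2) \<le> \<phi> y + ereal (1 / (2 * lam) * (norm (z - y))\<^sup>2)" for y
  proof (cases "\<phi> y")
    case (real s)
    have "h p \<le> s + 1 / (2 * lam) * (norm (z - y))\<^sup>2"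
    proof (cases "s + 1 / (2 * lam) * (norm (z - y))\<^sup>2 \<le> v")
      case True
      have "c \<le> s" using c[of y] real by simp
      moreover have "s \<le> v" using True lam zero_le_power2[of "norm (z - y)"]
        by (smt (verit) divide_nonneg_pos mult_nonneg_nonneg)
      ultimately have "(y, s) \<in> K" using inr[OF True] real by (auto simp: K_def epigraph_ext_def)
      from p(2)[OF this] show ?thesis by (simp add: h_def)
    next
      case False
      have "h p \<le> v" using p(2)[OF y0] by (simp add: h_def v_def)
      then show ?thesis using False by simp
    qed
    moreover have "\<phi> x \<le> ereal t" using p(1) xt by (simp add: K_def epigraph_ext_def)
    ultimately show ?thesis
      using real xt by (cases "\<phi> x") (auto simp: h_def)
  next
    case MInf then show ?thesis using not_MInf by simp
  qed simp
  then show ?thesis by blast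
qed

lemma prox_minimizes:
  assumes lam: "0 < lam"
  shows "\<phi> (prox lam \<phi> z) + ereal (1 / (2 * lam) * (norm (z - prox lam \<phi> z))\<^sup>2)
    \<le> \<phi> y + ereal (1 / (2 * lam) * (norm (z - y))\<^sup>2)"
proof -
  let ?h = "\<lambda>y. \<phi> y + ereal (1 / (2 * lam) * (norm (z - y))\<^sup>2)"
  have "\<exists>x. is_arg_min ?h (\<lambda>_. True) x"
    using prox_minimizer_exists[OF lam, of z] unfolding is_arg_min_def by (simp add: not_less)
  then have "is_arg_min ?h (\<lambda>_. True) (prox lam \<phi> z)"
    unfolding prox_def arg_min_def by (rule someI_ex)
  then show ?thesis by (simp add: is_arg_min_def not_less)
qed

text \<open>A minimizer has \<open>0\<close> as a regular subgradient of the objective, and the sum rule for a smooth plus a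
  convex function turns this into the claim.\<close>

lemma prox_subgradient:
  assumes lam: "0 < lam"
  shows "inverse lam *\<^sub>R (z - prox lam \<phi> z) \<in> convex_subdiff \<phi> (prox lam \<phi> z)"
proof -
  let ?x = "prox lam \<phi> z"
  let ?g = "\<lambda>y. 1 / (2 * lam) * (norm (z - y))\<^sup>2"
  let ?h = "\<lambda>y. ereal (?g y) + \<phi> y"
  have min: "?h ?x \<le> ?h y" for y
    using prox_minimizes[OF lam, of z y] by (simp add: add.commute)
  have npsi: "?h y \<noteq> -\<infinity>" for y using not_MInf[of y] by (cases "\<phi> y") auto
  obtain y0 d where d: "\<phi> y0 = ereal d"
    using proper not_MInf unfolding proper_fun_def by (metis ereal_cases)
  have "?h ?x \<le> ereal (?g y0 + d)" using min[of y0] d by simp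
  then have fin: "\<bar>?h ?x\<bar> \<noteq> \<infinity>" using npsi[of ?x] by auto
  then obtain hx where hx: "?h ?x = ereal hx" by (cases "?h ?x") auto
  have "0 \<in> regular_subdiff ?h ?x"
    unfolding regular_subdiff_iff[OF npsi]
  proof (intro conjI allI impI)
    fix e :: real assume e: "e > 0"
    have "eventually (\<lambda>y. y \<noteq> ?x) (at ?x)" by (simp add: eventually_at_filter)
    then show "eventually (\<lambda>y. ?h ?x + ereal (0 \<bullet> (y - ?x) - e * norm (y - ?x)) < ?h y) (at ?x)"
    proof eventually_elim
      case (elim y)
      have "?h ?x + ereal (0 \<bullet> (y - ?x) - e * norm (y - ?x)) < ?h ?x"
        unfolding hx using e elim by simp
      then show ?case using min[of y] by (rule less_le_trans)
    qed
  qed (rule fin)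
  then have "0 - inverse lam *\<^sub>R (?x - z) \<in> convex_subdiff \<phi> ?x"
    using regular_subdiff_composite[OF half_sq_norm_GDERIV not_MInf convex, of lam 0 z] lam by simp
  then show ?thesis by (simp add: scaleR_diff_right)
qed

lemma prox_firmly_nonexpansive:
  assumes lam: "0 < lam"
  shows "(norm (prox lam \<phi> z - prox lam \<phi> w))\<^sup>2 \<le> (z - w) \<bullet> (prox lam \<phi> z - prox lam \<phi> w)"
proof -
  let ?x = "prox lam \<phi> z" and ?y = "prox lam \<phi> w"
  have "0 \<le> (inverse lam *\<^sub>R (z - ?x) - inverse lam *\<^sub>R (w - ?y)) \<bullet> (?x - ?y)"
    by (rule convex_subdiff_monotone[OF prox_subgradient prox_subgradient]) (use lam in auto)
  also have "\<dots> = inverse lam * (((z - w) - (?x - ?y)) \<bullet> (?x - ?y))"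
    unfolding scaleR_diff_right[symmetric] inner_scaleR_left
    by (simp add: inner_diff_left inner_diff_right)
  finally have "0 \<le> ((z - w) - (?x - ?y)) \<bullet> (?x - ?y)"
    using lam by (simp add: zero_le_mult_iff)
  then show ?thesis by (simp add: inner_diff_left power2_norm_eq_inner)
qed

text \<open>By firm nonexpansiveness. The second bound gives the Lipschitz constant \<open>1 / lam\<close> of the proximal
  part of the normal map.\<close>

lemma prox_nonexpansive:
  assumes lam: "0 < lam"
  shows "norm (prox lam \<phi> z - prox lam \<phi> w) \<le> norm (z - w)"
    and "norm ((z - prox lam \<phi> z) - (w - prox lam \<phi> w)) \<le> norm (z - w)"
proof -
  let ?p = "prox lam \<phi> z - prox lam \<phi> w"
  have norm_diff_sq: "(norm (a - b))\<^sup>2 = (norm a)\<^sup>2 + (norm b)\<^sup>2 - 2 * (a \<bullet> b)" for a b :: 'a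
    by (simp add: power2_norm_eq_inner inner_diff_left inner_diff_right inner_commute)
  have f: "(norm ?p)\<^sup>2 \<le> (z - w) \<bullet> ?p" by (rule prox_firmly_nonexpansive[OF lam])
  also have "\<dots> \<le> norm (z - w) * norm ?p" by (rule norm_cauchy_schwarz)
  finally have "norm ?p * norm ?p \<le> norm (z - w) * norm ?p" by (simp add: power2_eq_square)
  then show "norm ?p \<le> norm (z - w)"
    by (metis mult_le_cancel_right norm_ge_zero not_le order_less_le)
  have "(norm ((z - w) - ?p))\<^sup>2 = (norm (z - w))\<^sup>2 + (norm ?p)\<^sup>2 - 2 * ((z - w) \<bullet> ?p)"
    by (rule norm_diff_sq)
  then have "(norm ((z - w) - ?p))\<^sup>2 \<le> (norm (z - w))\<^sup>2"
    using f zero_le_power2[of "norm ?p"] by linarith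
  then have "norm ((z - w) - ?p) \<le> norm (z - w)"
    by (rule power2_le_imp_le) simp
  then show "norm ((z - prox lam \<phi> z) - (w - prox lam \<phi> w)) \<le> norm (z - w)"
    by (simp add: algebra_simps)
qed

lemma prox_eqI:
  assumes lam: "0 < lam" and v: "inverse lam *\<^sub>R (z - x) \<in> convex_subdiff \<phi> x"
  shows "prox lam \<phi> z = x"
proof -
  let ?y = "prox lam \<phi> z"
  have "0 \<le> (inverse lam *\<^sub>R (z - ?y) - inverse lam *\<^sub>R (z - x)) \<bullet> (?y - x)"
    by (rule convex_subdiff_monotone[OF prox_subgradient v]) (use lam in auto)
  also have "\<dots> = - (inverse lam * (norm (?y - x))\<^sup>2)"
    unfolding scaleR_diff_right[symmetric] inner_scaleR_left
    by (simp add: power2_norm_eq_inner inner_diff_left inner_diff_right algebra_simps)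
  finally have "inverse lam * (norm (?y - x))\<^sup>2 \<le> 0" by simp
  then have "(norm (?y - x))\<^sup>2 \<le> 0" using lam by (simp add: mult_le_0_iff)
  then show ?thesis by simp
qed

lemma continuous_on_prox: "0 < lam \<Longrightarrow> continuous_on A (prox lam \<phi>)"
  using prox_nonexpansive(1)[of lam]
  by (intro lipschitz_on_continuous_on[of 1] lipschitz_onI) (auto simp: dist_norm)

end

section \<open>Strict derivatives and symmetry of second derivatives\<close>

lemma isCont_tendsto_nhds: "isCont g a \<Longrightarrow> g a = b \<Longrightarrow> (g \<longlongrightarrow> b) (nhds a)"
  by (metis isCont_def tendsto_at_iff_tendsto_nhds)

text \<open>Strict (rather than Frechet) differentiability controls the difference of two orbits, neither of
  which passes through the base point.\<close>

definition strict_deriv :: "('a::real_normed_vector \<Rightarrow> 'b::real_normed_vector) \<Rightarrow> ('a \<Rightarrow> 'b) \<Rightarrow> 'a \<Rightarrow> bool" where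
  "strict_deriv f f' p \<longleftrightarrow> bounded_linear f' \<and>
     (\<forall>e>0. \<exists>d>0. \<forall>x\<in>ball p d. \<forall>y\<in>ball p d. norm (f x - f y - f' (x - y)) \<le> e * norm (x - y))"

lemma strict_derivD:
  assumes "strict_deriv f f' p" "0 < e"
  obtains d where "0 < d"
    "\<And>x y. x \<in> ball p d \<Longrightarrow> y \<in> ball p d \<Longrightarrow> norm (f x - f y - f' (x - y)) \<le> e * norm (x - y)"
  using assms unfolding strict_deriv_def by meson

lemma strict_deriv_imp_has_derivative:
  assumes "strict_deriv f f' p"
  shows "(f has_derivative f') (at p)"
proof (rule has_derivativeI)
  show "bounded_linear f'" using assms by (simp add: strict_deriv_def)
  show "((\<lambda>y. ((f y - f p) - f' (y - p)) /\<^sub>R norm (y - p)) \<longlongrightarrow> 0) (at p)"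
  proof (rule tendstoI)
    fix e :: real assume e: "0 < e"
    obtain d where d: "0 < d"
      "\<And>x y. x \<in> ball p d \<Longrightarrow> y \<in> ball p d \<Longrightarrow> norm (f x - f y - f' (x - y)) \<le> e / 2 * norm (x - y)"
      using strict_derivD[OF assms, of "e / 2"] e by auto
    show "\<forall>\<^sub>F y in at p. dist (((f y - f p) - f' (y - p)) /\<^sub>R norm (y - p)) 0 < e"
      unfolding eventually_at
    proof (intro exI conjI ballI impI)
      show "0 < d" by fact
      fix y assume y: "y \<noteq> p \<and> dist y p < d"
      then have "norm (f y - f p - f' (y - p)) \<le> e / 2 * norm (y - p)"
        using d by (intro d(2)) (auto simp: dist_commute)
      also have "\<dots> < e * norm (y - p)" using e y by simp
      finally show "dist (((f y - f p) - f' (y - p)) /\<^sub>R norm (y - p)) 0 < e"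
        using y by (simp add: divide_inverse[symmetric] pos_divide_less_eq mult.commute[of "inverse _"])
    qed
  qed
qed

lemma strict_deriv_compose_linear:
  assumes h: "bounded_linear h" and f: "strict_deriv f f' p"
  shows "strict_deriv (\<lambda>x. h (f x)) (\<lambda>x. h (f' x)) p"
  unfolding strict_deriv_def
proof (intro conjI allI impI)
  show "bounded_linear (\<lambda>x. h (f' x))"
    using h f by (intro bounded_linear_compose[OF h]) (simp add: strict_deriv_def)
  interpret h: bounded_linear h by fact
  fix e :: real assume e: "0 < e"
  obtain K where K: "0 < K" "\<And>x. norm (h x) \<le> norm x * K" using h.pos_bounded by blast
  obtain d where d: "0 < d"
    "\<And>x y. x \<in> ball p d \<Longrightarrow> y \<in> ball p d \<Longrightarrow> norm (f x - f y - f' (x - y)) \<le> e / K * norm (x - y)"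
    using strict_derivD[OF f, of "e / K"] e K by auto
  have "norm (h (f x) - h (f y) - h (f' (x - y))) \<le> e * norm (x - y)"
    if "x \<in> ball p d" "y \<in> ball p d" for x y
  proof -
    have "norm (h (f x - f y - f' (x - y))) \<le> norm (f x - f y - f' (x - y)) * K" by (rule K(2))
    also have "\<dots> \<le> (e / K * norm (x - y)) * K" using d(2)[OF that] K by (intro mult_right_mono) auto
    also have "\<dots> = e * norm (x - y)" using K by simp
    finally show ?thesis by (simp add: h.diff)
  qed
  then show "\<exists>d>0. \<forall>x\<in>ball p d. \<forall>y\<in>ball p d. norm (h (f x) - h (f y) - h (f' (x - y))) \<le> e * norm (x - y)"
    using d(1) by blast
qed

lemma strict_deriv_add:
  assumes f: "strict_deriv f f' p" and g: "strict_deriv g g' p"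
  shows "strict_deriv (\<lambda>x. f x + g x) (\<lambda>x. f' x + g' x) p"
  unfolding strict_deriv_def
proof (intro conjI allI impI)
  show "bounded_linear (\<lambda>x. f' x + g' x)"
    using assms by (intro bounded_linear_add) (simp_all add: strict_deriv_def)
  fix e :: real assume e: "0 < e"
  obtain d where d: "0 < d"
    "\<And>x y. x \<in> ball p d \<Longrightarrow> y \<in> ball p d \<Longrightarrow> norm (f x - f y - f' (x - y)) \<le> e / 2 * norm (x - y)"
    using strict_derivD[OF f, of "e / 2"] e by auto
  obtain d' where d': "0 < d'"
    "\<And>x y. x \<in> ball p d' \<Longrightarrow> y \<in> ball p d' \<Longrightarrow> norm (g x - g y - g' (x - y)) \<le> e / 2 * norm (x - y)"
    using strict_derivD[OF g, of "e / 2"] e by auto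
  have "norm (f x + g x - (f y + g y) - (f' (x - y) + g' (x - y))) \<le> e * norm (x - y)"
    if "x \<in> ball p (min d d')" "y \<in> ball p (min d d')" for x y
  proof -
    have *: "f x + g x - (f y + g y) - (f' (x - y) + g' (x - y)) =
      (f x - f y - f' (x - y)) + (g x - g y - g' (x - y))" by simp
    have "norm (f x - f y - f' (x - y)) \<le> e / 2 * norm (x - y)"
      "norm (g x - g y - g' (x - y)) \<le> e / 2 * norm (x - y)"
      using d(2)[of x y] d'(2)[of x y] that by auto
    then show ?thesis
      using norm_triangle_ineq[of "f x - f y - f' (x - y)" "g x - g y - g' (x - y)"]
      unfolding * by simp
  qed
  then show "\<exists>d>0. \<forall>x\<in>ball p d. \<forall>y\<in>ball p d.
      norm (f x + g x - (f y + g y) - (f' (x - y) + g' (x - y))) \<le> e * norm (x - y)"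
    using d(1) d'(1) by (intro exI[of _ "min d d'"]) auto
qed

text \<open>The mean value inequality applied to \<open>f - f' p\<close>.\<close>

lemma strict_deriv_if_continuous_derivative:
  fixes f' :: "'a::real_normed_vector \<Rightarrow> 'a \<Rightarrow>\<^sub>L 'b::real_normed_vector"
  assumes der: "\<forall>\<^sub>F x in nhds p. (f has_derivative f' x) (at x)" and cont: "isCont f' p"
  shows "strict_deriv f (f' p) p"
  unfolding strict_deriv_def
proof (intro conjI allI impI)
  fix e :: real assume e: "0 < e"
  obtain d where d: "0 < d" "\<And>x. dist x p < d \<Longrightarrow> (f has_derivative f' x) (at x)"
    using der unfolding eventually_nhds_metric by blast
  obtain d' where d': "0 < d'" "\<And>x. dist x p < d' \<Longrightarrow> dist (f' x) (f' p) < e"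
    using cont e unfolding continuous_at_eps_delta by blast
  let ?d = "min d d'"
  have "norm (f x - f y - f' p (x - y)) \<le> e * norm (x - y)" if xy: "x \<in> ball p ?d" "y \<in> ball p ?d" for x y
  proof -
    have "norm ((f x - f' p x) - (f y - f' p y)) \<le> e * norm (x - y)"
    proof (rule differentiable_bound[OF convex_ball _ _ xy])
      fix w assume w: "w \<in> ball p ?d"
      have "((\<lambda>x. f x - f' p x) has_derivative (\<lambda>h. f' w h - f' p h)) (at w)"
        using d(2)[of w] w
        by (intro has_derivative_diff bounded_linear_imp_has_derivative blinfun.bounded_linear_right)
          (simp add: dist_commute)
      then show "((\<lambda>x. f x - f' p x) has_derivative blinfun_apply (f' w - f' p)) (at w within ball p ?d)"
        by (auto intro: has_derivative_at_withinI simp: blinfun.diff_left[abs_def])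
      show "onorm (blinfun_apply (f' w - f' p)) \<le> e"
        using d'(2)[of w] w unfolding norm_blinfun.rep_eq[symmetric]
        by (simp add: dist_norm norm_minus_commute[of w p])
    qed
    then show ?thesis by (simp add: blinfun.diff_right algebra_simps)
  qed
  then show "\<exists>d>0. \<forall>x\<in>ball p d. \<forall>y\<in>ball p d. norm (f x - f y - f' p (x - y)) \<le> e * norm (x - y)"
    using d(1) d'(1) by (intro exI[of _ ?d]) auto
qed (rule blinfun.bounded_linear_right)

text \<open>The mean value theorem in the direction \<open>h\<close> turns the second difference into a first difference of
  \<open>F' _ h\<close>, which is linear up to the error \<open>e\<close>.\<close>

lemma second_difference_estimate:
  fixes F :: "'a::real_normed_vector \<Rightarrow> real"
  assumes der: "\<And>x. x \<in> ball p r \<Longrightarrow> (F has_derivative F' x) (at x)"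
    and est: "\<And>x. x \<in> ball p r \<Longrightarrow> \<bar>F' x h - F' p h - B (x - p)\<bar> \<le> e * norm (x - p)"
    and B: "bounded_linear B" and e: "0 \<le> e"
    and t: "0 < t" "t * (norm h + norm k) < r"
  shows "\<bar>F (p + t *\<^sub>R h + t *\<^sub>R k) - F (p + t *\<^sub>R h) - F (p + t *\<^sub>R k) + F p - t\<^sup>2 * B k\<bar>
    \<le> e * t\<^sup>2 * (2 * norm h + norm k)"
proof -
  interpret B: bounded_linear B by fact
  define u where "u s = F (p + s *\<^sub>R h + t *\<^sub>R k) - F (p + s *\<^sub>R h)" for s
  have nb: "norm (s *\<^sub>R h + t *\<^sub>R k) \<le> t * (norm h + norm k)" "norm (s *\<^sub>R h) \<le> t * norm h"
    if "s \<in> {0..t}" for s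
  proof -
    show *: "norm (s *\<^sub>R h) \<le> t * norm h" using that by (simp add: mult_right_mono)
    show "norm (s *\<^sub>R h + t *\<^sub>R k) \<le> t * (norm h + norm k)"
      using * t norm_triangle_ineq[of "s *\<^sub>R h" "t *\<^sub>R k"] by (simp add: distrib_left)
  qed
  have th: "t * norm h \<le> t * (norm h + norm k)" using t by simp
  have in1: "p + s *\<^sub>R h + t *\<^sub>R k \<in> ball p r" and in2: "p + s *\<^sub>R h \<in> ball p r" if "s \<in> {0..t}" for s
  proof -
    have "dist p (p + s *\<^sub>R h + t *\<^sub>R k) = norm (s *\<^sub>R h + t *\<^sub>R k)"
      by (metis add.assoc add_diff_cancel_left' dist_norm dist_commute)
    then show "p + s *\<^sub>R h + t *\<^sub>R k \<in> ball p r" using nb[OF that] t by simp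
    show "p + s *\<^sub>R h \<in> ball p r" 
      using nb(2)[OF that] t(2) th by (simp add: dist_norm del: norm_scaleR)
  qed
  have "\<exists>s\<in>{0..t}. u t - u 0 = (\<lambda>c. c * (F' (p + s *\<^sub>R h + t *\<^sub>R k) h - F' (p + s *\<^sub>R h) h)) (t - 0)"
  proof (rule mvt_very_simple)
    fix s assume s: "0 \<le> s" "s \<le> t"
    then have s': "s \<in> {0..t}" by simp
    have lin: "F' x (c *\<^sub>R h) = c * F' x h" if "x \<in> ball p r" for c x
      using has_derivative_bounded_linear[OF der[OF that]] by (simp add: linear_cmul bounded_linear.linear)
    have "((\<lambda>s. F (p + s *\<^sub>R h + t *\<^sub>R k)) has_derivative (\<lambda>c. F' (p + s *\<^sub>R h + t *\<^sub>R k) (c *\<^sub>R h))) (at s)"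
      by (rule has_derivative_compose[of "\<lambda>s. p + s *\<^sub>R h + t *\<^sub>R k", OF _ der[OF in1[OF s']]])
        (auto intro!: derivative_eq_intros)
    moreover have "((\<lambda>s. F (p + s *\<^sub>R h)) has_derivative (\<lambda>c. F' (p + s *\<^sub>R h) (c *\<^sub>R h))) (at s)"
      by (rule has_derivative_compose[of "\<lambda>s. p + s *\<^sub>R h", OF _ der[OF in2[OF s']]])
        (auto intro!: derivative_eq_intros)
    ultimately have "(u has_derivative (\<lambda>c. F' (p + s *\<^sub>R h + t *\<^sub>R k) (c *\<^sub>R h) - F' (p + s *\<^sub>R h) (c *\<^sub>R h))) (at s)"
      unfolding u_def[abs_def] by (rule has_derivative_diff)
    then show "(u has_derivative (\<lambda>c. c * (F' (p + s *\<^sub>R h + t *\<^sub>R k) h - F' (p + s *\<^sub>R h) h))) (at s within {0..t})"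
      unfolding lin[OF in1[OF s']] lin[OF in2[OF s']] right_diff_distrib
      by (rule has_derivative_at_withinI)
  qed (use t in simp)
  then obtain s where s: "s \<in> {0..t}"
    "u t - u 0 = t * (F' (p + s *\<^sub>R h + t *\<^sub>R k) h - F' (p + s *\<^sub>R h) h)" by auto
  have "\<bar>F' (p + s *\<^sub>R h + t *\<^sub>R k) h - F' p h - B (s *\<^sub>R h + t *\<^sub>R k)\<bar> \<le> e * norm (s *\<^sub>R h + t *\<^sub>R k)"
    using est[OF in1[OF s(1)]] by (simp add: add.assoc)
  moreover have "\<dots> \<le> e * (t * (norm h + norm k))"
    by (rule mult_left_mono[OF nb(1)[OF s(1)] e])
  moreover have "\<bar>F' (p + s *\<^sub>R h) h - F' p h - B (s *\<^sub>R h)\<bar> \<le> e * norm (s *\<^sub>R h)"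
    using est[OF in2[OF s(1)]] by simp
  moreover have "\<dots> \<le> e * (t * norm h)"
    by (rule mult_left_mono[OF nb(2)[OF s(1)] e])
  moreover have "B (s *\<^sub>R h + t *\<^sub>R k) = B (s *\<^sub>R h) + t * B k" by (simp add: B.add B.scaleR)
  ultimately have "\<bar>F' (p + s *\<^sub>R h + t *\<^sub>R k) h - F' (p + s *\<^sub>R h) h - t * B k\<bar>
      \<le> e * (t * (norm h + norm k)) + e * (t * norm h)" by linarith
  also have "\<dots> = e * t * (2 * norm h + norm k)" by (simp add: algebra_simps)
  finally have "t * \<bar>F' (p + s *\<^sub>R h + t *\<^sub>R k) h - F' (p + s *\<^sub>R h) h - t * B k\<bar> \<le> t * (e * t * (2 * norm h + norm k))"
    using t by (intro mult_left_mono) auto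
  also have "t * \<bar>F' (p + s *\<^sub>R h + t *\<^sub>R k) h - F' (p + s *\<^sub>R h) h - t * B k\<bar>
     = \<bar>t * (F' (p + s *\<^sub>R h + t *\<^sub>R k) h - F' (p + s *\<^sub>R h) h - t * B k)\<bar>" using t by (simp add: abs_mult)
  also have "t * (F' (p + s *\<^sub>R h + t *\<^sub>R k) h - F' (p + s *\<^sub>R h) h - t * B k) = u t - u 0 - t\<^sup>2 * B k"
    unfolding s(2) by (simp add: power2_eq_square algebra_simps)
  finally show ?thesis
    by (simp add: u_def power2_eq_square algebra_simps)
qed

text \<open>The second difference is symmetric in \<open>h\<close> and \<open>k\<close>, and divided by \<open>t\<^sup>2\<close> it is close to both mixed
  derivatives.\<close>

lemma second_derivative_symmetric:
  fixes F :: "'a::real_normed_vector \<Rightarrow> real"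
  assumes der: "\<forall>\<^sub>F x in nhds p. (F has_derivative F' x) (at x)"
    and der2: "\<And>h. ((\<lambda>x. F' x h) has_derivative (\<lambda>k. F'' k h)) (at p)"
  shows "F'' h k = F'' k h"
proof -
  obtain r where r: "0 < r" "\<And>x. x \<in> ball p r \<Longrightarrow> (F has_derivative F' x) (at x)"
    using der unfolding eventually_nhds_metric by (auto simp: dist_commute)
  have est: "\<exists>d>0. \<forall>x\<in>ball p d. \<bar>F' x h - F' p h - F'' (x - p) h\<bar> \<le> e * norm (x - p)" if "0 < e" for e h
  proof -
    have "\<exists>d>0. \<forall>y. norm (y - p) < d \<longrightarrow> norm (F' y h - F' p h - F'' (y - p) h) \<le> e * norm (y - p)"
      using der2[of h] that unfolding has_derivative_at_alt by blast
    then show ?thesis by (auto simp: dist_norm norm_minus_commute)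
  qed
  have "\<bar>F'' k h - F'' h k\<bar> \<le> 0 + e" if e: "0 < e" for e
  proof -
    define n where "n = 3 * norm h + 3 * norm k + 1"
    have n: "0 < n" unfolding n_def by (intro add_nonneg_pos) auto
    define e' where "e' = e / n"
    have e': "0 < e'" using e n by (simp add: e'_def)
    obtain d1 where d1: "0 < d1" "\<And>x. x \<in> ball p d1 \<Longrightarrow> \<bar>F' x h - F' p h - F'' (x - p) h\<bar> \<le> e' * norm (x - p)"
      using est[OF e', of h] by blast
    obtain d2 where d2: "0 < d2" "\<And>x. x \<in> ball p d2 \<Longrightarrow> \<bar>F' x k - F' p k - F'' (x - p) k\<bar> \<le> e' * norm (x - p)"
      using est[OF e', of k] by blast
    define d where "d = min r (min d1 d2)"
    have d: "0 < d" using r d1 d2 by (simp add: d_def)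
    define t where "t = d / n"
    have t: "0 < t" using d n by (simp add: t_def)
    have "norm h + norm k < n"
      using norm_ge_zero[of h] norm_ge_zero[of k] unfolding n_def by linarith
    then have "d * (norm h + norm k) < d * n" using d by (rule mult_strict_left_mono)
    then have td: "t * (norm h + norm k) < d" "t * (norm k + norm h) < d"
      using n by (simp_all add: t_def pos_divide_less_eq add.commute[of "norm k"])
    have 1: "\<bar>F (p + t *\<^sub>R h + t *\<^sub>R k) - F (p + t *\<^sub>R h) - F (p + t *\<^sub>R k) + F p - t\<^sup>2 * F'' k h\<bar>
      \<le> e' * t\<^sup>2 * (2 * norm h + norm k)"
      by (rule second_difference_estimate[where r=d])
        (use r d1 d2 e' t td has_derivative_bounded_linear[OF der2] in \<open>auto simp: d_def\<close>)
    have 2: "\<bar>F (p + t *\<^sub>R k + t *\<^sub>R h) - F (p + t *\<^sub>R k) - F (p + t *\<^sub>R h) + F p - t\<^sup>2 * F'' h k\<bar>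
      \<le> e' * t\<^sup>2 * (2 * norm k + norm h)"
      by (rule second_difference_estimate[where r=d])
        (use r d1 d2 e' t td has_derivative_bounded_linear[OF der2] in \<open>auto simp: d_def\<close>)
    have 3: "p + t *\<^sub>R k + t *\<^sub>R h = p + t *\<^sub>R h + t *\<^sub>R k" by (simp add: algebra_simps)
    have "\<bar>t\<^sup>2 * F'' k h - t\<^sup>2 * F'' h k\<bar> \<le> e' * t\<^sup>2 * (2 * norm h + norm k) + e' * t\<^sup>2 * (2 * norm k + norm h)"
      using 1 2 unfolding 3 by linarith
    also have "\<dots> = t\<^sup>2 * (e' * (3 * norm h + 3 * norm k))" by (simp add: algebra_simps)
    also have "\<dots> \<le> t\<^sup>2 * (e' * n)" using e' by (intro mult_left_mono) (auto simp: n_def)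
    also have "e' * n = e" using n by (simp add: e'_def)
    finally have "t\<^sup>2 * \<bar>F'' k h - F'' h k\<bar> \<le> t\<^sup>2 * e"
      by (simp add: right_diff_distrib[symmetric] abs_mult)
    then show ?thesis using t by simp
  qed
  then have "\<bar>F'' k h - F'' h k\<bar> \<le> 0" by (rule field_le_epsilon)
  then show ?thesis by simp
qed

text \<open>The passage from derivatives as linear functionals to gradients.\<close>

lemma C2_on_gradient:
  fixes F :: "'a::euclidean_space \<Rightarrow> real"
  assumes "C2_on F U" "p \<in> U"
  obtains \<gamma> \<Gamma> :: "'a \<Rightarrow> 'a" where "\<And>x. x \<in> U \<Longrightarrow> (F has_derivative (\<lambda>h. \<gamma> x \<bullet> h)) (at x)"
    "strict_deriv \<gamma> \<Gamma> p" "\<And>h k. \<Gamma> h \<bullet> k = h \<bullet> \<Gamma> k"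
proof -
  obtain F' :: "'a \<Rightarrow> 'a \<Rightarrow>\<^sub>L real" and F'' :: "'a \<Rightarrow> 'a \<Rightarrow>\<^sub>L ('a \<Rightarrow>\<^sub>L real)" where U: "open U"
    and F': "\<And>x. x \<in> U \<Longrightarrow> (F has_derivative blinfun_apply (F' x)) (at x)"
    and F'': "\<And>x. x \<in> U \<Longrightarrow> (F' has_derivative blinfun_apply (F'' x)) (at x)"
    and cont: "continuous_on U F''"
    using assms(1) unfolding C2_on_def by blast
  have evU: "\<forall>\<^sub>F x in nhds p. x \<in> U" using U assms(2) eventually_nhds by blast
  have "isCont F'' p" using cont U assms(2) continuous_on_eq_continuous_at by blast
  then have sF': "strict_deriv F' (F'' p) p"
    using evU F'' by (intro strict_deriv_if_continuous_derivative) (auto elim: eventually_mono)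
  define R where "R l = (\<Sum>b\<in>Basis. blinfun_apply l b *\<^sub>R b)" for l :: "'a \<Rightarrow>\<^sub>L real"
  have R: "R l \<bullet> h = l h" for l h
  proof -
    have "l h = l (\<Sum>b\<in>Basis. (h \<bullet> b) *\<^sub>R b)" by (simp add: euclidean_representation)
    also have "\<dots> = R l \<bullet> h"
      by (simp add: R_def blinfun.sum_right blinfun.scaleR_right inner_sum_left inner_sum_right mult.commute inner_commute)
    finally show ?thesis ..
  qed
  have blR: "bounded_linear R"
    unfolding R_def[abs_def]
    by (intro bounded_linear_sum bounded_linear_scaleR_const blinfun.bounded_linear_left)
  show thesis
  proof
    show "(F has_derivative (\<lambda>h. R (F' x) \<bullet> h)) (at x)" if "x \<in> U" for x
      using F'[OF that] by (simp add: R)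
    show "strict_deriv (\<lambda>x. R (F' x)) (\<lambda>h. R (F'' p h)) p"
      by (rule strict_deriv_compose_linear[OF blR sF'])
    fix h k
    have "F'' p h k = F'' p k h"
    proof (rule second_derivative_symmetric[of F F' p "\<lambda>k h. F'' p k h"])
      show "\<forall>\<^sub>F x in nhds p. (F has_derivative F' x) (at x)"
        using evU F' by (auto elim: eventually_mono)
      show "((\<lambda>x. F' x h) has_derivative (\<lambda>k. F'' p k h)) (at p)" for h
        using F''[OF assms(2)] by (intro bounded_linear.has_derivative[OF blinfun.bounded_linear_left])
    qed
    then show "R (F'' p h) \<bullet> k = h \<bullet> R (F'' p k)"
      by (metis R inner_commute)
  qed
qed

lemma C2_on_UNIV_hess:
  fixes f :: "'a::euclidean_space \<Rightarrow> real"
  assumes "C2_on f UNIV"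
  shows "strict_deriv (grad f) (hess f p) p" and "hess f p h \<bullet> k = h \<bullet> hess f p k"
proof -
  obtain \<gamma> \<Gamma> :: "'a \<Rightarrow> 'a" where \<gamma>: "\<And>x. (f has_derivative (\<lambda>h. \<gamma> x \<bullet> h)) (at x)"
    "strict_deriv \<gamma> \<Gamma> p" "\<And>h k. \<Gamma> h \<bullet> k = h \<bullet> \<Gamma> k"
    using C2_on_gradient[OF assms UNIV_I] by auto
  have "grad f x = \<gamma> x" for x
  proof -
    have "(\<lambda>h. h \<bullet> grad f x) = (\<lambda>h. \<gamma> x \<bullet> h)"
      using C2_on_UNIV_grad(1)[OF assms] \<gamma>(1) unfolding gderiv_def by (rule has_derivative_unique)
    then show ?thesis by (metis euclidean_eqI inner_commute)
  qed
  then have eq: "grad f = \<gamma>" by (rule ext)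
  then have "blinfun_apply (hess f p) = \<Gamma>"
    using C2_on_UNIV_grad(2)[OF assms] strict_deriv_imp_has_derivative[OF \<gamma>(2)]
    by (metis has_derivative_unique)
  then show "strict_deriv (grad f) (hess f p) p" "hess f p h \<bullet> k = h \<bullet> hess f p k"
    using \<gamma> eq by simp_all
qed

section \<open>Charts of active manifolds and constrained resolvents\<close>

lemma orthogonal_projection_onto:
  fixes T :: "'a::euclidean_space set"
  assumes "subspace T"
  obtains \<pi> :: "'a \<Rightarrow> 'a" where "linear \<pi>" "\<And>x. \<pi> x \<in> T" "\<And>x \<sigma>. \<sigma> \<in> T \<Longrightarrow> \<pi> x \<bullet> \<sigma> = x \<bullet> \<sigma>"
    "\<And>x. x \<in> T \<Longrightarrow> \<pi> x = x"
proof -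
  obtain C where C: "C \<subseteq> T" "pairwise orthogonal C" "\<And>x. x \<in> C \<Longrightarrow> norm x = 1"
    "independent C" "card C = dim T" "span C = T"
    using orthonormal_basis_subspace[OF assms] by metis
  have fin: "finite C" using C(4) by (rule independent_imp_finite)
  define \<pi> where "\<pi> x = (\<Sum>c\<in>C. (x \<bullet> c) *\<^sub>R c)" for x
  have lin: "linear \<pi>"
    unfolding \<pi>_def by (intro linearI) (simp_all add: inner_add_left scaleR_add_left sum.distrib scaleR_sum_right)
  have inT: "\<pi> x \<in> T" for x
    unfolding \<pi>_def using C(1) assms by (intro subspace_sum subspace_scale) auto
  have "\<pi> x \<bullet> c = x \<bullet> c" if "c \<in> C" for x c
  proof -
    have "\<pi> x \<bullet> c = (\<Sum>b\<in>C. if b = c then x \<bullet> c else 0)"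
      unfolding \<pi>_def inner_sum_left
    proof (rule sum.cong)
      fix b assume "b \<in> C"
      then show "((x \<bullet> b) *\<^sub>R b) \<bullet> c = (if b = c then x \<bullet> c else 0)"
        using C(2) C(3)[OF that] that unfolding pairwise_def orthogonal_def
        by (auto simp: norm_eq_1)
    qed simp
    then show ?thesis using fin that by simp
  qed
  note orth_C = this
  have orth: "\<pi> x \<bullet> \<sigma> = x \<bullet> \<sigma>" if "\<sigma> \<in> T" for x \<sigma>
  proof -
    have "\<sigma> \<in> span C" using that C(6) by simp
    then show ?thesis
      by (induction rule: span_induct_alt) (simp_all add: inner_add_right orth_C)
  qed
  have "\<pi> x = x" if "x \<in> T" for x
  proof -
    have "\<pi> x - x \<in> T" using inT that assms by (simp add: subspace_diff)
    then have "(\<pi> x - x) \<bullet> (\<pi> x - x) = 0" using orth[of "\<pi> x - x" x] by (simp add: inner_diff_left)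
    then show ?thesis by simp
  qed
  then show thesis using that lin inT orth by blast
qed

text \<open>The resolvent \<open>(I + S)\<^sup>-\<^sup>1\<close> of a form that is only nonnegative on \<open>T\<close>, composed with the orthogonal
  projection \<open>\<pi>\<close> onto \<open>T\<close>. It is obtained by inverting \<open>I + \<pi> S \<pi>\<close> on the whole space, which is coercive.
  The last conclusion is the stability estimate: an element of \<open>T\<close> that solves the equation up to \<open>\<eta>\<close>
  is within \<open>\<eta>\<close> of the resolvent.\<close>

lemma constrained_resolvent:
  fixes T :: "'a::euclidean_space set" and S :: "'a \<Rightarrow> 'a"
  assumes T: "subspace T" and lin: "linear S"
    and sym: "\<And>h k. h \<in> T \<Longrightarrow> k \<in> T \<Longrightarrow> S h \<bullet> k = h \<bullet> S k" and nonneg: "\<And>h. h \<in> T \<Longrightarrow> 0 \<le> S h \<bullet> h"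
  obtains P :: "'a \<Rightarrow> 'a" where "linear P" "\<And>d. P d \<in> T"
    "\<And>d \<sigma>. \<sigma> \<in> T \<Longrightarrow> (S (P d) + P d - d) \<bullet> \<sigma> = 0"
    "\<And>x y. P x \<bullet> y = x \<bullet> P y" "\<And>d. (norm (P d))\<^sup>2 \<le> d \<bullet> P d" "\<And>y. y \<in> T \<Longrightarrow> \<exists>d. P d = y"
    "\<And>y d \<eta>. y \<in> T \<Longrightarrow> 0 \<le> \<eta> \<Longrightarrow> (\<And>\<sigma>. \<sigma> \<in> T \<Longrightarrow> \<bar>(S y + y - d) \<bullet> \<sigma>\<bar> \<le> \<eta> * norm \<sigma>) \<Longrightarrow> norm (y - P d) \<le> \<eta>"
proof -
  obtain \<pi> :: "'a \<Rightarrow> 'a" where \<pi>: "linear \<pi>" "\<And>x. \<pi> x \<in> T" "\<And>x \<sigma>. \<sigma> \<in> T \<Longrightarrow> \<pi> x \<bullet> \<sigma> = x \<bullet> \<sigma>"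
    "\<And>x. x \<in> T \<Longrightarrow> \<pi> x = x"
    using orthogonal_projection_onto[OF T] by blast
  have \<pi>_sym: "\<pi> x \<bullet> y = x \<bullet> \<pi> y" for x y
    using \<pi>(3)[OF \<pi>(2), of x y] \<pi>(3)[OF \<pi>(2), of y x] by (simp add: inner_commute)
  define B where "B y = y + \<pi> (S (\<pi> y))" for y
  have linB: "linear B"
    unfolding B_def[abs_def] using linear_compose[OF linear_compose[OF \<pi>(1) lin] \<pi>(1)]
    by (intro linear_compose_add linear_ident) (simp add: comp_def)
  have By: "(norm y)\<^sup>2 \<le> B y \<bullet> y" for y
    using nonneg[OF \<pi>(2), of y] by (simp add: B_def inner_add_left \<pi>_sym power2_norm_eq_inner)
  have "inj B"
    unfolding linear_injective_0[OF linB]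
  proof (intro allI impI)
    fix y assume "B y = 0" then show "y = 0" using By[of y] by simp
  qed
  then obtain B' where B': "linear B'" "\<And>x. B' (B x) = x" "\<And>x. B (B' x) = x"
    using linear_injective_isomorphism[OF linB] by blast
  define P where "P d = B' (\<pi> d)" for d
  have linP: "linear P"
    unfolding P_def[abs_def] using linear_compose[OF \<pi>(1) B'(1)] by (simp add: comp_def)
  have PT: "P d \<in> T" for d
  proof -
    have "P d = \<pi> d - \<pi> (S (\<pi> (P d)))"
      using B'(3)[of "\<pi> d"] by (simp add: P_def B_def algebra_simps)
    then show ?thesis using \<pi>(2) T by (metis subspace_diff)
  qed
  have eq: "(S (P d) + P d - d) \<bullet> \<sigma> = 0" if "\<sigma> \<in> T" for d \<sigma>
  proof -
    have "B (P d) \<bullet> \<sigma> = d \<bullet> \<sigma>" using that by (simp add: P_def B'(3) \<pi>(3))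
    then show ?thesis
      using that by (simp add: B_def \<pi>(3) \<pi>(4)[OF PT] inner_add_left inner_diff_left)
  qed
  then have dP: "d \<bullet> P e = S (P d) \<bullet> P e + P d \<bullet> P e" for d e
    using PT[of e] by (simp add: inner_add_left inner_diff_left)
  show thesis
  proof
    show "linear P" "P d \<in> T" "\<sigma> \<in> T \<Longrightarrow> (S (P d) + P d - d) \<bullet> \<sigma> = 0" for d \<sigma>
      using linP PT eq by auto
    show "P x \<bullet> y = x \<bullet> P y" for x y
      using dP[of x y] dP[of y x] sym[OF PT PT, of x y] by (simp add: inner_commute)
    show "(norm (P d))\<^sup>2 \<le> d \<bullet> P d" for d
      using dP[of d d] nonneg[OF PT, of d] by (simp add: power2_norm_eq_inner)
    show "\<exists>d. P d = y" if "y \<in> T" for y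
    proof -
      have "B y \<in> T" using that \<pi>(2) T by (simp add: B_def subspace_add)
      then have "P (B y) = y" by (simp add: P_def \<pi>(4) B'(2))
      then show ?thesis by blast
    qed
    fix y d and \<eta> :: real assume y: "y \<in> T" and \<eta>: "0 \<le> \<eta>" and *: "\<And>\<sigma>. \<sigma> \<in> T \<Longrightarrow> \<bar>(S y + y - d) \<bullet> \<sigma>\<bar> \<le> \<eta> * norm \<sigma>"
    let ?t = "y - P d"
    have t: "?t \<in> T" using y PT T by (simp add: subspace_diff)
    have "(norm ?t)\<^sup>2 \<le> S ?t \<bullet> ?t + ?t \<bullet> ?t"
      using nonneg[OF t] by (simp add: power2_norm_eq_inner)
    also have "\<dots> = (S y + y - d) \<bullet> ?t - (S (P d) + P d - d) \<bullet> ?t"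
      by (simp add: linear_diff[OF lin] inner_diff_left inner_add_left)
    also have "\<dots> \<le> \<eta> * norm ?t" using *[OF t] eq[OF t] by simp
    finally have "norm ?t * norm ?t \<le> \<eta> * norm ?t" by (simp add: power2_eq_square)
    then show "norm ?t \<le> \<eta>"
      using \<eta> by (cases "norm ?t = 0") auto
  qed
qed

text \<open>The chart of the definition is translated and composed with its derivative, so that \<open>T\<close> is the tangent
  space at \<open>p\<close> and the parametrization \<open>\<theta>\<close> has derivative \<open>id\<close> at \<open>0\<close>. The last two conclusions say that
  \<open>\<theta>\<close> maps \<open>T\<close> near \<open>0\<close> onto \<open>N\<close> near \<open>p\<close>.\<close>

lemma C2_manifold_chart:
  fixes N :: "'a::euclidean_space set"
  assumes N: "C2_manifold N" and p: "p \<in> N"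
  obtains T and \<theta> :: "'a \<Rightarrow> 'a" and \<theta>' :: "'a \<Rightarrow> 'a \<Rightarrow>\<^sub>L 'a" and \<theta>'' :: "'a \<Rightarrow> 'a \<Rightarrow>\<^sub>L 'a"
  where "subspace T" "\<theta> 0 = p" "\<forall>\<^sub>F t in nhds 0. (\<theta> has_derivative \<theta>' t) (at t)"
    "\<theta>' 0 = id_blinfun" "strict_deriv \<theta>' \<theta>'' 0" "\<forall>\<^sub>F t in nhds 0. t \<in> T \<longrightarrow> \<theta> t \<in> N"
    "\<And>e. 0 < e \<Longrightarrow> \<forall>\<^sub>F x in nhds p. x \<in> N \<longrightarrow> (\<exists>t\<in>T. norm t < e \<and> \<theta> t = x)"
proof -
  from N p obtain V W S and \<Phi> \<Psi> :: "'a \<Rightarrow> 'a" where pV: "p \<in> V" and C\<Phi>: "C2_on \<Phi> V" and C\<Psi>: "C2_on \<Psi> W"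
    and hom: "homeomorphism V W \<Phi> \<Psi>" and S: "subspace S" and im: "\<Phi> ` (N \<inter> V) = S \<inter> W"
    unfolding C2_manifold_def by metis
  from C\<Phi> obtain \<Phi>' :: "'a \<Rightarrow> 'a \<Rightarrow>\<^sub>L 'a" where V: "open V"
    and \<Phi>': "\<And>x. x \<in> V \<Longrightarrow> (\<Phi> has_derivative \<Phi>' x) (at x)"
    unfolding C2_on_def by blast
  from C\<Psi> obtain \<Psi>' :: "'a \<Rightarrow> 'a \<Rightarrow>\<^sub>L 'a" and \<Psi>'' :: "'a \<Rightarrow> 'a \<Rightarrow>\<^sub>L ('a \<Rightarrow>\<^sub>L 'a)" where W: "open W"
    and \<Psi>': "\<And>x. x \<in> W \<Longrightarrow> (\<Psi> has_derivative \<Psi>' x) (at x)"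
    and \<Psi>'': "\<And>x. x \<in> W \<Longrightarrow> (\<Psi>' has_derivative \<Psi>'' x) (at x)"
    and cont: "continuous_on W \<Psi>''"
    unfolding C2_on_def by blast
  define s where "s = \<Phi> p"
  have s: "s \<in> S" "s \<in> W" using im p pV by (auto simp: s_def)
  have \<Psi>\<Phi>: "\<Psi> (\<Phi> x) = x" if "x \<in> V" for x using hom that by (auto simp: homeomorphism_def)
  have \<Phi>\<Psi>: "\<Phi> (\<Psi> x) = x" "\<Psi> x \<in> V" if "x \<in> W" for x
    using hom that by (auto simp: homeomorphism_def)
  define E where "E = \<Phi>' p"
  define D where "D = \<Psi>' s"
  have E: "(\<Phi> has_derivative E) (at p)" using \<Phi>'[OF pV] by (simp add: E_def)
  have D: "(\<Psi> has_derivative D) (at s)" using \<Psi>'[OF s(2)] by (simp add: D_def)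
  have \<Psi>s: "\<Psi> s = p" using \<Psi>\<Phi>[OF pV] by (simp add: s_def)
  have DE: "D (E h) = h" for h
  proof -
    have "((\<lambda>x. \<Psi> (\<Phi> x)) has_derivative (\<lambda>h. D (E h))) (at p)"
      using has_derivative_compose[OF E, of \<Psi> D] D by (simp add: s_def)
    moreover have "((\<lambda>x. \<Psi> (\<Phi> x)) has_derivative (\<lambda>h. h)) (at p)"
      by (rule has_derivative_transform_within_open[OF has_derivative_ident V pV]) (simp add: \<Psi>\<Phi>)
    ultimately have "(\<lambda>h. D (E h)) = (\<lambda>h. h)" by (rule has_derivative_unique)
    then show ?thesis by metis
  qed
  have ED: "E (D h) = h" for h
  proof -
    have "((\<lambda>x. \<Phi> (\<Psi> x)) has_derivative (\<lambda>h. E (D h))) (at s)"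
      using has_derivative_compose[OF D, of \<Phi> E] E \<Psi>s by simp
    moreover have "((\<lambda>x. \<Phi> (\<Psi> x)) has_derivative (\<lambda>h. h)) (at s)"
      by (rule has_derivative_transform_within_open[OF has_derivative_ident W s(2)]) (simp add: \<Phi>\<Psi>)
    ultimately have "(\<lambda>h. E (D h)) = (\<lambda>h. h)" by (rule has_derivative_unique)
    then show ?thesis by metis
  qed
  \<comment> \<open>Since \<open>s \<in> S\<close>, the subspace \<open>S\<close> equals \<open>s + S\<close>, and \<open>E\<close> pulls it back to the tangent space at \<open>p\<close>.\<close>
  define T where "T = {t. E t \<in> S}"
  define \<theta> where "\<theta> t = \<Psi> (s + E t)" for t
  define \<theta>' where "\<theta>' t = \<Psi>' (s + E t) o\<^sub>L E" for t
  define \<theta>'' where "\<theta>'' = Blinfun (\<lambda>h. \<Psi>'' s (E h) o\<^sub>L E)"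
  have lim: "((\<lambda>t. s + E t) \<longlongrightarrow> s) (nhds 0)"
  proof -
    have "((\<lambda>t. s + E t) \<longlongrightarrow> s + E 0) (nhds 0)"
      by (intro tendsto_intros filterlim_ident)
    then show ?thesis by simp
  qed
  have "open (UNIV :: 'a set)" by simp
  have evW: "\<forall>\<^sub>F t in nhds 0. s + E t \<in> W"
    using lim W s(2) unfolding tendsto_def by blast
  have affine: "((\<lambda>t. s + E t) has_derivative E) (at t)" for t
    by (auto intro!: derivative_eq_intros)
  have der: "\<forall>\<^sub>F t in nhds 0. (\<theta> has_derivative \<theta>' t) (at t)"
    using evW
  proof eventually_elim
    case (elim t)
    have "blinfun_apply (\<theta>' t) = (\<lambda>h. \<Psi>' (s + E t) (E h))"
      by (auto simp: \<theta>'_def)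
    then show ?case
      using has_derivative_compose[OF affine \<Psi>'[OF elim]] by (simp add: \<theta>_def[abs_def])
  qed
  have strict: "strict_deriv \<theta>' \<theta>'' 0"
  proof -
    define Q where "Q t = Blinfun (\<lambda>h. \<Psi>'' (s + E t) (E h) o\<^sub>L E)" for t
    have bl: "bounded_linear (\<lambda>h. \<Psi>'' x (E h) o\<^sub>L E)" for x
      by (intro bounded_linear_intros)
    have Q: "blinfun_apply (Q t) = (\<lambda>h. \<Psi>'' (s + E t) (E h) o\<^sub>L E)" for t
      unfolding Q_def by (rule bounded_linear_Blinfun_apply[OF bl])
    have "strict_deriv \<theta>' (Q 0) 0"
    proof (rule strict_deriv_if_continuous_derivative)
      show "\<forall>\<^sub>F t in nhds 0. (\<theta>' has_derivative Q t) (at t)"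
        using evW
      proof eventually_elim
        case (elim t)
        have "((\<lambda>t. \<Psi>' (s + E t)) has_derivative (\<lambda>h. \<Psi>'' (s + E t) (E h))) (at t)"
          using has_derivative_compose[OF affine \<Psi>''[OF elim]] by (simp add: o_def)
        then show ?case unfolding \<theta>'_def[abs_def] Q
          by (rule bounded_linear.has_derivative[OF bounded_bilinear.bounded_linear_left[OF bounded_bilinear_blinfun_compose]])
      qed
      have c: "isCont (\<lambda>t. \<Psi>'' (s + E t)) 0"
      proof -
        have "isCont \<Psi>'' s" using cont W s(2) continuous_on_eq_continuous_at by blast
        then have "isCont \<Psi>'' (s + E 0)" by simp
        moreover have "isCont (\<lambda>t. s + E t) 0" by (intro continuous_intros)
        ultimately show ?thesis
          using isCont_o2[of 0 "\<lambda>t. s + E t" \<Psi>''] by (simp add: o_def)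
      qed
      have Qeq: "Q t = ((Blinfun (\<lambda>l. l o\<^sub>L E)) o\<^sub>L \<Psi>'' (s + E t)) o\<^sub>L E" for t
      proof (rule blinfun_eqI)
        fix h
        have "bounded_linear (\<lambda>l :: 'a \<Rightarrow>\<^sub>L 'a. l o\<^sub>L E)" by (intro bounded_linear_intros)
        then show "Q t h = (((Blinfun (\<lambda>l. l o\<^sub>L E)) o\<^sub>L \<Psi>'' (s + E t)) o\<^sub>L E) h"
          unfolding Q by (simp add: bounded_linear_Blinfun_apply)
      qed
      show "isCont Q 0" unfolding Qeq[abs_def]
        by (intro bounded_linear.isCont[OF bounded_bilinear.bounded_linear_left[OF bounded_bilinear_blinfun_compose]]
           bounded_linear.isCont[OF bounded_bilinear.bounded_linear_right[OF bounded_bilinear_blinfun_compose]] c)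
    qed
    moreover have "Q 0 = \<theta>''" by (simp add: Q_def \<theta>''_def)
    ultimately show ?thesis by simp
  qed
  show thesis
  proof (rule that)
    show "subspace T"
      unfolding T_def subspace_def using S
      by (auto simp: blinfun.add_right blinfun.scaleR_right subspace_0 subspace_add subspace_scale)
    show "\<theta> 0 = p" by (simp add: \<theta>_def \<Psi>s)
    show "\<forall>\<^sub>F t in nhds 0. (\<theta> has_derivative \<theta>' t) (at t)" by (rule der)
    show "\<theta>' 0 = id_blinfun"
      by (rule blinfun_eqI) (simp add: \<theta>'_def D_def[symmetric] DE)
    show "strict_deriv \<theta>' \<theta>'' 0" by (rule strict)
    show "\<forall>\<^sub>F t in nhds 0. t \<in> T \<longrightarrow> \<theta> t \<in> N"
      using evW
    proof eventually_elim
      case (elim t)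
      show ?case
      proof
        assume "t \<in> T"
        then have "s + E t \<in> S \<inter> W" using elim S s by (simp add: T_def subspace_add)
        then obtain y where "y \<in> N" "y \<in> V" "s + E t = \<Phi> y" using im by blast
        then show "\<theta> t \<in> N" by (simp add: \<theta>_def \<Psi>\<Phi>)
      qed
    qed
    fix e :: real assume e: "0 < e"
    have "isCont \<Phi> p" using E has_derivative_continuous by blast
    then have "isCont (\<lambda>x. D (\<Phi> x - s)) p" by (intro continuous_intros)
    then have "(\<lambda>x. D (\<Phi> x - s)) \<midarrow>p\<rightarrow> D (\<Phi> p - s)" by (simp add: isCont_def)
    from tendsto_at_iff_tendsto_nhds[THEN iffD1, OF this]
    have "((\<lambda>x. D (\<Phi> x - s)) \<longlongrightarrow> 0) (nhds p)"
      by (simp add: s_def)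
    then have "\<forall>\<^sub>F x in nhds p. dist (D (\<Phi> x - s)) 0 < e" using e by (rule tendstoD)
    moreover have "\<forall>\<^sub>F x in nhds p. x \<in> V" using V pV eventually_nhds by blast
    ultimately show "\<forall>\<^sub>F x in nhds p. x \<in> N \<longrightarrow> (\<exists>t\<in>T. norm t < e \<and> \<theta> t = x)"
    proof eventually_elim
      case (elim x)
      show ?case
      proof
        assume "x \<in> N"
        then have "\<Phi> x \<in> S" using im elim(2) by blast
        then have "D (\<Phi> x - s) \<in> T" using S s by (simp add: T_def ED subspace_diff)
        moreover have "\<theta> (D (\<Phi> x - s)) = x" using elim(2) by (simp add: \<theta>_def ED \<Psi>\<Phi>)
        ultimately show "\<exists>t\<in>T. norm t < e \<and> \<theta> t = x" using elim(1) by (intro bexI[of _ "D (\<Phi> x - s)"]) auto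
      qed
    qed
  qed
qed

section \<open>First and second order conditions in a chart\<close>

text \<open>The local situation at a critical point \<open>x\<^sub>0\<close>: on a manifold parametrized by \<open>\<theta>\<close> on the tangent space
  \<open>T\<close>, the function \<open>\<phi>\<close> agrees with a smooth function \<open>G\<close> with gradient \<open>\<gamma>\<close>, and \<open>prox\<close> takes values
  in the manifold near \<open>x\<^sub>0 - lam *\<^sub>R grad f x\<^sub>0\<close>.\<close>

locale prox_chart = prox_function \<phi> for \<phi> :: "'a::euclidean_space \<Rightarrow> ereal" +
  fixes f :: "'a \<Rightarrow> real" and lam :: real and x\<^sub>0 :: 'a and T :: "'a set"
    and \<theta> :: "'a \<Rightarrow> 'a" and \<theta>' \<theta>'' :: "'a \<Rightarrow> 'a \<Rightarrow>\<^sub>L 'a"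
    and G :: "'a \<Rightarrow> real" and \<gamma> \<Gamma> :: "'a \<Rightarrow> 'a"
  assumes lam: "0 < lam" and f: "C2_on f UNIV"
    and critical: "- grad f x\<^sub>0 \<in> convex_subdiff \<phi> x\<^sub>0"
    and T: "subspace T" and \<theta>0: "\<theta> 0 = x\<^sub>0"
    and \<theta>_deriv: "\<forall>\<^sub>F t in nhds 0. (\<theta> has_derivative \<theta>' t) (at t)"
    and \<theta>'0: "\<theta>' 0 = id_blinfun" and \<theta>'_strict: "strict_deriv \<theta>' \<theta>'' 0"
    and \<phi>_chart: "\<forall>\<^sub>F t in nhds 0. t \<in> T \<longrightarrow> \<phi> (\<theta> t) = ereal (G (\<theta> t))"
    and G_deriv: "\<forall>\<^sub>F x in nhds x\<^sub>0. (G has_derivative (\<lambda>h. \<gamma> x \<bullet> h)) (at x)"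
    and \<gamma>_strict: "strict_deriv \<gamma> \<Gamma> x\<^sub>0" and \<Gamma>_sym: "\<Gamma> h \<bullet> k = h \<bullet> \<Gamma> k"
    and prox_in_chart: "0 < e \<Longrightarrow> \<forall>\<^sub>F z in nhds (x\<^sub>0 - lam *\<^sub>R grad f x\<^sub>0). \<exists>t\<in>T. norm t < e \<and> \<theta> t = prox lam \<phi> z"
begin

text \<open>The gradient of the smooth representative of \<open>\<psi>\<close>; it is normal to the manifold at a critical
  point.\<close>

definition "n\<^sub>0 = \<gamma> x\<^sub>0 + grad f x\<^sub>0"

text \<open>The Hessian of \<open>G + \<langle>grad f x\<^sub>0, _\<rangle>\<close> along the manifold, as an operator: the curvature of \<open>G\<close> plus
  that of the manifold in the direction of the multiplier \<open>n\<^sub>0\<close>.\<close>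

definition "S h = (\<Sum>b\<in>Basis. (\<Gamma> h \<bullet> b + n\<^sub>0 \<bullet> \<theta>'' h b) *\<^sub>R b)"

lemma \<theta>'_cont: "isCont \<theta>' 0"
  using strict_deriv_imp_has_derivative[OF \<theta>'_strict] has_derivative_continuous by blast

lemma \<theta>_strict: "strict_deriv \<theta> (\<lambda>h. h) 0"
  using strict_deriv_if_continuous_derivative[OF \<theta>_deriv \<theta>'_cont] by (simp add: \<theta>'0 id_def)

lemma \<theta>_tendsto: "(\<theta> \<longlongrightarrow> x\<^sub>0) (nhds 0)"
proof -
  have "isCont \<theta> 0"
    using strict_deriv_imp_has_derivative[OF \<theta>_strict] has_derivative_continuous by blast
  then show ?thesis by (rule isCont_tendsto_nhds) (rule \<theta>0)
qed

lemma bl\<Gamma>: "bounded_linear \<Gamma>" and bl\<theta>'': "bounded_linear \<theta>''"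
  using \<gamma>_strict \<theta>'_strict by (simp_all add: strict_deriv_def)

lemma S_inner: "S h \<bullet> k = \<Gamma> h \<bullet> k + n\<^sub>0 \<bullet> \<theta>'' h k"
proof -
  have k: "(\<Sum>b\<in>Basis. (k \<bullet> b) *\<^sub>R b) = k" by (rule euclidean_representation)
  have "\<Gamma> h \<bullet> k + n\<^sub>0 \<bullet> \<theta>'' h k
     = \<Gamma> h \<bullet> (\<Sum>b\<in>Basis. (k \<bullet> b) *\<^sub>R b) + n\<^sub>0 \<bullet> \<theta>'' h (\<Sum>b\<in>Basis. (k \<bullet> b) *\<^sub>R b)"
    unfolding k ..
  also have "\<dots> = (\<Sum>b\<in>Basis. (k \<bullet> b) * (\<Gamma> h \<bullet> b) + (k \<bullet> b) * (n\<^sub>0 \<bullet> \<theta>'' h b))"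
    by (simp add: inner_sum_right blinfun.sum_right blinfun.scaleR_right sum.distrib)
  also have "\<dots> = S h \<bullet> k"
    unfolding S_def inner_sum_left by (rule sum.cong) (simp_all add: algebra_simps inner_commute)
  finally show ?thesis ..
qed

lemma linear_S: "linear S"
proof -
  interpret \<Gamma>: bounded_linear \<Gamma> by (rule bl\<Gamma>)
  interpret \<theta>'': bounded_linear \<theta>'' by (rule bl\<theta>'')
  show ?thesis
  proof (rule linearI)
    fix x y :: 'a and c :: real
    show "S (x + y) = S x + S y"
      by (rule euclidean_eqI) (simp add: inner_add_left S_inner \<Gamma>.add \<theta>''.add blinfun.add_left inner_add_right)
    show "S (c *\<^sub>R x) = c *\<^sub>R S x"
      by (rule euclidean_eqI) (simp add: S_inner \<Gamma>.scaleR \<theta>''.scaleR blinfun.scaleR_left distrib_left)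
  qed
qed

lemma S_sym: "S h \<bullet> k = h \<bullet> S k"
proof -
  have d: "(\<theta>' has_derivative \<theta>'') (at 0)" by (rule strict_deriv_imp_has_derivative[OF \<theta>'_strict])
  have "n\<^sub>0 \<bullet> \<theta>'' h k = n\<^sub>0 \<bullet> \<theta>'' k h"
  proof (rule second_derivative_symmetric[of "\<lambda>t. n\<^sub>0 \<bullet> \<theta> t" "\<lambda>t h. n\<^sub>0 \<bullet> \<theta>' t h" 0 "\<lambda>k h. n\<^sub>0 \<bullet> \<theta>'' k h"])
    show "\<forall>\<^sub>F x in nhds 0. ((\<lambda>t. n\<^sub>0 \<bullet> \<theta> t) has_derivative (\<lambda>h. n\<^sub>0 \<bullet> \<theta>' x h)) (at x)"
      using \<theta>_deriv by eventually_elim (rule has_derivative_inner_right)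
    show "((\<lambda>x. n\<^sub>0 \<bullet> \<theta>' x h) has_derivative (\<lambda>k. n\<^sub>0 \<bullet> \<theta>'' k h)) (at 0)" for h
      by (intro has_derivative_inner_right bounded_linear.has_derivative[OF blinfun.bounded_linear_left] d)
  qed
  then show ?thesis
    using S_inner[of h k] S_inner[of k h] \<Gamma>_sym[of h k] by (simp add: inner_commute)
qed

lemma eventually_nice:
  "\<forall>\<^sub>F t in nhds 0. (\<theta> has_derivative \<theta>' t) (at t) \<and> (t \<in> T \<longrightarrow> \<phi> (\<theta> t) = ereal (G (\<theta> t))) \<and>
     (G has_derivative (\<lambda>h. \<gamma> (\<theta> t) \<bullet> h)) (at (\<theta> t))"
  using \<theta>_deriv \<phi>_chart eventually_compose_filterlim[OF G_deriv \<theta>_tendsto] by eventually_elim simp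

lemma ray_deriv:
  assumes "(\<theta> has_derivative \<theta>' (t + r *\<^sub>R \<sigma>)) (at (t + r *\<^sub>R \<sigma>))"
    and "(H has_derivative (\<lambda>h. m (\<theta> (t + r *\<^sub>R \<sigma>)) \<bullet> h)) (at (\<theta> (t + r *\<^sub>R \<sigma>)))"
  shows "((\<lambda>r. H (\<theta> (t + r *\<^sub>R \<sigma>))) has_real_derivative m (\<theta> (t + r *\<^sub>R \<sigma>)) \<bullet> \<theta>' (t + r *\<^sub>R \<sigma>) \<sigma>) (at r)"
proof -
  have "((\<lambda>r. t + r *\<^sub>R \<sigma>) has_derivative (\<lambda>c. c *\<^sub>R \<sigma>)) (at r)"
    by (auto intro!: derivative_eq_intros)
  from has_derivative_compose[OF has_derivative_compose[OF this assms(1)] assms(2)]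
  have "((\<lambda>r. H (\<theta> (t + r *\<^sub>R \<sigma>))) has_derivative (\<lambda>c. m (\<theta> (t + r *\<^sub>R \<sigma>)) \<bullet> \<theta>' (t + r *\<^sub>R \<sigma>) (c *\<^sub>R \<sigma>))) (at r)" .
  then show ?thesis
    unfolding has_field_derivative_def by (simp add: blinfun.scaleR_right mult.commute[of _ "inner _ _"])
qed

lemma ray_tendsto: "((\<lambda>r. t + r *\<^sub>R \<sigma>) \<longlongrightarrow> t) (nhds (0::real))" for t \<sigma> :: 'a
proof -
  have "((\<lambda>r. t + r *\<^sub>R \<sigma>) \<longlongrightarrow> t + 0 *\<^sub>R \<sigma>) (nhds (0::real))"
    by (intro tendsto_intros filterlim_ident)
  then show ?thesis by simp
qed

text \<open>The subgradient inequality says that \<open>G - u\<close> restricted to a curve in the manifold has a minimum at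
  \<open>\<theta> t\<close>.\<close>

lemma subgradient_tangential:
  "\<forall>\<^sub>F t in nhds 0. t \<in> T \<longrightarrow> (\<forall>u\<in>convex_subdiff \<phi> (\<theta> t). \<forall>\<sigma>\<in>T. (\<gamma> (\<theta> t) - u) \<bullet> \<theta>' t \<sigma> = 0)"
proof -
  have "\<forall>\<^sub>F t in nhds 0. \<forall>\<^sub>F s in nhds t. (\<theta> has_derivative \<theta>' s) (at s) \<and> (s \<in> T \<longrightarrow> \<phi> (\<theta> s) = ereal (G (\<theta> s))) \<and>
     (G has_derivative (\<lambda>h. \<gamma> (\<theta> s) \<bullet> h)) (at (\<theta> s))"
    using eventually_nice unfolding eventually_eventually .
  then show ?thesis
  proof eventually_elim
    case (elim t)
    show ?case
    proof (intro impI ballI)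
      fix u \<sigma> assume tT: "t \<in> T" and u: "u \<in> convex_subdiff \<phi> (\<theta> t)" and \<sigma>: "\<sigma> \<in> T"
      have at_t: "(\<theta> has_derivative \<theta>' t) (at t)" "\<phi> (\<theta> t) = ereal (G (\<theta> t))"
        "(G has_derivative (\<lambda>h. \<gamma> (\<theta> t) \<bullet> h)) (at (\<theta> t))"
        using eventually_nhds_x_imp_x[OF elim] tT by auto
      define \<rho> where "\<rho> r = G (\<theta> (t + r *\<^sub>R \<sigma>)) - u \<bullet> \<theta> (t + r *\<^sub>R \<sigma>)" for r
      have "((\<lambda>x. G x - u \<bullet> x) has_derivative (\<lambda>h. (\<gamma> (\<theta> t) - u) \<bullet> h)) (at (\<theta> t))"
        using has_derivative_diff[OF at_t(3) has_derivative_inner_right[OF has_derivative_ident]]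
        by (simp add: inner_diff_left)
      then have d: "(\<rho> has_real_derivative (\<gamma> (\<theta> t) - u) \<bullet> \<theta>' t \<sigma>) (at 0)"
        using ray_deriv[of t 0 \<sigma> "\<lambda>x. G x - u \<bullet> x" "\<lambda>x. \<gamma> x - u"] at_t(1) by (simp add: \<rho>_def[abs_def])
      have "\<forall>\<^sub>F r in nhds (0::real). \<rho> 0 \<le> \<rho> r"
        using eventually_compose_filterlim[OF elim ray_tendsto[of t \<sigma>]]
      proof eventually_elim
        case (elim r)
        have "t + r *\<^sub>R \<sigma> \<in> T" using T tT \<sigma> by (simp add: subspace_add subspace_scale)
        then have "\<phi> (\<theta> (t + r *\<^sub>R \<sigma>)) = ereal (G (\<theta> (t + r *\<^sub>R \<sigma>)))" using elim by simp
        moreover have "\<phi> (\<theta> t) + ereal (u \<bullet> (\<theta> (t + r *\<^sub>R \<sigma>) - \<theta> t)) \<le> \<phi> (\<theta> (t + r *\<^sub>R \<sigma>))"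
          using u by (simp add: convex_subdiff_def)
        ultimately show ?case using at_t(2) by (simp add: \<rho>_def inner_diff_right)
      qed
      then obtain d' where "0 < d'" "\<And>r. \<bar>0 - r\<bar> < d' \<Longrightarrow> \<rho> 0 \<le> \<rho> r"
        unfolding eventually_nhds_metric by (auto simp: dist_real_def)
      then show "(\<gamma> (\<theta> t) - u) \<bullet> \<theta>' t \<sigma> = 0"
        using DERIV_local_min[OF d] by blast
    qed
  qed
qed

lemma n\<^sub>0_normal: "\<sigma> \<in> T \<Longrightarrow> n\<^sub>0 \<bullet> \<sigma> = 0"
  using eventually_nhds_x_imp_x[OF subgradient_tangential] critical T \<theta>'0
  by (auto simp: \<theta>0 n\<^sub>0_def subspace_0)

lemma pairing_deriv:
  assumes "(m has_derivative m') (at x\<^sub>0)"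
  shows "((\<lambda>s. m (\<theta> s) \<bullet> \<theta>' s k) has_derivative (\<lambda>h. m x\<^sub>0 \<bullet> \<theta>'' h k + m' h \<bullet> k)) (at 0)"
proof -
  have d: "(\<theta>' has_derivative \<theta>'') (at 0)" by (rule strict_deriv_imp_has_derivative[OF \<theta>'_strict])
  have "((\<lambda>s. m (\<theta> s)) has_derivative m') (at 0)"
    using has_derivative_compose[OF strict_deriv_imp_has_derivative[OF \<theta>_strict], of m m'] assms \<theta>0 by simp
  moreover have "((\<lambda>s. \<theta>' s k) has_derivative (\<lambda>h. \<theta>'' h k)) (at 0)"
    by (intro bounded_linear.has_derivative[OF blinfun.bounded_linear_left] d)
  ultimately show ?thesis
    using has_derivative_inner[of "\<lambda>s. m (\<theta> s)" m' 0 UNIV "\<lambda>s. \<theta>' s k" "\<lambda>h. \<theta>'' h k"]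
    by (simp add: \<theta>0 \<theta>'0)
qed

text \<open>By criticality and convexity of \<open>\<phi>\<close>, the function \<open>G + \<langle>grad f x\<^sub>0, _\<rangle>\<close> has a minimum over the manifold
  at \<open>x\<^sub>0\<close>, and its second derivative along a curve in the direction \<open>\<sigma>\<close> is \<open>S \<sigma> \<bullet> \<sigma>\<close>.\<close>

lemma S_nonneg:
  assumes \<sigma>: "\<sigma> \<in> T"
  shows "0 \<le> S \<sigma> \<bullet> \<sigma>"
proof (rule ccontr)
  assume neg: "\<not> 0 \<le> S \<sigma> \<bullet> \<sigma>"
  define \<rho> where "\<rho> r = G (\<theta> (0 + r *\<^sub>R \<sigma>)) + grad f x\<^sub>0 \<bullet> \<theta> (0 + r *\<^sub>R \<sigma>)" for r
  define w where "w r = (\<gamma> (\<theta> (0 + r *\<^sub>R \<sigma>)) + grad f x\<^sub>0) \<bullet> \<theta>' (0 + r *\<^sub>R \<sigma>) \<sigma>" for r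
  have "((\<lambda>x. \<gamma> x + grad f x\<^sub>0) has_derivative \<Gamma>) (at x\<^sub>0)"
    using has_derivative_add[OF strict_deriv_imp_has_derivative[OF \<gamma>_strict] has_derivative_const] by simp
  from pairing_deriv[OF this, of \<sigma>]
  have pd: "((\<lambda>s. (\<gamma> (\<theta> s) + grad f x\<^sub>0) \<bullet> \<theta>' s \<sigma>) has_derivative (\<lambda>h. S h \<bullet> \<sigma>)) (at (0 + 0 *\<^sub>R \<sigma>))"
    by (simp add: S_inner n\<^sub>0_def add.commute)
  have "((\<lambda>r. 0 + r *\<^sub>R \<sigma>) has_derivative (\<lambda>c. c *\<^sub>R \<sigma>)) (at (0::real))"
    by (auto intro!: derivative_eq_intros)
  from has_derivative_compose[OF this pd]
  have "(w has_derivative (\<lambda>c. S (c *\<^sub>R \<sigma>) \<bullet> \<sigma>)) (at 0)" by (simp add: w_def[abs_def])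
  then have wd: "(w has_real_derivative S \<sigma> \<bullet> \<sigma>) (at 0)"
    unfolding has_field_derivative_def by (simp add: linear_cmul[OF linear_S] mult.commute[of _ "inner _ _"])
  have w0: "w 0 = 0" using n\<^sub>0_normal[OF \<sigma>] by (simp add: w_def \<theta>0 \<theta>'0 n\<^sub>0_def)
  obtain d1 where d1: "0 < d1" "\<And>h. 0 < h \<Longrightarrow> h < d1 \<Longrightarrow> w h < 0"
    using DERIV_neg_dec_right[OF wd] neg w0 by auto
  obtain d2 where d2: "0 < d2" "\<And>r. \<bar>r\<bar> < d2 \<Longrightarrow> (\<theta> has_derivative \<theta>' (0 + r *\<^sub>R \<sigma>)) (at (0 + r *\<^sub>R \<sigma>)) \<and>
     ((0 + r *\<^sub>R \<sigma>) \<in> T \<longrightarrow> \<phi> (\<theta> (0 + r *\<^sub>R \<sigma>)) = ereal (G (\<theta> (0 + r *\<^sub>R \<sigma>)))) \<and>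
     (G has_derivative (\<lambda>h. \<gamma> (\<theta> (0 + r *\<^sub>R \<sigma>)) \<bullet> h)) (at (\<theta> (0 + r *\<^sub>R \<sigma>)))"
    using eventually_compose_filterlim[OF eventually_nice ray_tendsto[of 0 \<sigma>]]
    unfolding eventually_nhds_metric by (auto simp: dist_real_def)
  have \<rho>d: "(\<rho> has_real_derivative w r) (at r)" if "\<bar>r\<bar> < d2" for r
  proof -
    have "((\<lambda>x. G x + grad f x\<^sub>0 \<bullet> x) has_derivative (\<lambda>h. (\<gamma> (\<theta> (0 + r *\<^sub>R \<sigma>)) + grad f x\<^sub>0) \<bullet> h)) (at (\<theta> (0 + r *\<^sub>R \<sigma>)))"
      using has_derivative_add[OF conjunct2[OF conjunct2[OF d2(2)[OF that]]] has_derivative_inner_right[OF has_derivative_ident]]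
      by (simp add: inner_add_left)
    from ray_deriv[where m="\<lambda>x. \<gamma> x + grad f x\<^sub>0", OF conjunct1[OF d2(2)[OF that]] this]
    show ?thesis by (simp only: \<rho>_def[abs_def] w_def)
  qed
  define h where "h = min d1 d2 / 2"
  have h: "0 < h" "h < d1" "h < d2" using d1 d2 by (auto simp: h_def)
  have "\<exists>z>0. z < h \<and> \<rho> h - \<rho> 0 = (h - 0) * w z"
    by (rule MVT2) (use h \<rho>d in auto)
  then obtain z where z: "0 < z" "z < h" "\<rho> h - \<rho> 0 = h * w z" by auto
  then have "\<rho> h < \<rho> 0" using d1(2)[of z] h mult_pos_neg[of h "w z"] by auto
  moreover have "h *\<^sub>R \<sigma> \<in> T" using \<sigma> T by (simp add: subspace_scale)
  then have "\<phi> (\<theta> (h *\<^sub>R \<sigma>)) = ereal (G (\<theta> (h *\<^sub>R \<sigma>)))" "\<phi> x\<^sub>0 = ereal (G x\<^sub>0)"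
    using d2(2)[of h] d2(2)[of 0] h T d2(1) by (auto simp: \<theta>0 subspace_0)
  then have "G x\<^sub>0 + - grad f x\<^sub>0 \<bullet> (\<theta> (h *\<^sub>R \<sigma>) - x\<^sub>0) \<le> G (\<theta> (h *\<^sub>R \<sigma>))"
    using critical unfolding convex_subdiff_def by (auto dest!: spec[of _ "\<theta> (h *\<^sub>R \<sigma>)"])
  then have "\<rho> 0 \<le> \<rho> h" by (simp add: \<rho>_def \<theta>0 inner_diff_right)
  ultimately show False by simp
qed

end

section \<open>The derivative of the proximity operator at an active strict saddle\<close>

context prox_chart
begin

definition "z\<^sub>0 = x\<^sub>0 - lam *\<^sub>R grad f x\<^sub>0"

lemma prox_z\<^sub>0: "prox lam \<phi> z\<^sub>0 = x\<^sub>0"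
  by (rule prox_eqI[OF lam]) (use lam critical in \<open>simp add: z\<^sub>0_def\<close>)

text \<open>The vectors \<open>a\<close> and \<open>a'\<close> are the gradients of the two proximal objectives at \<open>prox z = \<theta> t\<close> and
  \<open>prox z' = \<theta> t'\<close>; both are orthogonal to the tangent spaces there. Subtracting the two optimality
  conditions and linearizing shows that \<open>t - t'\<close> solves the equation of the resolvent of \<open>lam S\<close> with
  right-hand side \<open>z - z'\<close> up to an error of order \<open>\<eta>\<close>.\<close>

lemma resolvent_estimate:
  fixes \<eta> K\<Gamma> K\<theta> :: real and t t' z z' \<sigma> :: 'a
  defines "x \<equiv> \<theta> t" and "x' \<equiv> \<theta> t'"
  defines "a \<equiv> \<gamma> x + inverse lam *\<^sub>R (x - z)" and "a' \<equiv> \<gamma> x' + inverse lam *\<^sub>R (x' - z')"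
  assumes \<eta>: "0 < \<eta>" "\<eta> \<le> 1 / 2"
    and K: "\<And>h. norm (\<Gamma> h) \<le> K\<Gamma> * norm h" "0 \<le> K\<Gamma>" "\<And>h. norm (\<theta>'' h) \<le> K\<theta> * norm h" "0 \<le> K\<theta>"
    and opt: "a \<bullet> \<theta>' t \<sigma> = 0" "a' \<bullet> \<theta>' t' \<sigma> = 0"
    and \<theta>s: "norm (x - x' - (t - t')) \<le> \<eta> * norm (t - t')"
    and \<theta>'s: "norm (\<theta>' t - \<theta>' t' - \<theta>'' (t - t')) \<le> \<eta> * norm (t - t')"
    and \<theta>'i: "norm (\<theta>' t - id_blinfun) \<le> \<eta>"
    and \<gamma>s: "norm (\<gamma> x - \<gamma> x' - \<Gamma> (x - x')) \<le> \<eta> * norm (x - x')"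
    and a': "norm (n\<^sub>0 - a') \<le> \<eta>" and nx: "norm (x - x') \<le> norm (z - z')"
  shows "norm (t - t') \<le> 2 * norm (z - z')"
    and "\<bar>(lam *\<^sub>R S (t - t') + (t - t') - (z - z')) \<bullet> \<sigma>\<bar>
      \<le> lam * (2 * K\<Gamma> + 1 + 2 * inverse lam + (K\<Gamma> + 1 + 2 * inverse lam) + 2 * norm n\<^sub>0 + 2 * (K\<theta> + 1))
         * \<eta> * norm (z - z') * norm \<sigma>"
proof -
  interpret \<Gamma>: bounded_linear \<Gamma> by (rule bl\<Gamma>)
  define \<tau> where "\<tau> = t - t'"
  define d where "d = z - z'"
  define l where "l = inverse lam"
  have l: "0 < l" "lam * l = 1" using lam by (simp_all add: l_def)
  have "\<eta> * norm \<tau> \<le> 1 / 2 * norm \<tau>" using \<eta> by (intro mult_right_mono) auto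
  then have "norm (x - x' - \<tau>) \<le> norm \<tau> / 2" using \<theta>s by (simp add: \<tau>_def)
  moreover have "norm \<tau> \<le> norm (x - x') + norm (x - x' - \<tau>)"
    using norm_triangle_ineq4[of "x - x'" "x - x' - \<tau>"] by simp
  ultimately have \<tau>: "norm \<tau> \<le> 2 * norm d" using nx by (simp add: d_def)
  then show "norm (t - t') \<le> 2 * norm (z - z')" by (simp add: \<tau>_def d_def)
  have "\<eta> * norm \<tau> \<le> \<eta> * (2 * norm d)" using \<tau> \<eta> by (intro mult_left_mono) auto
  then have xt: "norm (\<tau> - (x - x')) \<le> 2 * \<eta> * norm d"
    using \<theta>s by (simp add: \<tau>_def norm_minus_commute[of _ "x - x'"])
  define q where "q = \<Gamma> \<tau> + l *\<^sub>R (\<tau> - d) - (a - a')"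
  define \<Delta> where "\<Delta> = \<theta>' t \<sigma> - \<theta>' t' \<sigma>"
  have q_eq: "q = \<Gamma> (\<tau> - (x - x')) - (\<gamma> x - \<gamma> x' - \<Gamma> (x - x')) + l *\<^sub>R (\<tau> - (x - x'))"
    by (simp add: q_def a_def a'_def d_def l_def \<Gamma>.diff \<Gamma>.add algebra_simps)
  have \<gamma>s': "norm (\<gamma> x - \<gamma> x' - \<Gamma> (x - x')) \<le> \<eta> * norm d"
    by (rule order_trans[OF \<gamma>s]) (use nx \<eta> in \<open>simp add: d_def\<close>)
  have "norm (\<Gamma> (\<tau> - (x - x'))) \<le> K\<Gamma> * (2 * \<eta> * norm d)"
    by (rule order_trans[OF K(1) mult_left_mono[OF xt K(2)]])
  moreover have "norm (l *\<^sub>R (\<tau> - (x - x'))) \<le> l * (2 * \<eta> * norm d)"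
    using mult_left_mono[OF xt, of l] l by simp
  ultimately have "norm q \<le> K\<Gamma> * (2 * \<eta> * norm d) + \<eta> * norm d + l * (2 * \<eta> * norm d)"
    unfolding q_eq using \<gamma>s' norm_triangle_ineq[of "\<Gamma> (\<tau> - (x - x')) - (\<gamma> x - \<gamma> x' - \<Gamma> (x - x'))" "l *\<^sub>R (\<tau> - (x - x'))"]
      norm_triangle_ineq4[of "\<Gamma> (\<tau> - (x - x'))" "\<gamma> x - \<gamma> x' - \<Gamma> (x - x')"] by linarith
  then have q: "norm q \<le> (2 * K\<Gamma> + 1 + 2 * l) * \<eta> * norm d" by (simp add: algebra_simps)
  have aa: "norm (a - a') \<le> (K\<Gamma> + 1 + 2 * l) * norm d"
  proof -
    have eq: "a - a' = (\<gamma> x - \<gamma> x' - \<Gamma> (x - x')) + \<Gamma> (x - x') + l *\<^sub>R ((x - x') - d)"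
      by (simp add: a_def a'_def d_def l_def algebra_simps)
    have "norm (\<Gamma> (x - x')) \<le> K\<Gamma> * norm d"
      by (rule order_trans[OF K(1)]) (use nx K(2) in \<open>simp add: d_def mult_left_mono\<close>)
    moreover have "norm ((x - x') - d) \<le> 2 * norm d"
      using norm_triangle_ineq4[of "x - x'" d] nx by (simp add: d_def)
    then have "norm (l *\<^sub>R ((x - x') - d)) \<le> l * (2 * norm d)"
      using l by simp
    moreover have "\<eta> * norm d \<le> 1 * norm d" using \<eta> by (intro mult_right_mono) auto
    ultimately have "norm (a - a') \<le> norm d + K\<Gamma> * norm d + l * (2 * norm d)"
      unfolding eq using \<gamma>s'
        norm_triangle_ineq[of "(\<gamma> x - \<gamma> x' - \<Gamma> (x - x')) + \<Gamma> (x - x')" "l *\<^sub>R ((x - x') - d)"]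
        norm_triangle_ineq[of "\<gamma> x - \<gamma> x' - \<Gamma> (x - x')" "\<Gamma> (x - x')"] by linarith
    then show ?thesis by (simp add: algebra_simps)
  qed
  have i\<sigma>: "norm (\<sigma> - \<theta>' t \<sigma>) \<le> \<eta> * norm \<sigma>"
  proof -
    have "norm ((\<theta>' t - id_blinfun) \<sigma>) \<le> norm (\<theta>' t - id_blinfun) * norm \<sigma>" by (rule norm_blinfun)
    also have "\<dots> \<le> \<eta> * norm \<sigma>" by (rule mult_right_mono[OF \<theta>'i]) simp
    finally show ?thesis by (simp add: blinfun.diff_left norm_minus_commute)
  qed
  have "norm (\<theta>' t - \<theta>' t' - \<theta>'' \<tau>) \<le> 2 * \<eta> * norm d"
    using \<theta>'s \<open>\<eta> * norm \<tau> \<le> \<eta> * (2 * norm d)\<close> by (simp add: \<tau>_def)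
  note \<theta>'s2 = this
  have \<Delta>1: "norm (\<theta>'' \<tau> \<sigma> - \<Delta>) \<le> 2 * \<eta> * norm d * norm \<sigma>"
  proof -
    have "norm ((\<theta>' t - \<theta>' t' - \<theta>'' \<tau>) \<sigma>) \<le> norm (\<theta>' t - \<theta>' t' - \<theta>'' \<tau>) * norm \<sigma>" by (rule norm_blinfun)
    also have "\<dots> \<le> (2 * \<eta> * norm d) * norm \<sigma>" by (rule mult_right_mono[OF \<theta>'s2]) simp
    finally show ?thesis by (simp add: \<Delta>_def blinfun.diff_left norm_minus_commute)
  qed
  have \<Delta>2: "norm \<Delta> \<le> 2 * (K\<theta> + 1) * norm d * norm \<sigma>"
  proof -
    have "norm (\<theta>'' \<tau> \<sigma>) \<le> norm (\<theta>'' \<tau>) * norm \<sigma>" by (rule norm_blinfun)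
    also have "\<dots> \<le> (K\<theta> * (2 * norm d)) * norm \<sigma>"
      by (intro mult_right_mono order_trans[OF K(3) mult_left_mono[OF \<tau> K(4)]]) simp
    finally have 1: "norm (\<theta>'' \<tau> \<sigma>) \<le> 2 * K\<theta> * norm d * norm \<sigma>" by (simp add: mult_ac)
    have "2 * \<eta> * (norm d * norm \<sigma>) \<le> 2 * (norm d * norm \<sigma>)"
      using \<eta> by (intro mult_right_mono) auto
    then show ?thesis
      using 1 \<Delta>1 norm_triangle_ineq4[of "\<theta>'' \<tau> \<sigma>" "\<theta>'' \<tau> \<sigma> - \<Delta>"] by (simp add: algebra_simps)
  qed
  have "(a - a') \<bullet> \<theta>' t \<sigma> + a' \<bullet> \<Delta> = 0"
    using opt by (simp add: \<Delta>_def inner_diff_left inner_diff_right)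
  moreover have ll: "l * ((lam *\<^sub>R S \<tau> + \<tau> - d) \<bullet> \<sigma>) = S \<tau> \<bullet> \<sigma> + l * ((\<tau> - d) \<bullet> \<sigma>)"
  proof -
    have "l * (lam * c) = (lam * l) * c" for c by (simp only: mult_ac)
    then have "l * (lam * c) = c" for c by (simp only: l(2) mult_1)
    then show ?thesis by (simp add: inner_add_left inner_diff_left algebra_simps)
  qed
  ultimately have "l * ((lam *\<^sub>R S \<tau> + \<tau> - d) \<bullet> \<sigma>)
     = q \<bullet> \<sigma> + (a - a') \<bullet> (\<sigma> - \<theta>' t \<sigma>) + n\<^sub>0 \<bullet> (\<theta>'' \<tau> \<sigma> - \<Delta>) + (n\<^sub>0 - a') \<bullet> \<Delta>"
    unfolding ll q_def
    by (simp add: inner_add_left inner_diff_left inner_diff_right S_inner algebra_simps)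
  also have "\<bar>\<dots>\<bar> \<le> norm q * norm \<sigma> + norm (a - a') * norm (\<sigma> - \<theta>' t \<sigma>)
      + norm n\<^sub>0 * norm (\<theta>'' \<tau> \<sigma> - \<Delta>) + norm (n\<^sub>0 - a') * norm \<Delta>"
    using Cauchy_Schwarz_ineq2[of q \<sigma>] Cauchy_Schwarz_ineq2[of "a - a'" "\<sigma> - \<theta>' t \<sigma>"]
      Cauchy_Schwarz_ineq2[of n\<^sub>0 "\<theta>'' \<tau> \<sigma> - \<Delta>"] Cauchy_Schwarz_ineq2[of "n\<^sub>0 - a'" \<Delta>] by linarith
  also have "\<dots> \<le> ((2 * K\<Gamma> + 1 + 2 * l) * \<eta> * norm d) * norm \<sigma>
      + ((K\<Gamma> + 1 + 2 * l) * norm d) * (\<eta> * norm \<sigma>)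
      + norm n\<^sub>0 * (2 * \<eta> * norm d * norm \<sigma>) + \<eta> * (2 * (K\<theta> + 1) * norm d * norm \<sigma>)"
    using \<eta> K l by (intro add_mono mult_mono q aa i\<sigma> \<Delta>1 \<Delta>2 a' mult_nonneg_nonneg add_nonneg_nonneg) auto
  also have "\<dots> = (2 * K\<Gamma> + 1 + 2 * l + (K\<Gamma> + 1 + 2 * l) + 2 * norm n\<^sub>0 + 2 * (K\<theta> + 1))
         * \<eta> * norm d * norm \<sigma>" by (simp add: algebra_simps)
  finally have "lam * \<bar>l * ((lam *\<^sub>R S \<tau> + \<tau> - d) \<bullet> \<sigma>)\<bar> \<le> lam * ((2 * K\<Gamma> + 1 + 2 * l + (K\<Gamma> + 1 + 2 * l)
        + 2 * norm n\<^sub>0 + 2 * (K\<theta> + 1)) * \<eta> * norm d * norm \<sigma>)"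
    using lam by (intro mult_left_mono) auto
  moreover have "lam * \<bar>l * ((lam *\<^sub>R S \<tau> + \<tau> - d) \<bullet> \<sigma>)\<bar> = \<bar>(lam *\<^sub>R S \<tau> + \<tau> - d) \<bullet> \<sigma>\<bar>"
    using l lam by (simp add: abs_mult mult.assoc[symmetric])
  ultimately show "\<bar>(lam *\<^sub>R S (t - t') + (t - t') - (z - z')) \<bullet> \<sigma>\<bar>
      \<le> lam * (2 * K\<Gamma> + 1 + 2 * inverse lam + (K\<Gamma> + 1 + 2 * inverse lam) + 2 * norm n\<^sub>0 + 2 * (K\<theta> + 1))
         * \<eta> * norm (z - z') * norm \<sigma>"
    unfolding \<tau>_def d_def l_def by (simp add: mult.assoc)
qed

text \<open>The derivative is the resolvent of \<open>lam S\<close> on \<open>T\<close>: by the previous estimate and the stability of the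
  resolvent, \<open>t - t'\<close> is close to \<open>P (z - z')\<close>, and \<open>\<theta>\<close> is close to the identity.\<close>

theorem prox_strict_deriv:
  obtains P where "linear P" "\<And>x y. P x \<bullet> y = x \<bullet> P y" "\<And>d. (norm (P d))\<^sup>2 \<le> d \<bullet> P d"
    "\<And>y. y \<in> T \<Longrightarrow> \<exists>d. P d = y" "\<And>d \<sigma>. \<sigma> \<in> T \<Longrightarrow> (lam *\<^sub>R S (P d) + P d - d) \<bullet> \<sigma> = 0"
    "strict_deriv (prox lam \<phi>) P z\<^sub>0"
proof -
  obtain P :: "'a \<Rightarrow> 'a" where P: "linear P" "\<And>d. P d \<in> T"
    "\<And>d \<sigma>. \<sigma> \<in> T \<Longrightarrow> (lam *\<^sub>R S (P d) + P d - d) \<bullet> \<sigma> = 0"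
    "\<And>x y. P x \<bullet> y = x \<bullet> P y" "\<And>d. (norm (P d))\<^sup>2 \<le> d \<bullet> P d" "\<And>y. y \<in> T \<Longrightarrow> \<exists>d. P d = y"
    "\<And>y d \<eta>. y \<in> T \<Longrightarrow> 0 \<le> \<eta> \<Longrightarrow> (\<And>\<sigma>. \<sigma> \<in> T \<Longrightarrow> \<bar>(lam *\<^sub>R S y + y - d) \<bullet> \<sigma>\<bar> \<le> \<eta> * norm \<sigma>)
       \<Longrightarrow> norm (y - P d) \<le> \<eta>"
    by (rule constrained_resolvent[OF T, of "\<lambda>h. lam *\<^sub>R S h"])
      (use lam linear_S S_sym S_nonneg in \<open>auto intro!: linear_compose_scale_right\<close>)
  have "strict_deriv (prox lam \<phi>) P z\<^sub>0"
    unfolding strict_deriv_def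
  proof (intro conjI allI impI)
    show "bounded_linear P" using P(1) by (simp add: linear_conv_bounded_linear)
    fix e :: real assume e: "0 < e"
    obtain K\<Gamma> where K\<Gamma>: "0 \<le> K\<Gamma>" "\<And>h. norm (\<Gamma> h) \<le> norm h * K\<Gamma>"
      using bounded_linear.nonneg_bounded[OF bl\<Gamma>] by blast
    obtain K\<theta> where K\<theta>: "0 \<le> K\<theta>" "\<And>h. norm (\<theta>'' h) \<le> norm h * K\<theta>"
      using bounded_linear.nonneg_bounded[OF bl\<theta>''] by blast
    \<comment> \<open>\<open>C\<close> is the constant of the resolvent estimate; the summand \<open>2\<close> below accounts for \<open>\<theta>\<close>.\<close>
    define C where "C = lam * (2 * K\<Gamma> + 1 + 2 * inverse lam + (K\<Gamma> + 1 + 2 * inverse lam) + 2 * norm n\<^sub>0 + 2 * (K\<theta> + 1))"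
    have C: "0 \<le> C" unfolding C_def using lam K\<Gamma> K\<theta> by (intro mult_nonneg_nonneg add_nonneg_nonneg) auto
    define \<eta> where "\<eta> = min (1 / 2) (e / (C + 2))"
    have \<eta>: "0 < \<eta>" "\<eta> \<le> 1 / 2"
      using e C unfolding \<eta>_def by (simp, intro min.cobounded1)
    have "\<eta> \<le> e / (C + 2)" by (simp add: \<eta>_def)
    then have \<eta>e: "(C + 2) * \<eta> \<le> e" using C by (simp add: field_simps)
    obtain d1 where d1: "0 < d1"
      "\<And>t t'. t \<in> ball 0 d1 \<Longrightarrow> t' \<in> ball 0 d1 \<Longrightarrow> norm (\<theta> t - \<theta> t' - (t - t')) \<le> \<eta> * norm (t - t')"
      using strict_derivD[OF \<theta>_strict \<eta>(1)] by blast
    obtain d2 where d2: "0 < d2"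
      "\<And>t t'. t \<in> ball 0 d2 \<Longrightarrow> t' \<in> ball 0 d2 \<Longrightarrow> norm (\<theta>' t - \<theta>' t' - \<theta>'' (t - t')) \<le> \<eta> * norm (t - t')"
      using strict_derivD[OF \<theta>'_strict \<eta>(1)] by blast
    obtain d3 where d3: "0 < d3" "\<And>t. dist t 0 < d3 \<Longrightarrow> dist (\<theta>' t) (\<theta>' 0) < \<eta>"
      using \<theta>'_cont \<eta>(1) unfolding continuous_at_eps_delta by blast
    obtain d4 where d4: "0 < d4" "\<And>t u \<sigma>. dist t 0 < d4 \<Longrightarrow> t \<in> T \<Longrightarrow> u \<in> convex_subdiff \<phi> (\<theta> t) \<Longrightarrow> \<sigma> \<in> T
        \<Longrightarrow> (\<gamma> (\<theta> t) - u) \<bullet> \<theta>' t \<sigma> = 0"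
      using subgradient_tangential unfolding eventually_nhds_metric by metis
    obtain d5 where d5: "0 < d5"
      "\<And>x x'. x \<in> ball x\<^sub>0 d5 \<Longrightarrow> x' \<in> ball x\<^sub>0 d5 \<Longrightarrow> norm (\<gamma> x - \<gamma> x' - \<Gamma> (x - x')) \<le> \<eta> * norm (x - x')"
      using strict_derivD[OF \<gamma>_strict \<eta>(1)] by blast
    define b where "b = min (min d1 d2) (min d3 d4)"
    have b: "0 < b" using d1 d2 d3 d4 by (simp add: b_def)
    have pc: "isCont (prox lam \<phi>) z\<^sub>0"
      using continuous_on_prox[OF lam, of UNIV] by (simp add: continuous_on_eq_continuous_at)
    have "isCont \<gamma> x\<^sub>0"
      using strict_deriv_imp_has_derivative[OF \<gamma>_strict] has_derivative_continuous by blast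
    then have "isCont (\<lambda>z. \<gamma> (prox lam \<phi> z)) z\<^sub>0"
      using isCont_o2[OF pc, of \<gamma>] by (simp add: prox_z\<^sub>0)
    then have ac: "isCont (\<lambda>z. \<gamma> (prox lam \<phi> z) + inverse lam *\<^sub>R (prox lam \<phi> z - z)) z\<^sub>0"
      using pc by (intro continuous_intros) auto
    have a0: "\<gamma> (prox lam \<phi> z\<^sub>0) + inverse lam *\<^sub>R (prox lam \<phi> z\<^sub>0 - z\<^sub>0) = n\<^sub>0"
      unfolding prox_z\<^sub>0 using lam by (simp add: n\<^sub>0_def z\<^sub>0_def)
    obtain d6 where d6: "0 < d6"
      "\<And>z. dist z z\<^sub>0 < d6 \<Longrightarrow> dist (\<gamma> (prox lam \<phi> z) + inverse lam *\<^sub>R (prox lam \<phi> z - z)) n\<^sub>0 < \<eta>"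
      using ac \<eta>(1) unfolding continuous_at_eps_delta a0 by blast
    obtain d7 where d7: "0 < d7" "\<And>z. dist z z\<^sub>0 < d7 \<Longrightarrow> \<exists>t\<in>T. norm t < b \<and> \<theta> t = prox lam \<phi> z"
      using prox_in_chart[OF b] unfolding z\<^sub>0_def[symmetric] eventually_nhds_metric by blast
    define r where "r = min d5 (min d6 d7)"
    have r: "0 < r" using d5 d6 d7 by (simp add: r_def)
    have opt: "\<exists>t. t \<in> T \<and> norm t < b \<and> \<theta> t = prox lam \<phi> z \<and> prox lam \<phi> z \<in> ball x\<^sub>0 d5 \<and>
        (\<forall>\<sigma>\<in>T. (\<gamma> (\<theta> t) + inverse lam *\<^sub>R (\<theta> t - z)) \<bullet> \<theta>' t \<sigma> = 0) \<and>
        norm (n\<^sub>0 - (\<gamma> (\<theta> t) + inverse lam *\<^sub>R (\<theta> t - z))) \<le> \<eta>"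
      if z: "z \<in> ball z\<^sub>0 r" for z
    proof -
      have z': "dist z z\<^sub>0 < d5" "dist z z\<^sub>0 < d6" "dist z z\<^sub>0 < d7" using z by (auto simp: r_def dist_commute)
      obtain t where t: "t \<in> T" "norm t < b" "\<theta> t = prox lam \<phi> z" using d7(2)[OF z'(3)] by blast
      have "norm (prox lam \<phi> z - prox lam \<phi> z\<^sub>0) \<le> norm (z - z\<^sub>0)" by (rule prox_nonexpansive(1)[OF lam])
      then have "prox lam \<phi> z \<in> ball x\<^sub>0 d5" using z'(1) by (simp add: prox_z\<^sub>0 dist_norm norm_minus_commute)
      moreover have "(\<gamma> (\<theta> t) + inverse lam *\<^sub>R (\<theta> t - z)) \<bullet> \<theta>' t \<sigma> = 0" if "\<sigma> \<in> T" for \<sigma>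
      proof -
        have "inverse lam *\<^sub>R (z - \<theta> t) \<in> convex_subdiff \<phi> (\<theta> t)"
          unfolding t(3) by (rule prox_subgradient[OF lam])
        moreover have "dist t 0 < d4" using t(2) by (simp add: b_def)
        ultimately have "(\<gamma> (\<theta> t) - inverse lam *\<^sub>R (z - \<theta> t)) \<bullet> \<theta>' t \<sigma> = 0"
          using d4(2) t(1) that by blast
        moreover have "\<gamma> (\<theta> t) - inverse lam *\<^sub>R (z - \<theta> t) = \<gamma> (\<theta> t) + inverse lam *\<^sub>R (\<theta> t - z)"
          by (simp add: algebra_simps)
        ultimately show ?thesis by simp
      qed
      moreover have "norm (n\<^sub>0 - (\<gamma> (\<theta> t) + inverse lam *\<^sub>R (\<theta> t - z))) \<le> \<eta>"
        using d6(2)[OF z'(2)] unfolding t(3) by (simp add: dist_norm norm_minus_commute)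
      ultimately show ?thesis using t by blast
    qed
    have "norm (prox lam \<phi> z - prox lam \<phi> z' - P (z - z')) \<le> e * norm (z - z')"
      if z: "z \<in> ball z\<^sub>0 r" and z': "z' \<in> ball z\<^sub>0 r" for z z'
    proof -
      obtain t where t: "t \<in> T" "norm t < b" "\<theta> t = prox lam \<phi> z" "prox lam \<phi> z \<in> ball x\<^sub>0 d5"
        "\<And>\<sigma>. \<sigma> \<in> T \<Longrightarrow> (\<gamma> (\<theta> t) + inverse lam *\<^sub>R (\<theta> t - z)) \<bullet> \<theta>' t \<sigma> = 0"
        using opt[OF z] by blast
      obtain t' where t': "t' \<in> T" "norm t' < b" "\<theta> t' = prox lam \<phi> z'" "prox lam \<phi> z' \<in> ball x\<^sub>0 d5"
        "\<And>\<sigma>. \<sigma> \<in> T \<Longrightarrow> (\<gamma> (\<theta> t') + inverse lam *\<^sub>R (\<theta> t' - z')) \<bullet> \<theta>' t' \<sigma> = 0"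
        "norm (n\<^sub>0 - (\<gamma> (\<theta> t') + inverse lam *\<^sub>R (\<theta> t' - z'))) \<le> \<eta>"
        using opt[OF z'] by blast
      have tb: "t \<in> ball 0 d1" "t' \<in> ball 0 d1" "t \<in> ball 0 d2" "t' \<in> ball 0 d2" "dist t 0 < d3"
        using t(2) t'(2) by (auto simp: b_def)
      have e1: "norm (\<theta> t - \<theta> t' - (t - t')) \<le> \<eta> * norm (t - t')" by (rule d1(2)) fact+
      have e2: "norm (\<theta>' t - \<theta>' t' - \<theta>'' (t - t')) \<le> \<eta> * norm (t - t')" by (rule d2(2)) fact+
      have e3: "norm (\<theta>' t - id_blinfun) \<le> \<eta>" using d3(2)[OF tb(5)] by (simp add: \<theta>'0 dist_norm)
      have e4: "norm (\<gamma> (\<theta> t) - \<gamma> (\<theta> t') - \<Gamma> (\<theta> t - \<theta> t')) \<le> \<eta> * norm (\<theta> t - \<theta> t')"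
        unfolding t(3) t'(3) by (rule d5(2)) fact+
      have e5: "norm (\<theta> t - \<theta> t') \<le> norm (z - z')"
        unfolding t(3) t'(3) by (rule prox_nonexpansive(1)[OF lam])
      note est = resolvent_estimate[of \<eta> K\<Gamma> K\<theta> t z _ t' z', OF \<eta> _ K\<Gamma>(1) _ K\<theta>(1) t(5) t'(5) e1 e2 e3 e4 t'(6) e5,
          folded C_def, unfolded mult.commute[of K\<Gamma>] mult.commute[of K\<theta>], OF K\<Gamma>(2) K\<theta>(2)]
      have \<tau>: "norm (t - t') \<le> 2 * norm (z - z')"
        using est(1)[of 0] T by (simp add: subspace_0)
      have "norm ((t - t') - P (z - z')) \<le> C * \<eta> * norm (z - z')"
      proof (rule P(7))
        show "t - t' \<in> T" using T t(1) t'(1) by (rule subspace_diff)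
        show "0 \<le> C * \<eta> * norm (z - z')" using C \<eta> by simp
        fix \<sigma> assume \<sigma>: "\<sigma> \<in> T"
        show "\<bar>(lam *\<^sub>R S (t - t') + (t - t') - (z - z')) \<bullet> \<sigma>\<bar> \<le> C * \<eta> * norm (z - z') * norm \<sigma>"
          by (rule est(2)[OF \<sigma> \<sigma>])
      qed
      moreover have "norm (\<theta> t - \<theta> t' - (t - t')) \<le> 2 * \<eta> * norm (z - z')"
        
        by (rule order_trans[OF e1]) (use mult_left_mono[OF \<tau>, of \<eta>] \<eta> in simp)
      ultimately have "norm (prox lam \<phi> z - prox lam \<phi> z' - P (z - z')) \<le> (C + 2) * \<eta> * norm (z - z')"
        using norm_triangle_ineq[of "\<theta> t - \<theta> t' - (t - t')" "(t - t') - P (z - z')"]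
        unfolding t(3) t'(3) by (simp add: algebra_simps)
      also have "\<dots> \<le> e * norm (z - z')" by (rule mult_right_mono[OF \<eta>e]) simp
      finally show ?thesis .
    qed
    then show "\<exists>d>0. \<forall>x\<in>ball z\<^sub>0 d. \<forall>y\<in>ball z\<^sub>0 d.
        norm (prox lam \<phi> x - prox lam \<phi> y - P (x - y)) \<le> e * norm (x - y)"
      using r by blast
  qed
  with P(1,4,5,6,3) show thesis by (rule that)
qed

text \<open>The hypothesis only provides quadratic decrease at points of the manifold near \<open>x\<^sub>0\<close>. The mean value
  theorem along the ray to one of them turns it into negativity of the second-order form
  in the direction of that ray.\<close>

lemma negative_tangent_direction:
  assumes \<eta>: "0 < \<eta>"
    and desc: "\<And>e. 0 < e \<Longrightarrow> \<exists>t\<in>T. t \<noteq> 0 \<and> norm t < e \<and>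
      G (\<theta> t) + f (\<theta> t) < G x\<^sub>0 + f x\<^sub>0 - \<eta> * (norm t)\<^sup>2"
  shows "\<exists>\<tau>\<in>T. S \<tau> \<bullet> \<tau> + hess f x\<^sub>0 \<tau> \<bullet> \<tau> < 0"
proof -
  \<comment> \<open>\<open>W s\<close> represents \<open>k \<mapsto> (\<gamma> + grad f) (\<theta> s) \<bullet> \<theta>' s k\<close> as a vector, so that its expansion at \<open>0\<close> is
      uniform in \<open>k\<close>.\<close>
  define W where "W s = (\<Sum>b\<in>Basis. ((\<gamma> (\<theta> s) + grad f (\<theta> s)) \<bullet> \<theta>' s b) *\<^sub>R b)" for s
  define W' where "W' h = (\<Sum>b\<in>Basis. (n\<^sub>0 \<bullet> \<theta>'' h b + (\<Gamma> h + hess f x\<^sub>0 h) \<bullet> b) *\<^sub>R b)" for h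
  have md: "((\<lambda>x. \<gamma> x + grad f x) has_derivative (\<lambda>h. \<Gamma> h + hess f x\<^sub>0 h)) (at x\<^sub>0)"
    by (intro has_derivative_add strict_deriv_imp_has_derivative[OF \<gamma>_strict] C2_on_UNIV_grad(2)[OF f])
  have Wd: "(W has_derivative W') (at 0)"
    unfolding W_def[abs_def] W'_def[abs_def] n\<^sub>0_def
    by (intro has_derivative_sum has_derivative_scaleR_left pairing_deriv[OF md])
  have rep: "(\<Sum>b\<in>Basis. l b *\<^sub>R b) \<bullet> k = l k" if "linear l" for l :: "'a \<Rightarrow> real" and k
  proof -
    have "l k = l (\<Sum>b\<in>Basis. (k \<bullet> b) *\<^sub>R b)" by (simp add: euclidean_representation)
    also have "\<dots> = (\<Sum>b\<in>Basis. (k \<bullet> b) * l b)"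
      using that by (simp add: linear_sum linear_cmul)
    finally show ?thesis by (simp add: inner_sum_left inner_sum_right mult.commute inner_commute)
  qed
  have W: "W s \<bullet> k = (\<gamma> (\<theta> s) + grad f (\<theta> s)) \<bullet> \<theta>' s k" for s k
    unfolding W_def by (rule rep) (auto intro!: linearI simp: blinfun.add_right blinfun.scaleR_right inner_add_right)
  have W': "W' h \<bullet> k = S h \<bullet> k + hess f x\<^sub>0 h \<bullet> k" for h k
    unfolding W'_def
    by (subst rep) (auto intro!: linearI
        simp: blinfun.add_right blinfun.scaleR_right inner_add_right inner_add_left S_inner algebra_simps)
  interpret W': bounded_linear W' using Wd by (rule has_derivative_bounded_linear)
  obtain d1 where d1: "0 < d1" "\<And>s. norm (s - 0) < d1 \<Longrightarrow> norm (W s - W 0 - W' (s - 0)) \<le> \<eta> * norm (s - 0)"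
    using Wd \<eta> unfolding has_derivative_at_alt by blast
  obtain d2 where d2: "0 < d2" "\<And>s. norm s < d2 \<Longrightarrow> (\<theta> has_derivative \<theta>' s) (at s) \<and>
     (G has_derivative (\<lambda>h. \<gamma> (\<theta> s) \<bullet> h)) (at (\<theta> s))"
    using eventually_nice unfolding eventually_nhds_metric by auto
  obtain t where t: "t \<in> T" "t \<noteq> 0" "norm t < min d1 d2"
    "G (\<theta> t) + f (\<theta> t) < G x\<^sub>0 + f x\<^sub>0 - \<eta> * (norm t)\<^sup>2"
    using desc[of "min d1 d2"] d1 d2 by auto
  define \<rho> where "\<rho> r = G (\<theta> (0 + r *\<^sub>R t)) + f (\<theta> (0 + r *\<^sub>R t))" for r
  have small: "norm (r *\<^sub>R t) < min d1 d2" if "0 \<le> r" "r \<le> 1" for r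
    using that t(3) mult_left_le_one_le[of "norm t" r] by simp
  have \<rho>d: "(\<rho> has_real_derivative W (r *\<^sub>R t) \<bullet> t) (at r)" if r: "0 \<le> r" "r \<le> 1" for r
  proof -
    have sm: "norm (0 + r *\<^sub>R t) < d2" using small[OF r] by simp
    have "((\<lambda>x. f x) has_derivative (\<lambda>h. grad f (\<theta> (0 + r *\<^sub>R t)) \<bullet> h)) (at (\<theta> (0 + r *\<^sub>R t)))"
      using C2_on_UNIV_grad(1)[OF f] unfolding gderiv_def by (simp add: inner_commute)
    from has_derivative_add[OF conjunct2[OF d2(2)[OF sm]] this]
    have "((\<lambda>x. G x + f x) has_derivative (\<lambda>h. (\<gamma> (\<theta> (0 + r *\<^sub>R t)) + grad f (\<theta> (0 + r *\<^sub>R t))) \<bullet> h)) (at (\<theta> (0 + r *\<^sub>R t)))"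
      by (simp add: inner_add_left)
    from ray_deriv[where m="\<lambda>x. \<gamma> x + grad f x", OF conjunct1[OF d2(2)[OF sm]] this]
    show ?thesis by (simp add: \<rho>_def[abs_def] W)
  qed
  have "\<exists>r>0. r < 1 \<and> \<rho> 1 - \<rho> 0 = (1 - 0) * (W (r *\<^sub>R t) \<bullet> t)"
    by (rule MVT2) (use \<rho>d in auto)
  then obtain r where r: "0 < r" "r < 1" "\<rho> 1 - \<rho> 0 = W (r *\<^sub>R t) \<bullet> t" by auto
  have "W 0 \<bullet> t = 0" using n\<^sub>0_normal[OF t(1)] by (simp add: W \<theta>0 \<theta>'0 n\<^sub>0_def)
  have "\<bar>(W (r *\<^sub>R t) - W 0 - W' (r *\<^sub>R t)) \<bullet> t\<bar> \<le> norm (W (r *\<^sub>R t) - W 0 - W' (r *\<^sub>R t)) * norm t"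
    by (rule Cauchy_Schwarz_ineq2)
  also have "\<dots> \<le> (\<eta> * norm (r *\<^sub>R t)) * norm t"
    using d1(2)[of "r *\<^sub>R t"] small[of r] r by (intro mult_right_mono) auto
  also have "\<dots> = r * (\<eta> * (norm t)\<^sup>2)" using r by (simp add: power2_eq_square)
  also have "\<dots> \<le> 1 * (\<eta> * (norm t)\<^sup>2)" using r \<eta> by (intro mult_right_mono) auto
  finally have "r * (W' t \<bullet> t) \<le> W (r *\<^sub>R t) \<bullet> t + \<eta> * (norm t)\<^sup>2"
    using \<open>W 0 \<bullet> t = 0\<close> by (simp add: inner_diff_left W'.scaleR)
  also have "\<dots> < 0" using t(4) r(3) by (simp add: \<rho>_def \<theta>0)
  finally have "W' t \<bullet> t < 0" using r(1) by (simp add: mult_less_0_iff)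
  then show ?thesis using t(1) by (auto simp: W')
qed

end

lemma Lipschitz_gradient_upper_bound:
  fixes f :: "'a::euclidean_space \<Rightarrow> real"
  assumes f: "C2_on f UNIV" and L: "L-lipschitz_on UNIV (grad f)"
  shows "f w \<le> f y + grad f y \<bullet> (w - y) + L * (norm (w - y))\<^sup>2"
proof -
  define \<rho> where "\<rho> r = f (y + r *\<^sub>R (w - y))" for r
  have "\<exists>r\<in>{0<..<1}. \<rho> 1 - \<rho> 0 = (\<lambda>c. c *\<^sub>R (w - y) \<bullet> grad f (y + r *\<^sub>R (w - y))) (1 - 0)"
  proof (rule mvt_simple)
    fix r :: real
    have "((\<lambda>r. y + r *\<^sub>R (w - y)) has_derivative (\<lambda>c. c *\<^sub>R (w - y))) (at r)"
      by (auto intro!: derivative_eq_intros)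
    from has_derivative_compose[OF this C2_on_UNIV_grad(1)[OF f, unfolded gderiv_def]]
    show "(\<rho> has_derivative (\<lambda>c. c *\<^sub>R (w - y) \<bullet> grad f (y + r *\<^sub>R (w - y)))) (at r within {0..1})"
      unfolding \<rho>_def[abs_def] by (rule has_derivative_at_withinI)
  qed simp
  then obtain r where r: "0 < r" "r < 1" "f w - f y = (w - y) \<bullet> grad f (y + r *\<^sub>R (w - y))"
    by (auto simp: \<rho>_def)
  have L0: "0 \<le> L" using L by (rule lipschitz_on_nonneg)
  have "norm (grad f (y + r *\<^sub>R (w - y)) - grad f y) \<le> L * (r * norm (w - y))"
    using lipschitz_onD[OF L, of "y + r *\<^sub>R (w - y)" y] r by (simp add: dist_norm)
  also have "\<dots> \<le> L * norm (w - y)"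
    using r L0 by (intro mult_left_mono) (auto simp: mult_left_le_one_le)
  finally have "norm (w - y) * norm (grad f (y + r *\<^sub>R (w - y)) - grad f y) \<le> norm (w - y) * (L * norm (w - y))"
    by (intro mult_left_mono) auto
  moreover have "(w - y) \<bullet> (grad f (y + r *\<^sub>R (w - y)) - grad f y) \<le> norm (w - y) * norm (grad f (y + r *\<^sub>R (w - y)) - grad f y)"
    by (rule norm_cauchy_schwarz)
  ultimately show ?thesis
    using r(3) by (simp add: inner_diff_right inner_commute power2_eq_square mult_ac)
qed

context prox_function
begin

text \<open>The step moves a point near a critical point to one that carries a small subgradient of \<open>\<psi>\<close>, hence
  lies on the active manifold, and does not increase \<open>\<psi>\<close>.\<close>

lemma prox_gradient_descent:
  assumes f: "C2_on f UNIV" and L: "L-lipschitz_on UNIV (grad f)"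
    and g: "0 < g" "2 * g * L \<le> 1"
  shows "ereal (f (prox g \<phi> (y - g *\<^sub>R grad f y))) + \<phi> (prox g \<phi> (y - g *\<^sub>R grad f y)) \<le> ereal (f y) + \<phi> y"
proof -
  define w where "w = prox g \<phi> (y - g *\<^sub>R grad f y)"
  have min: "\<phi> w + ereal (1 / (2 * g) * (norm (y - g *\<^sub>R grad f y - w))\<^sup>2)
      \<le> \<phi> y + ereal (1 / (2 * g) * (norm (y - g *\<^sub>R grad f y - y))\<^sup>2)"
    unfolding w_def by (rule prox_minimizes[OF g(1)])
  have sq: "(norm (y - g *\<^sub>R grad f y - w))\<^sup>2 = (norm (w - y))\<^sup>2 + 2 * g * (grad f y \<bullet> (w - y)) + g\<^sup>2 * (norm (grad f y))\<^sup>2"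
    unfolding power2_norm_eq_inner
    by (simp add: inner_diff_left inner_diff_right inner_commute power2_eq_square algebra_simps)
  have e1: "1 / (2 * g) * (norm (y - g *\<^sub>R grad f y - w))\<^sup>2
      = 1 / (2 * g) * (norm (w - y))\<^sup>2 + grad f y \<bullet> (w - y) + g / 2 * (norm (grad f y))\<^sup>2"
    unfolding sq using g(1) by (simp add: field_simps power2_eq_square)
  have e2: "1 / (2 * g) * (norm (y - g *\<^sub>R grad f y - y))\<^sup>2 = g / 2 * (norm (grad f y))\<^sup>2"
    using g(1) by (simp add: power_mult_distrib power2_eq_square field_simps)
  have "L \<le> 1 / (2 * g)" using g by (simp add: field_simps)
  then have "L * (norm (w - y))\<^sup>2 \<le> 1 / (2 * g) * (norm (w - y))\<^sup>2" by (rule mult_right_mono) simp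
  then have fw: "f w \<le> f y + grad f y \<bullet> (w - y) + 1 / (2 * g) * (norm (w - y))\<^sup>2"
    using Lipschitz_gradient_upper_bound[OF f L, of w y] by linarith
  show ?thesis
    unfolding w_def[symmetric]
    using min not_MInf[of y] not_MInf[of w] fw unfolding e1 e2
    by (cases "\<phi> y"; cases "\<phi> w") auto
qed

text \<open>The last conclusion is \<open>\<langle>P v, H v\<rangle> < 0\<close> for the linearized normal map
  \<open>H = hess f x\<^sub>0 P + (I - P) / lam\<close>. With \<open>\<tau> = P v\<close> tangent to the manifold, the equation of the resolvent
  rewrites \<open>\<langle>\<tau>, v - \<tau>\<rangle> / lam\<close> as \<open>\<langle>S \<tau>, \<tau>\<rangle>\<close>, and the left-hand side becomes the second derivative of
  \<open>\<psi>\<close> along the manifold. To make this negative, the points that witness a negative second subderivative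
  are moved onto the manifold by a proximal gradient step.\<close>

theorem active_strict_saddle_prox_derivative:
  assumes f: "C2_on f UNIV" and L: "L-lipschitz_on UNIV (grad f)" and lam: "0 < lam"
    and saddle: "x\<^sub>0 \<in> active_strict_saddles (\<lambda>y. ereal (f y) + \<phi> y)"
  obtains P v where "linear P" "\<And>x y. P x \<bullet> y = x \<bullet> P y" "\<And>d. (norm (P d))\<^sup>2 \<le> d \<bullet> P d"
    "strict_deriv (prox lam \<phi>) P (x\<^sub>0 - lam *\<^sub>R grad f x\<^sub>0)"
    "prox lam \<phi> (x\<^sub>0 - lam *\<^sub>R grad f x\<^sub>0) = x\<^sub>0"
    "P v \<bullet> hess f x\<^sub>0 (P v) + inverse lam * (P v \<bullet> (v - P v)) < 0"
proof -
  define \<psi> where "\<psi> y = ereal (f y) + \<phi> y" for y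
  note lim_sub = limiting_subdiff_composite[OF f proper convex, folded \<psi>_def[abs_def]]
  have "x\<^sub>0 \<in> active_strict_saddles \<psi>"
    using saddle unfolding \<psi>_def[abs_def] .
  then have zero: "0 \<in> limiting_subdiff \<psi> x\<^sub>0" and "\<exists>M. active_manifold \<psi> x\<^sub>0 M"
    and neg: "(INF h\<in>sphere 0 1. second_subderivative \<psi> x\<^sub>0 0 h) < 0"
    unfolding active_strict_saddles_def by simp_all
  then obtain M where M: "active_manifold \<psi> x\<^sub>0 M" by blast
  from zero obtain u where u: "u \<in> convex_subdiff \<phi> x\<^sub>0" "0 = grad f x\<^sub>0 + u" unfolding lim_sub by blast
  then have "u = - grad f x\<^sub>0" by (simp add: eq_neg_iff_add_eq_0 add.commute)
  with u have critical: "- grad f x\<^sub>0 \<in> convex_subdiff \<phi> x\<^sub>0" by simp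
  from M obtain U where U: "open U" "x\<^sub>0 \<in> U" "C2_manifold (M \<inter> U)" "C2_restricted \<psi> (M \<inter> U)"
    "0 < (INF y\<in>U - M. INF v\<in>limiting_subdiff \<psi> y. ereal (dist 0 v))"
    unfolding active_manifold_def by blast
  obtain c :: real where c: "0 < ereal c" "ereal c < (INF y\<in>U - M. INF v\<in>limiting_subdiff \<psi> y. ereal (dist 0 v))"
    using ereal_dense2[OF U(5)] by blast
  have c0: "0 < c" using c(1) by simp
  have identify: "x \<in> M" if "x \<in> U" "v \<in> convex_subdiff \<phi> x" "norm (grad f x + v) < c" for x v
  proof (rule ccontr)
    assume "x \<notin> M"
    then have "(INF y\<in>U - M. INF v\<in>limiting_subdiff \<psi> y. ereal (dist 0 v)) \<le> (INF v\<in>limiting_subdiff \<psi> x. ereal (dist 0 v))"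
      using that(1) by (intro INF_lower) auto
    also have "\<dots> \<le> ereal (dist 0 (grad f x + v))"
      using that(2) by (intro INF_lower) (auto simp: lim_sub)
    finally have "ereal c < ereal (dist 0 (grad f x + v))" by (rule less_le_trans[OF c(2)])
    then show False using that(3) by simp
  qed
  have x0M: "x\<^sub>0 \<in> M \<inter> U" using identify[OF U(2) critical] U(2) c0 by simp
  obtain T \<theta> \<theta>' \<theta>'' where T: "subspace T" and \<theta>: "\<theta> 0 = x\<^sub>0" "\<forall>\<^sub>F t in nhds 0. (\<theta> has_derivative blinfun_apply (\<theta>' t)) (at t)"
    "\<theta>' 0 = id_blinfun" "strict_deriv \<theta>' \<theta>'' 0" "\<forall>\<^sub>F t in nhds 0. t \<in> T \<longrightarrow> \<theta> t \<in> M \<inter> U"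
    and chart: "\<And>e. 0 < e \<Longrightarrow> \<forall>\<^sub>F x in nhds x\<^sub>0. x \<in> M \<inter> U \<longrightarrow> (\<exists>t\<in>T. norm t < e \<and> \<theta> t = x)"
    by (rule C2_manifold_chart[OF U(3) x0M]) blast
  from bspec[OF U(4)[unfolded C2_restricted_def] x0M]
  obtain V g where V: "x\<^sub>0 \<in> V" "C2_on g V" "\<forall>x\<in>M \<inter> U \<inter> V. \<psi> x = ereal (g x)"
    by (elim exE conjE)
  have "open V" using V(2) by (simp add: C2_on_def)
  then have evV: "\<forall>\<^sub>F x in nhds x\<^sub>0. x \<in> V" using V(1) eventually_nhds by blast
  obtain \<gamma>g \<Gamma>g :: "'a \<Rightarrow> 'a" where \<gamma>g: "\<And>x. x \<in> V \<Longrightarrow> (g has_derivative (\<lambda>h. \<gamma>g x \<bullet> h)) (at x)"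
    "strict_deriv \<gamma>g \<Gamma>g x\<^sub>0" "\<And>h k. \<Gamma>g h \<bullet> k = h \<bullet> \<Gamma>g k"
    using C2_on_gradient[OF V(2) V(1)] by blast
  have fd: "(f has_derivative (\<lambda>h. grad f x \<bullet> h)) (at x)" for x
    using C2_on_UNIV_grad(1)[OF f] unfolding gderiv_def by (simp add: inner_commute)
  have \<theta>_lim: "(\<theta> \<longlongrightarrow> x\<^sub>0) (nhds 0)"
  proof -
    have "isCont \<theta> 0" using eventually_nhds_x_imp_x[OF \<theta>(2)] has_derivative_continuous by blast
    then show ?thesis by (rule isCont_tendsto_nhds) (rule \<theta>(1))
  qed
  let ?z = "x\<^sub>0 - lam *\<^sub>R grad f x\<^sub>0"
  have prox0: "prox lam \<phi> ?z = x\<^sub>0"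
    by (rule prox_eqI[OF lam]) (use lam critical in simp)
  have pc: "isCont (prox lam \<phi>) ?z"
    using continuous_on_prox[OF lam, of UNIV] by (simp add: continuous_on_eq_continuous_at)
  have pl: "(prox lam \<phi> \<longlongrightarrow> x\<^sub>0) (nhds ?z)"
    by (rule isCont_tendsto_nhds[OF pc prox0])
  have prox_land: "\<forall>\<^sub>F z in nhds ?z. \<exists>t\<in>T. norm t < e \<and> \<theta> t = prox lam \<phi> z" if e: "0 < e" for e
  proof -
    have "isCont (\<lambda>z. grad f (prox lam \<phi> z)) ?z"
      using isCont_o2[OF pc C2_on_UNIV_grad(4)[OF f]] .
    then have "isCont (\<lambda>z. grad f (prox lam \<phi> z) + inverse lam *\<^sub>R (z - prox lam \<phi> z)) ?z"
      using pc by (intro continuous_intros) auto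
    then have "((\<lambda>z. grad f (prox lam \<phi> z) + inverse lam *\<^sub>R (z - prox lam \<phi> z)) \<longlongrightarrow> 0) (nhds ?z)"
      by (rule isCont_tendsto_nhds) (use lam in \<open>simp add: prox0\<close>)
    then have 1: "\<forall>\<^sub>F z in nhds ?z. norm (grad f (prox lam \<phi> z) + inverse lam *\<^sub>R (z - prox lam \<phi> z)) < c"
      using c0 by (auto dest: tendstoD)
    have "\<forall>\<^sub>F x in nhds x\<^sub>0. x \<in> U" using U(1,2) eventually_nhds by blast
    then have 2: "\<forall>\<^sub>F z in nhds ?z. prox lam \<phi> z \<in> U" by (rule eventually_compose_filterlim[OF _ pl])
    show ?thesis
      using 1 2 eventually_compose_filterlim[OF chart[OF e] pl]
    proof eventually_elim
      case (elim z)
      have "prox lam \<phi> z \<in> M" by (rule identify[OF elim(2) prox_subgradient[OF lam] elim(1)])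
      then show ?case using elim by simp
    qed
  qed
  define G where "G x = g x - f x" for x
  define \<Gamma> where "\<Gamma> h = \<Gamma>g h + - hess f x\<^sub>0 h" for h
  define \<gamma> where "\<gamma> x = \<gamma>g x + - grad f x" for x
  interpret prox_chart \<phi> f lam x\<^sub>0 T \<theta> \<theta>' \<theta>'' G \<gamma> \<Gamma>
  proof
    show "0 < lam" "C2_on f UNIV" "- grad f x\<^sub>0 \<in> convex_subdiff \<phi> x\<^sub>0" "subspace T" "\<theta> 0 = x\<^sub>0"
      "\<forall>\<^sub>F t in nhds 0. (\<theta> has_derivative blinfun_apply (\<theta>' t)) (at t)"
      "\<theta>' 0 = id_blinfun" "strict_deriv \<theta>' \<theta>'' 0" by fact+
    show "\<forall>\<^sub>F z in nhds ?z. \<exists>t\<in>T. norm t < e \<and> \<theta> t = prox lam \<phi> z" if "0 < e" for e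
      by (rule prox_land[OF that])
    show "\<forall>\<^sub>F t in nhds 0. t \<in> T \<longrightarrow> \<phi> (\<theta> t) = ereal (G (\<theta> t))"
      using \<theta>(5) eventually_compose_filterlim[OF evV \<theta>_lim]
    proof eventually_elim
      case (elim t)
      show ?case
      proof
        assume "t \<in> T"
        then have "ereal (f (\<theta> t)) + \<phi> (\<theta> t) = ereal (g (\<theta> t))"
          using V(3) elim by (simp add: \<psi>_def)
        then show "\<phi> (\<theta> t) = ereal (G (\<theta> t))" by (cases "\<phi> (\<theta> t)") (auto simp: G_def)
      qed
    qed
    show "\<forall>\<^sub>F x in nhds x\<^sub>0. (G has_derivative (\<lambda>h. \<gamma> x \<bullet> h)) (at x)"
      using evV
    proof eventually_elim
      case (elim x)
      show ?case
        using has_derivative_diff[OF \<gamma>g(1)[OF elim] fd[of x]]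
        by (simp add: G_def[abs_def] \<gamma>_def inner_diff_left)
    qed
    have "strict_deriv (\<lambda>x. - grad f x) (\<lambda>h. - hess f x\<^sub>0 h) x\<^sub>0"
      by (intro strict_deriv_compose_linear[OF bounded_linear_minus[OF bounded_linear_ident]] C2_on_UNIV_hess(1)[OF f])
    from strict_deriv_add[OF \<gamma>g(2) this]
    show "strict_deriv \<gamma> \<Gamma> x\<^sub>0" by (simp only: \<gamma>_def[abs_def] \<Gamma>_def[abs_def])
    show "\<Gamma> h \<bullet> k = h \<bullet> \<Gamma> k" for h k
      using \<gamma>g(3)[of h k] C2_on_UNIV_hess(2)[OF f, of x\<^sub>0 h k]
      by (simp add: \<Gamma>_def inner_diff_left inner_diff_right)
  qed
  obtain P where P: "linear P" "\<And>x y. P x \<bullet> y = x \<bullet> P y" "\<And>d. (norm (P d))\<^sup>2 \<le> d \<bullet> P d"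
    "\<And>y. y \<in> T \<Longrightarrow> \<exists>d. P d = y" "\<And>d \<sigma>. \<sigma> \<in> T \<Longrightarrow> (lam *\<^sub>R S (P d) + P d - d) \<bullet> \<sigma> = 0"
    "strict_deriv (prox lam \<phi>) P z\<^sub>0"
    using prox_strict_deriv by blast
  from neg obtain h where h: "norm h = 1" "second_subderivative \<psi> x\<^sub>0 0 h < 0"
    unfolding INF_less_iff by auto
  then have "\<not> 0 \<le> Liminf (at_right 0 \<times>\<^sub>F nhds h)
       (\<lambda>(t, k). (\<psi> (x\<^sub>0 + t *\<^sub>R k) - \<psi> x\<^sub>0 - ereal (t * (0 \<bullet> k))) / ereal (t\<^sup>2 / 2))"
    unfolding second_subderivative_def by (simp add: not_le)
  then obtain e where e: "0 < e" "\<exists>\<^sub>F p in at_right 0 \<times>\<^sub>F nhds h. \<not> - ereal e <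
      (case p of (t, k) \<Rightarrow> (\<psi> (x\<^sub>0 + t *\<^sub>R k) - \<psi> x\<^sub>0 - ereal (t * (0 \<bullet> k))) / ereal (t\<^sup>2 / 2))"
    unfolding ereal_Liminf_ge_iff frequently_def by auto
  obtain p0 where p0: "\<phi> x\<^sub>0 = ereal p0" using critical by (auto simp: convex_subdiff_def)
  have L0: "0 \<le> L" using L by (rule lipschitz_on_nonneg)
  \<comment> \<open>The step size of the auxiliary proximal gradient step, unrelated to \<open>lam\<close>; it satisfies
      \<open>2 g\<^sub>0 L \<le> 1\<close>, and the summand \<open>1\<close> covers \<open>L = 0\<close>.\<close>
  define g\<^sub>0 where "g\<^sub>0 = inverse (2 * (L + 1))"
  have g0: "0 < g\<^sub>0" "2 * g\<^sub>0 * L \<le> 1" "g\<^sub>0 * L \<le> 1" using L0 by (auto simp: g\<^sub>0_def field_simps)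
  have "\<exists>t\<in>T. t \<noteq> 0 \<and> norm t < \<epsilon> \<and> G (\<theta> t) + f (\<theta> t) < G x\<^sub>0 + f x\<^sub>0 - e / 256 * (norm t)\<^sup>2"
    if \<epsilon>: "0 < \<epsilon>" for \<epsilon>
  proof -
    obtain d1 where d1: "0 < d1"
      "\<And>t t'. t \<in> ball 0 d1 \<Longrightarrow> t' \<in> ball 0 d1 \<Longrightarrow> norm (\<theta> t - \<theta> t' - (t - t')) \<le> 1 / 2 * norm (t - t')"
      using strict_derivD[OF \<theta>_strict, of "1 / 2"] by (metis half_gt_zero zero_less_one)
    obtain d2 where d2: "0 < d2" "\<And>t. dist t 0 < d2 \<Longrightarrow> t \<in> T \<Longrightarrow> \<phi> (\<theta> t) = ereal (G (\<theta> t))"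
      using \<phi>_chart unfolding eventually_nhds_metric by blast
    define b where "b = min \<epsilon> (min d1 d2)"
    have b: "0 < b" using \<epsilon> d1 d2 by (simp add: b_def)
    obtain d3 where d3: "0 < d3" "\<And>x. dist x x\<^sub>0 < d3 \<Longrightarrow> x \<in> M \<inter> U \<Longrightarrow> \<exists>t\<in>T. norm t < b \<and> \<theta> t = x"
      using chart[OF b] unfolding eventually_nhds_metric by blast
    obtain d4 where d4: "0 < d4" "ball x\<^sub>0 d4 \<subseteq> U" using U(1,2) open_contains_ball by blast
    \<comment> \<open>For \<open>w\<close> produced by the step from \<open>y\<close>, \<open>\<psi>\<close> has a subgradient at \<open>w\<close> of norm at most
        \<open>K |y - x\<^sub>0|\<close>; here \<open>2 (L + 1) = 1 / g\<^sub>0\<close>.\<close>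
    define K where "K = 3 * (2 * (L + 1) + L)"
    have K: "0 < K" using L0 by (simp add: K_def)
    define r where "r = min (min d3 d4 / 4) (c / (2 * K))"
    have r: "0 < r" using d3 d4 c0 K by (simp add: r_def)
    have "\<forall>\<^sub>F p in at_right 0 \<times>\<^sub>F nhds h. (0 < fst p \<and> fst p < r) \<and> norm (snd p) < 2"
      unfolding eventually_prod_filter
    proof (intro exI conjI allI impI)
      show "\<forall>\<^sub>F t in at_right 0. 0 < t \<and> t < r"
        using r by (auto simp: eventually_at_right_field intro!: exI[of _ r])
      have "open {k :: 'a. norm k < 2}"
        by (intro open_Collect_less continuous_intros)
      then show "\<forall>\<^sub>F k in nhds h. norm k < 2"
        using h(1) unfolding eventually_nhds by (intro exI[of _ "{k. norm k < 2}"]) auto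
    qed auto
    from frequently_eventually_conj[OF e(2) this]
    obtain t k where tk: "0 < t" "t < r" "norm k < 2" and
      quot: "(\<psi> (x\<^sub>0 + t *\<^sub>R k) - \<psi> x\<^sub>0 - ereal (t * (0 \<bullet> k))) / ereal (t\<^sup>2 / 2) \<le> - ereal e"
      by (auto dest!: frequently_ex simp: not_less)
    define y where "y = x\<^sub>0 + t *\<^sub>R k"
    have yx: "norm (y - x\<^sub>0) \<le> 2 * t"
      using tk by (simp add: y_def mult.commute)
    have \<psi>x: "\<psi> x\<^sub>0 = ereal (f x\<^sub>0 + p0)" by (simp add: \<psi>_def p0)
    obtain s where s: "\<phi> y = ereal s" "f y + s \<le> f x\<^sub>0 + p0 - e * t\<^sup>2 / 2"
    proof (cases "\<phi> y")
      case (real s)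
      then have "(f y + s - (f x\<^sub>0 + p0)) / (t\<^sup>2 / 2) \<le> - e"
        using quot unfolding \<psi>x y_def[symmetric] using tk(1) by (simp add: \<psi>_def)
      then have "f y + s - (f x\<^sub>0 + p0) \<le> - e * (t\<^sup>2 / 2)"
        using tk(1) by (simp add: pos_divide_le_eq)
      then show thesis using real that by (simp add: algebra_simps)
    next
      case PInf
      then have "\<psi> y = \<infinity>" by (simp add: \<psi>_def)
      then show thesis using quot tk(1) unfolding y_def[symmetric] \<psi>x by simp
    next
      case MInf then show thesis using not_MInf by blast
    qed
    define w where "w = prox g\<^sub>0 \<phi> (y - g\<^sub>0 *\<^sub>R grad f y)"
    have w0: "prox g\<^sub>0 \<phi> (x\<^sub>0 - g\<^sub>0 *\<^sub>R grad f x\<^sub>0) = x\<^sub>0"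
      by (rule prox_eqI[OF g0(1)]) (use g0 critical in simp)
    have glip: "norm (grad f a - grad f b) \<le> L * norm (a - b)" for a b
      using lipschitz_onD[OF L, of a b] by (simp add: dist_norm)
    have wx: "norm (w - x\<^sub>0) \<le> 2 * norm (y - x\<^sub>0)"
    proof -
      have "norm (w - x\<^sub>0) \<le> norm ((y - g\<^sub>0 *\<^sub>R grad f y) - (x\<^sub>0 - g\<^sub>0 *\<^sub>R grad f x\<^sub>0))"
        unfolding w_def by (subst w0[symmetric]) (rule prox_nonexpansive(1)[OF g0(1)])
      also have "\<dots> = norm ((y - x\<^sub>0) - g\<^sub>0 *\<^sub>R (grad f y - grad f x\<^sub>0))" by (simp add: algebra_simps)
      also have "\<dots> \<le> norm (y - x\<^sub>0) + g\<^sub>0 * norm (grad f y - grad f x\<^sub>0)"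
        using norm_triangle_ineq4[of "y - x\<^sub>0" "g\<^sub>0 *\<^sub>R (grad f y - grad f x\<^sub>0)"] g0(1) by simp
      also have "g\<^sub>0 * norm (grad f y - grad f x\<^sub>0) \<le> g\<^sub>0 * (L * norm (y - x\<^sub>0))"
        using g0(1) glip by (intro mult_left_mono) auto
      also have "\<dots> = (g\<^sub>0 * L) * norm (y - x\<^sub>0)" by simp
      also have "\<dots> \<le> 1 * norm (y - x\<^sub>0)" using g0(3) by (intro mult_right_mono) auto
      finally show ?thesis by simp
    qed
    have yw: "norm (y - w) \<le> 3 * norm (y - x\<^sub>0)"
      using wx norm_triangle_ineq[of "y - x\<^sub>0" "x\<^sub>0 - w"] by (simp add: norm_minus_commute)
    have wU: "w \<in> U" and w3: "dist w x\<^sub>0 < d3"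
    proof -
      have "norm (w - x\<^sub>0) < 4 * r" using wx yx tk(2) by linarith
      also have "\<dots> \<le> min d3 d4" by (simp add: r_def min_def)
      finally show "w \<in> U" "dist w x\<^sub>0 < d3" using d4(2) by (auto simp: dist_norm norm_minus_commute)
    qed
    define u where "u = inverse g\<^sub>0 *\<^sub>R (y - g\<^sub>0 *\<^sub>R grad f y - w)"
    have u: "u \<in> convex_subdiff \<phi> w" unfolding u_def w_def by (rule prox_subgradient[OF g0(1)])
    have gu: "grad f w + u = (grad f w - grad f y) + inverse g\<^sub>0 *\<^sub>R (y - w)"
      using g0(1) by (simp add: u_def algebra_simps)
    have "norm (grad f w + u) \<le> L * norm (w - y) + inverse g\<^sub>0 * norm (y - w)"
      using norm_triangle_ineq[of "grad f w - grad f y" "inverse g\<^sub>0 *\<^sub>R (y - w)"] glip[of w y] g0(1)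
      unfolding gu by simp
    also have "\<dots> = (2 * (L + 1) + L) * norm (y - w)"
      by (simp add: g\<^sub>0_def norm_minus_commute algebra_simps)
    also have "\<dots> \<le> (2 * (L + 1) + L) * (3 * norm (y - x\<^sub>0))" using yw L0 by (intro mult_left_mono) auto
    also have "\<dots> = K * norm (y - x\<^sub>0)" by (simp add: K_def)
    also have "\<dots> \<le> K * (2 * t)" using yx K by (intro mult_left_mono) auto
    also have "\<dots> < K * (2 * r)" using K tk(2) by simp
    also have "\<dots> \<le> c" using K by (simp add: r_def field_simps min_def)
    finally have "w \<in> M" by (rule identify[OF wU u])
    then obtain t' where t': "t' \<in> T" "norm t' < b" "\<theta> t' = w" using d3(2)[OF w3] wU by blast
    have "norm (\<theta> t' - \<theta> 0 - (t' - 0)) \<le> 1 / 2 * norm (t' - 0)"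
      using t'(2) d1(1) by (intro d1(2)) (auto simp: b_def)
    then have "norm t' \<le> 2 * norm (w - x\<^sub>0)"
      using norm_triangle_ineq4[of "w - x\<^sub>0" "w - x\<^sub>0 - t'"] by (simp add: t'(3) \<theta>(1))
    then have "norm t' \<le> 8 * t" using wx yx by linarith
    then have "(norm t')\<^sup>2 \<le> (8 * t)\<^sup>2" by (intro power_mono) auto
    then have "e / 128 * (norm t')\<^sup>2 \<le> e / 128 * (8 * t)\<^sup>2" using e(1) by (intro mult_left_mono) auto
    then have tt: "e / 128 * (norm t')\<^sup>2 \<le> e * t\<^sup>2 / 2" by (simp add: power_mult_distrib)
    have "\<phi> w = ereal (G w)" using d2(2)[of t'] t' by (simp add: b_def)
    then have "f w + G w \<le> f y + s"
      using prox_gradient_descent[OF f L g0(1,2), of y] s(1) by (simp add: w_def[symmetric])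
    then have Gw: "G w + f w \<le> G x\<^sub>0 + f x\<^sub>0 - e * t\<^sup>2 / 2"
      using s(2) p0 d2(2)[of 0] d2(1) T by (simp add: \<theta>(1) subspace_0)
    moreover have "0 < e * t\<^sup>2 / 2" using e(1) tk(1) by simp
    ultimately have "w \<noteq> x\<^sub>0" by auto
    then have "t' \<noteq> 0" using t'(3) \<theta>(1) by auto
    then have "e / 256 * (norm t')\<^sup>2 < e / 128 * (norm t')\<^sup>2" using e(1) by simp
    then have "G w + f w < G x\<^sub>0 + f x\<^sub>0 - e / 256 * (norm t')\<^sup>2" using Gw tt by linarith
    then show ?thesis using t' \<open>t' \<noteq> 0\<close> by (intro bexI[of _ t']) (auto simp: b_def)
  qed
  from negative_tangent_direction[of "e / 256", OF _ this] e(1)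
  obtain \<tau> where \<tau>: "\<tau> \<in> T" "S \<tau> \<bullet> \<tau> + hess f x\<^sub>0 \<tau> \<bullet> \<tau> < 0" by auto
  obtain v where v: "P v = \<tau>" using P(4)[OF \<tau>(1)] by blast
  have "lam * (S \<tau> \<bullet> \<tau>) = \<tau> \<bullet> (v - \<tau>)"
    using P(5)[OF \<tau>(1), of v] 
    by (simp add: v inner_add_left inner_add_right inner_diff_left inner_diff_right inner_commute)
  then have "inverse lam * (\<tau> \<bullet> (v - \<tau>)) = inverse lam * (lam * (S \<tau> \<bullet> \<tau>))" by simp
  also have "\<dots> = S \<tau> \<bullet> \<tau>" using lam by simp
  finally have "inverse lam * (\<tau> \<bullet> (v - \<tau>)) = S \<tau> \<bullet> \<tau>" .
  then have "P v \<bullet> hess f x\<^sub>0 (P v) + inverse lam * (P v \<bullet> (v - P v)) < 0"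
    using \<tau>(2) by (simp add: v inner_commute)
  from that[OF P(1-3) P(6)[unfolded z\<^sub>0_def] prox0 this] show thesis .
qed

end

section \<open>A quadratic Lyapunov form for the linearized normal map\<close>

text \<open>The product \<open>P B\<close> is not symmetric, but eigenvectors \<open>P d\<close> for distinct eigenvalues come from vectors
  \<open>d\<close> that are orthogonal for the form \<open>\<langle>_, P _\<rangle>\<close>, and this form is positive on each of them.\<close>

lemma finitely_many_product_eigenvalues:
  fixes P B :: "'a::euclidean_space \<Rightarrow> 'a"
  assumes linP: "linear P" and symP: "\<And>x y. P x \<bullet> y = x \<bullet> P y" and symB: "\<And>x y. B x \<bullet> y = x \<bullet> B y"
    and firm: "\<And>d. (norm (P d))\<^sup>2 \<le> d \<bullet> P d"
  shows "finite {\<mu>. \<exists>d. P d \<noteq> 0 \<and> P (B (P d)) = \<mu> *\<^sub>R P d}" (is "finite ?E")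
proof (rule ccontr)
  assume "infinite ?E"
  then obtain F where F: "F \<subseteq> ?E" "finite F" "card F = Suc DIM('a)"
    using infinite_arbitrarily_large by blast
  then obtain d where d: "\<And>\<mu>. \<mu> \<in> F \<Longrightarrow> P (d \<mu>) \<noteq> 0 \<and> P (B (P (d \<mu>))) = \<mu> *\<^sub>R P (d \<mu>)"
    unfolding subset_eq mem_Collect_eq by metis
  have orth: "d \<mu> \<bullet> P (d \<nu>) = 0" if "\<mu> \<in> F" "\<nu> \<in> F" "\<mu> \<noteq> \<nu>" for \<mu> \<nu>
  proof -
    have "\<nu> * (d \<mu> \<bullet> P (d \<nu>)) = d \<mu> \<bullet> P (B (P (d \<nu>)))"
      using d[OF that(2)] by simp
    also have "\<dots> = P (B (P (d \<mu>))) \<bullet> d \<nu>"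
      by (metis symP symB)
    also have "\<dots> = \<mu> * (d \<mu> \<bullet> P (d \<nu>))"
      using d[OF that(1)] symP by simp
    finally show ?thesis using that(3) by simp
  qed
  have pos: "d \<mu> \<bullet> P (d \<mu>) \<noteq> 0" if "\<mu> \<in> F" for \<mu>
    using firm[of "d \<mu>"] d[OF that] by auto
  have inj: "inj_on d F"
    by (rule inj_onI) (metis orth pos)
  have "independent (d ` F)"
    unfolding dependent_finite[OF finite_imageI[OF F(2)]]
  proof safe
    fix u \<mu> assume 0: "(\<Sum>v\<in>d ` F. u v *\<^sub>R v) = 0" and \<mu>: "\<mu> \<in> F" "u (d \<mu>) \<noteq> 0"
    have "0 = (\<Sum>v\<in>d ` F. u v *\<^sub>R v) \<bullet> P (d \<mu>)" by (simp add: 0)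
    also have "\<dots> = (\<Sum>\<nu>\<in>F. u (d \<nu>) * (d \<nu> \<bullet> P (d \<mu>)))"
      by (simp add: sum.reindex[OF inj] inner_sum_left)
    also have "\<dots> = (\<Sum>\<nu>\<in>F. if \<nu> = \<mu> then u (d \<mu>) * (d \<mu> \<bullet> P (d \<mu>)) else 0)"
      by (rule sum.cong) (use orth \<mu> in auto)
    also have "\<dots> = u (d \<mu>) * (d \<mu> \<bullet> P (d \<mu>))"
      using F(2) \<mu>(1) by simp
    finally show False using pos[OF \<mu>(1)] \<mu>(2) by simp
  qed
  then have "card (d ` F) \<le> DIM('a)"
    using independent_bound by blast
  then show False using F(3) card_image[OF inj] by simp
qed

text \<open>With \<open>H = A P + l (I - P)\<close> and \<open>g = H + c I\<close>, the operator \<open>P g\<close> is symmetric. Hence along \<open>d' = - H d\<close> the form \<open>V = - \<langle>d, P g d\<rangle>\<close>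
  satisfies \<open>V' = 2 c V + 2 \<langle>g d, P g d\<rangle>\<close>. The last term is at least \<open>2 |P g d|\<^sup>2\<close>, which dominates
  \<open>|P d|\<^sup>2\<close> if \<open>- (l + c)\<close> is not an eigenvalue of \<open>P (A - l I)\<close>; all but finitely many \<open>c\<close> qualify.
  Subtracting \<open>\<rho> |d|\<^sup>2\<close> from \<open>V\<close> gains control on the kernel of \<open>P\<close>, where \<open>g\<close> is \<open>l + c > 0\<close>.\<close>

lemma Lyapunov_form_exists:
  fixes P A :: "'a::euclidean_space \<Rightarrow> 'a"
  assumes linP: "linear P" and linA: "linear A"
    and symP: "\<And>x y. P x \<bullet> y = x \<bullet> P y" and symA: "\<And>x y. A x \<bullet> y = x \<bullet> A y"
    and firm: "\<And>d. (norm (P d))\<^sup>2 \<le> d \<bullet> P d" and l: "0 < (l::real)"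
    and neg: "P v \<bullet> A (P v) + l * (P v \<bullet> (v - P v)) < 0"
  obtains Q c \<kappa> where "linear Q" "\<And>x y. Q x \<bullet> y = x \<bullet> Q y" "0 < c" "0 < \<kappa>" "0 < v \<bullet> Q v"
    "\<And>d. 2 * c * (d \<bullet> Q d) + \<kappa> * (norm d)\<^sup>2 \<le> - 2 * ((A (P d) + l *\<^sub>R (d - P d)) \<bullet> Q d)"
proof -
  define B where "B x = A x - l *\<^sub>R x" for x
  have linB: "linear B" unfolding B_def[abs_def]
    by (intro linear_compose_sub linA linear_compose_scale_right linear_ident)
  have symB: "B x \<bullet> y = x \<bullet> B y" for x y
    by (simp add: B_def inner_diff_left inner_diff_right symA)
  define \<eta> where "\<eta> = - (l * (v \<bullet> P v) + P v \<bullet> B (P v))"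
  have \<eta>: "0 < \<eta>"
    using neg by (simp add: \<eta>_def B_def inner_diff_right inner_commute algebra_simps)
  have vPv: "0 \<le> v \<bullet> P v" using firm[of v] zero_le_power2[of "norm (P v)"] by linarith
  \<comment> \<open>For \<open>c < c0\<close> the form is still positive at \<open>v\<close>.\<close>
  define c0 where "c0 = \<eta> / (1 + v \<bullet> P v)"
  have c0: "0 < c0" using \<eta> vPv by (simp add: c0_def)
  let ?E = "{\<mu>. \<exists>d. P d \<noteq> 0 \<and> P (B (P d)) = \<mu> *\<^sub>R P d}"
  have "finite ((\<lambda>\<mu>. - \<mu> - l) ` ?E)"
    by (intro finite_imageI finitely_many_product_eigenvalues linP symP symB firm)
  then have "infinite ({0<..<c0} - (\<lambda>\<mu>. - \<mu> - l) ` ?E)"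
    using c0 by (intro Diff_infinite_finite) auto
  then obtain c where c: "0 < c" "c < c0" "c \<notin> (\<lambda>\<mu>. - \<mu> - l) ` ?E"
    by (metis (no_types, lifting) DiffE finite.emptyI greaterThanLessThan_iff equals0I)
  define f where "f y = (l + c) *\<^sub>R y + P (B y)" for y
  have linf: "linear f" unfolding f_def[abs_def]
    by (intro linear_compose_add linear_compose_scale_right linear_ident
        linear_compose[OF linB linP, unfolded comp_def])
  have "inj f"
    unfolding linear_injective_0[OF linf]
  proof (intro allI impI)
    fix y assume fy: "f y = 0"
    define d where "d = (- 1 / (l + c)) *\<^sub>R B y"
    have "(l + c) *\<^sub>R y = - P (B y)" using fy by (simp add: f_def eq_neg_iff_add_eq_0)
    then have "y = (1 / (l + c)) *\<^sub>R (- P (B y))" 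
      using l c(1) by (metis (no_types, lifting) add_pos_pos divide_inverse less_irrefl mult_1
          left_inverse scaleR_one scaleR_scaleR)
    then have y: "y = P d" by (simp add: d_def linear_cmul[OF linP] linear_neg[OF linP])
    show "y = 0"
    proof (rule ccontr)
      assume "y \<noteq> 0"
      have "P (B y) = (- (l + c)) *\<^sub>R y"
        using \<open>(l + c) *\<^sub>R y = - P (B y)\<close> by (metis minus_minus scaleR_minus_left)
      then have "- (l + c) \<in> ?E" using y \<open>y \<noteq> 0\<close> by (auto intro: exI[of _ d])
      then show False using c(3) by (auto simp: image_iff)
    qed
  qed
  then obtain \<nu> where \<nu>: "0 < \<nu>" "\<And>y. \<nu> * norm y \<le> norm (f y)"
    using linear_inj_bounded_below_pos[OF linf] by blast
  obtain C where C: "0 < C" "\<And>y. norm (B y) \<le> C * norm y"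
    using linear_bounded_pos[OF linB] by blast
  define g where "g d = (l + c) *\<^sub>R d + B (P d)" for d
  have ling: "linear g" unfolding g_def[abs_def]
    by (intro linear_compose_add linear_compose_scale_right linear_ident
        linear_compose[OF linP linB, unfolded comp_def])
  have Pg: "P (g d) = f (P d)" for d
    by (simp add: g_def f_def linear_add[OF linP] linear_cmul[OF linP])
  have symPg: "P (g x) \<bullet> y = x \<bullet> P (g y)" for x y
  proof -
    have "x \<bullet> P (B (P y)) = P (B (P x)) \<bullet> y" by (metis symP symB)
    then show ?thesis
      by (simp add: Pg f_def inner_add_left inner_add_right symP)
  qed
  define w where "w = - (v \<bullet> P (g v))"
  have "w = \<eta> - c * (v \<bullet> P v)"
    by (simp add: w_def Pg f_def \<eta>_def inner_add_right symP algebra_simps)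
  moreover have "c * (v \<bullet> P v) \<le> c * (1 + v \<bullet> P v)" "c * (1 + v \<bullet> P v) < \<eta>"
    using c(1,2) vPv by (auto simp: c0_def field_simps)
  ultimately have w: "0 < w" by linarith
  \<comment> \<open>The first bound keeps the form growing on the range of \<open>P\<close>, the second keeps it positive at \<open>v\<close>.\<close>
  define \<rho> where "\<rho> = min (2 * \<nu>\<^sup>2 * l / C\<^sup>2) (w / (1 + (norm v)\<^sup>2))"
  have \<rho>: "0 < \<rho>" "\<rho> \<le> 2 * \<nu>\<^sup>2 * l / C\<^sup>2" "\<rho> \<le> w / (1 + (norm v)\<^sup>2)"
    using \<nu> l C w by (auto simp: \<rho>_def add_pos_nonneg)
  define Q where "Q d = - P (g d) - \<rho> *\<^sub>R d" for d
  show thesis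
  proof
    show "linear Q" unfolding Q_def[abs_def]
      by (intro linear_compose_sub linear_compose_neg linear_compose_scale_right linear_ident
        linear_compose[OF ling linP, unfolded comp_def])
    show "Q x \<bullet> y = x \<bullet> Q y" for x y
      by (simp add: Q_def inner_diff_left inner_diff_right symPg)
    show "0 < c" by fact
    show "0 < \<rho> * l" using \<rho> l by simp
    have "\<rho> * (norm v)\<^sup>2 < \<rho> * (1 + (norm v)\<^sup>2)" using \<rho> by simp
    also have "\<dots> \<le> w" using \<rho>(3) by (simp add: field_simps add_pos_nonneg)
    finally show "0 < v \<bullet> Q v"
      by (simp add: Q_def w_def inner_diff_right power2_norm_eq_inner)
    fix d
    have "\<nu> * norm (P d) \<le> norm (P (g d))" unfolding Pg by (rule \<nu>(2))
    then have "(\<nu> * norm (P d))\<^sup>2 \<le> (norm (P (g d)))\<^sup>2"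
      using \<nu>(1) by (intro power_mono) auto
    then have 1: "\<nu>\<^sup>2 * (norm (P d))\<^sup>2 \<le> g d \<bullet> P (g d)"
      using firm[of "g d"] by (simp add: power_mult_distrib)
    have "- (B (P d) \<bullet> d) \<le> norm (B (P d)) * norm d"
      using norm_cauchy_schwarz[of "- B (P d)" d] by simp
    also have "\<dots> \<le> C * norm (P d) * norm d"
      by (intro mult_right_mono C) auto
    also have "\<dots> \<le> l / 2 * (norm d)\<^sup>2 + C\<^sup>2 / (2 * l) * (norm (P d))\<^sup>2"
    proof -
      have "0 \<le> (l * norm d - C * norm (P d))\<^sup>2 / (2 * l)" using l by simp
      also have "\<dots> = l / 2 * (norm d)\<^sup>2 + C\<^sup>2 / (2 * l) * (norm (P d))\<^sup>2 - C * norm (P d) * norm d"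
        using l by (simp add: power2_eq_square field_simps)
      finally show ?thesis by simp
    qed
    finally have 2: "(l / 2 + c) * (norm d)\<^sup>2 - C\<^sup>2 / (2 * l) * (norm (P d))\<^sup>2 \<le> g d \<bullet> d"
      by (simp add: g_def inner_add_left power2_norm_eq_inner algebra_simps)
    have "\<rho> * (C\<^sup>2 / (2 * l)) \<le> \<nu>\<^sup>2"
      using \<rho>(2) C l by (simp add: field_simps)
    then have 3: "\<rho> * (C\<^sup>2 / (2 * l)) * (norm (P d))\<^sup>2 \<le> \<nu>\<^sup>2 * (norm (P d))\<^sup>2"
      by (rule mult_right_mono) simp
    have 4: "0 \<le> \<rho> * c * (norm d)\<^sup>2" using \<rho> c by simp
    have Hd: "A (P d) + l *\<^sub>R (d - P d) = g d - c *\<^sub>R d"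
      by (simp add: g_def B_def algebra_simps)
    have "- 2 * ((A (P d) + l *\<^sub>R (d - P d)) \<bullet> Q d) - 2 * c * (d \<bullet> Q d) = - 2 * (g d \<bullet> Q d)"
      unfolding Hd by (simp add: inner_diff_left algebra_simps)
    also have "\<dots> = 2 * (g d \<bullet> P (g d)) + 2 * (\<rho> * (g d \<bullet> d))"
      by (simp add: Q_def inner_diff_right algebra_simps)
    also have "\<dots> \<ge> \<rho> * l * (norm d)\<^sup>2"
      using 1 3 4 mult_left_mono[OF 2, of \<rho>] \<rho>(1) by (simp add: algebra_simps)
    finally show "2 * c * (d \<bullet> Q d) + \<rho> * l * (norm d)\<^sup>2
        \<le> - 2 * ((A (P d) + l *\<^sub>R (d - P d)) \<bullet> Q d)" by linarith
  qed
qed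

section \<open>Divergence of perturbed linear orbits\<close>

text \<open>The perturbation \<open>N k\<close> has the size of \<open>H\<close>, but \<open>\<alpha> k N k = R k - R (k + 1)\<close> telescopes with
  \<open>R k \<rightarrow> 0\<close>. In the variables \<open>y k = d k - R k (d k)\<close> what remains of it is of order
  \<open>\<alpha> k (|R k| + \<alpha> k)\<close>, so that the form \<open>y \<bullet> Q y\<close> grows at least by the factor \<open>1 + 2 c \<alpha> k\<close>.\<close>

lemma perturbed_unstable_orbit_unbounded:
  fixes H Q :: "'a::euclidean_space \<Rightarrow>\<^sub>L 'a" and N R :: "nat \<Rightarrow> 'a \<Rightarrow>\<^sub>L 'a" and \<alpha> :: "nat \<Rightarrow> real"
  assumes Qsym: "\<And>x y. Q x \<bullet> y = x \<bullet> Q y" and c: "0 < c" and \<kappa>: "0 < \<kappa>" and v: "0 < v \<bullet> Q v"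
    and lyap: "\<And>d. 2 * c * (d \<bullet> Q d) + \<kappa> * (norm d)\<^sup>2 \<le> - 2 * (H d \<bullet> Q d)"
    and \<epsilon>: "0 \<le> \<epsilon>" "16 * \<epsilon> * norm Q \<le> \<kappa>"
    and \<alpha>: "\<And>k. 0 < \<alpha> k" "\<alpha> \<longlonglongrightarrow> 0" "filterlim (\<lambda>n. \<Sum>k<n. \<alpha> k) at_top sequentially"
    and N: "\<And>k. norm (N k) \<le> C" and R: "\<And>k. R (Suc k) = R k - \<alpha> k *\<^sub>R N k" "R \<longlonglongrightarrow> 0"
  shows "\<forall>\<^sub>F m in sequentially. \<forall>d s t b. t \<noteq> 0 \<longrightarrow> d m = t *\<^sub>R v \<longrightarrow>
    (\<forall>k\<ge>m. d (Suc k) = d k - \<alpha> k *\<^sub>R (H (d k) + N k (d k) + s k) \<and>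
       norm (s k) \<le> \<epsilon> * norm (d k) \<and> norm (d k) \<le> b) \<longrightarrow> False"
proof -
  have tri3: "norm (p1 + p2 + p3) \<le> norm p1 + norm p2 + norm p3" for p1 p2 p3 :: 'a
    using norm_triangle_ineq[of "p1 + p2" p3] norm_triangle_ineq[of p1 p2] by linarith
  have tri5: "norm (p1 + p2 + p3 - p4 - p5) \<le> norm p1 + norm p2 + norm p3 + norm p4 + norm p5"
    for p1 p2 p3 p4 p5 :: 'a
    using norm_triangle_ineq4[of "p1 + p2 + p3 - p4" p5] norm_triangle_ineq4[of "p1 + p2 + p3" p4]
      tri3[of p1 p2 p3] by linarith
  define h where "h = norm H"
  define q where "q = norm Q"
  have C0: "0 \<le> C" using N[of 0] norm_ge_zero order_trans by blast
  have h0: "0 \<le> h" "0 \<le> q" by (simp_all add: h_def q_def)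
  have q0: "0 < q"
  proof (rule ccontr)
    assume "\<not> 0 < q"
    then have "Q = 0" by (simp add: q_def)
    then show False using v by simp
  qed
  \<comment> \<open>\<open>E k\<close> bounds, relative to \<open>d k\<close>, everything that the change of variables leaves of the perturbation
      apart from \<open>s k\<close> itself.\<close>
  define E where "E k = norm (R k) * (h + C) + h * norm (R k) + norm (R k) * \<epsilon> + \<alpha> k * (C * (h + C)) + \<alpha> k * (C * \<epsilon>)" for k
  define \<epsilon>' where "\<epsilon>' = \<kappa> / (16 * q)"
  have \<epsilon>': "0 < \<epsilon>'" "\<epsilon> \<le> \<epsilon>'" "16 * \<epsilon>' * q = \<kappa>"
    using \<kappa> q0 \<epsilon>(2) by (simp_all add: \<epsilon>'_def q_def field_simps)
  define D where "D = q * (h + 4 * \<epsilon>')\<^sup>2"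
  have Rn: "(\<lambda>k. norm (R k)) \<longlonglongrightarrow> 0"
    using R(2) tendsto_norm_zero by blast
  have "E \<longlonglongrightarrow> 0 * (h + C) + h * 0 + 0 * \<epsilon> + 0 * (C * (h + C)) + 0 * (C * \<epsilon>)"
    unfolding E_def[abs_def] by (intro tendsto_intros Rn \<alpha>(2))
  then have "E \<longlonglongrightarrow> 0" by simp
  then have ev1: "\<forall>\<^sub>F k in sequentially. E k < \<epsilon>'"
    using \<epsilon>'(1) order_tendstoD(2) by blast
  have ev2: "\<forall>\<^sub>F k in sequentially. norm (R k) < 1 / 2"
    using Rn by (rule order_tendstoD(2)) simp
  have "(\<lambda>k. \<alpha> k * D) \<longlonglongrightarrow> 0 * D" by (intro tendsto_intros \<alpha>(2))
  then have ev3: "\<forall>\<^sub>F k in sequentially. \<alpha> k * D < \<kappa> / 2"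
    using order_tendstoD(2)[of "\<lambda>k. \<alpha> k * D" 0 _ "\<kappa> / 2"] \<kappa> by simp
  have "(\<lambda>k. (v - R k v) \<bullet> Q (v - R k v)) \<longlonglongrightarrow> (v - blinfun_apply 0 v) \<bullet> Q (v - blinfun_apply 0 v)"
    by (intro tendsto_intros R(2))
  then have ev4: "\<forall>\<^sub>F k in sequentially. 0 < (v - R k v) \<bullet> Q (v - R k v)"
    using v by (intro order_tendstoD(1)) auto
  from ev1 ev2 ev3 have "\<forall>\<^sub>F k in sequentially. E k < \<epsilon>' \<and> norm (R k) < 1 / 2 \<and> \<alpha> k * D < \<kappa> / 2"
    by eventually_elim simp
  then have "\<forall>\<^sub>F m in sequentially. \<forall>k\<ge>m. E k < \<epsilon>' \<and> norm (R k) < 1 / 2 \<and> \<alpha> k * D < \<kappa> / 2"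
    by (rule eventually_all_ge_at_top)
  with ev4 show ?thesis
  proof eventually_elim
    case (elim m)
    show ?case
    proof (intro allI impI)
      fix d :: "nat \<Rightarrow> 'a" and s t b
      assume t: "t \<noteq> 0" "d m = t *\<^sub>R v"
        and rec: "\<forall>k\<ge>m. d (Suc k) = d k - \<alpha> k *\<^sub>R (H (d k) + N k (d k) + s k) \<and>
         norm (s k) \<le> \<epsilon> * norm (d k) \<and> norm (d k) \<le> b"
      define y where "y k = d k - R k (d k)" for k
      define V where "V k = y k \<bullet> Q (y k)" for k
      have V0: "0 < V m"
      proof -
        have "y m = t *\<^sub>R (v - R m v)"
          by (simp add: y_def t blinfun.scaleR_right scaleR_diff_right)
        then have "V m = t\<^sup>2 * ((v - R m v) \<bullet> Q (v - R m v))"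
          by (simp add: V_def blinfun.scaleR_right power2_eq_square)
        then show ?thesis using t(1) elim(1) by simp
      qed
      have dy: "norm (d k) \<le> 2 * norm (y k)" "norm (y k) \<le> 2 * norm (d k)" if k: "k \<ge> m" for k
      proof -
        have "norm (R k (d k)) \<le> norm (R k) * norm (d k)" by (rule norm_blinfun)
        also have "\<dots> \<le> 1 / 2 * norm (d k)"
          using elim(2) k by (intro mult_right_mono) (auto intro: less_imp_le)
        finally have *: "norm (R k (d k)) \<le> norm (d k) / 2" by simp
        show "norm (d k) \<le> 2 * norm (y k)" "norm (y k) \<le> 2 * norm (d k)"
          using * norm_triangle_ineq[of "y k" "R k (d k)"] norm_triangle_ineq4[of "d k" "R k (d k)"]
          by (simp_all add: y_def)
      qed
      have step: "(1 + 2 * c * \<alpha> k) * V k \<le> V (Suc k)" if k: "k \<ge> m" for k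
      proof -
        define a where "a = \<alpha> k"
        have a: "0 < a" using \<alpha>(1) by (simp add: a_def)
        \<comment> \<open>\<open>e\<close> is the total error in \<open>y (Suc k) = y k + \<alpha> k (e - H (y k))\<close>; the terms \<open>N k (d k)\<close> of the
            recursions of \<open>d\<close> and of \<open>R\<close> have cancelled.\<close>
        define e\<^sub>1 where "e\<^sub>1 = R k (H (d k)) + R k (N k (d k)) + R k (s k) - s k - H (R k (d k))"
        define e\<^sub>2 where "e\<^sub>2 = N k (H (d k)) + N k (N k (d k)) + N k (s k)"
        define e where "e = e\<^sub>1 - a *\<^sub>R e\<^sub>2"
        have dS: "d (Suc k) = d k - a *\<^sub>R (H (d k) + N k (d k) + s k)"
          and s: "norm (s k) \<le> \<epsilon> * norm (d k)"
          using rec k by (auto simp: a_def)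
        define g where "g = e - H (y k)"
        have yS: "y (Suc k) = y k + a *\<^sub>R g"
          unfolding y_def R(1) dS g_def e_def e\<^sub>1_def e\<^sub>2_def a_def[symmetric]
          by (simp add: blinfun.diff_left blinfun.add_right blinfun.diff_right blinfun.scaleR_left
              blinfun.scaleR_right algebra_simps)
        have b1: "norm (H x) \<le> h * norm x" for x
          unfolding h_def by (rule norm_blinfun)
        have b2: "norm (N k x) \<le> C * norm x" for x
          by (rule order_trans[OF norm_blinfun mult_right_mono[OF N]]) simp
        have b3: "norm (R k x) \<le> norm (R k) * norm x" for x
          by (rule norm_blinfun)
        let ?n = "norm (d k)"
        have Hd: "norm (H (d k)) \<le> h * ?n" and Nd: "norm (N k (d k)) \<le> C * ?n" by (rule b1 b2)+
        have "norm (R k (H (d k))) \<le> norm (R k) * (h * ?n)"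
          by (rule order_trans[OF b3 mult_left_mono[OF Hd]]) simp
        moreover have "norm (R k (N k (d k))) \<le> norm (R k) * (C * ?n)"
          by (rule order_trans[OF b3 mult_left_mono[OF Nd]]) simp
        moreover have "norm (R k (s k)) \<le> norm (R k) * (\<epsilon> * ?n)"
          by (rule order_trans[OF b3 mult_left_mono[OF s]]) simp
        moreover have "norm (H (R k (d k))) \<le> h * (norm (R k) * ?n)"
          by (rule order_trans[OF b1 mult_left_mono[OF b3 h0(1)]])
        moreover have "norm (N k (H (d k))) \<le> C * (h * ?n)"
          by (rule order_trans[OF b2 mult_left_mono[OF Hd C0]])
        moreover have "norm (N k (N k (d k))) \<le> C * (C * ?n)"
          by (rule order_trans[OF b2 mult_left_mono[OF Nd C0]])
        moreover have "norm (N k (s k)) \<le> C * (\<epsilon> * ?n)"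
          by (rule order_trans[OF b2 mult_left_mono[OF s C0]])
        ultimately have n1: "norm e\<^sub>1 \<le> norm (R k) * (h * ?n) + norm (R k) * (C * ?n)
              + norm (R k) * (\<epsilon> * ?n) + \<epsilon> * ?n + h * (norm (R k) * ?n)"
          and n2: "norm e\<^sub>2 \<le> C * (h * ?n) + C * (C * ?n) + C * (\<epsilon> * ?n)"
          unfolding e\<^sub>1_def e\<^sub>2_def
          using s tri5[of "R k (H (d k))" "R k (N k (d k))" "R k (s k)" "s k" "H (R k (d k))"]
            tri3[of "N k (H (d k))" "N k (N k (d k))" "N k (s k)"] by linarith+
        have "norm (a *\<^sub>R e\<^sub>2) \<le> a * (C * (h * ?n) + C * (C * ?n) + C * (\<epsilon> * ?n))"
          using mult_left_mono[OF n2, of a] a by simp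
        then have "norm e \<le> norm (R k) * (h * ?n) + norm (R k) * (C * ?n) + norm (R k) * (\<epsilon> * ?n)
            + \<epsilon> * ?n + h * (norm (R k) * ?n) + a * (C * (h * ?n) + C * (C * ?n) + C * (\<epsilon> * ?n))"
          using norm_triangle_ineq4[of "e\<^sub>1" "a *\<^sub>R e\<^sub>2"] n1 unfolding e_def by linarith
        also have "\<dots> = (E k + \<epsilon>) * ?n"
          by (simp add: E_def a_def algebra_simps)
        also have "\<dots> \<le> (2 * \<epsilon>') * (2 * norm (y k))"
          using elim(2) k \<epsilon>'(1,2) dy(1)[OF k] by (intro mult_mono) auto
        finally have e: "norm e \<le> 4 * \<epsilon>' * norm (y k)" by simp
        have Qb: "norm (Q x) \<le> q * norm x" for x
          unfolding q_def by (rule norm_blinfun)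
        have "norm g \<le> norm e + norm (H (y k))"
          unfolding g_def by (rule norm_triangle_ineq4)
        then have g: "norm g \<le> (h + 4 * \<epsilon>') * norm (y k)"
          using e b1[of "y k"] by (simp add: algebra_simps)
        have "\<bar>g \<bullet> Q g\<bar> \<le> norm g * norm (Q g)" by (rule Cauchy_Schwarz_ineq2)
        also have "\<dots> \<le> norm g * (q * norm g)" by (intro mult_left_mono Qb) auto
        also have "\<dots> = q * (norm g)\<^sup>2" by (simp add: power2_eq_square)
        also have "\<dots> \<le> q * ((h + 4 * \<epsilon>') * norm (y k))\<^sup>2"
          using g h0 by (intro mult_left_mono power_mono) auto
        also have "\<dots> = D * (norm (y k))\<^sup>2" by (simp add: D_def power_mult_distrib)
        finally have "\<bar>a * (g \<bullet> Q g)\<bar> \<le> a * (D * (norm (y k))\<^sup>2)"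
          using a by (simp add: abs_mult)
        also have "\<dots> = (a * D) * (norm (y k))\<^sup>2" by simp
        also have "\<dots> \<le> \<kappa> / 2 * (norm (y k))\<^sup>2"
          using elim(2) k by (intro mult_right_mono) (auto simp: a_def intro: less_imp_le)
        finally have g2: "- (\<kappa> / 2 * (norm (y k))\<^sup>2) \<le> a * (g \<bullet> Q g)" by linarith
        have "\<bar>e \<bullet> Q (y k)\<bar> \<le> norm e * norm (Q (y k))" by (rule Cauchy_Schwarz_ineq2)
        also have "\<dots> \<le> (4 * \<epsilon>' * norm (y k)) * (q * norm (y k))"
          using \<epsilon>'(1) by (intro mult_mono e Qb) auto
        also have "\<dots> = (16 * \<epsilon>' * q) / 4 * (norm (y k))\<^sup>2" by (simp add: power2_eq_square)
        also have "\<dots> = \<kappa> / 4 * (norm (y k))\<^sup>2" by (simp only: \<epsilon>'(3))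
        finally have eQ: "- (\<kappa> / 4 * (norm (y k))\<^sup>2) \<le> e \<bullet> Q (y k)" by linarith
        have gQ: "g \<bullet> Q (y k) = e \<bullet> Q (y k) - H (y k) \<bullet> Q (y k)"
          by (simp add: g_def inner_diff_left)
        have "V (Suc k) = V k + a * (2 * (g \<bullet> Q (y k)) + a * (g \<bullet> Q g))"
          unfolding V_def yS
          using Qsym[of "y k" g]
          by (simp add: blinfun.add_right blinfun.scaleR_right inner_add_left inner_add_right
              inner_commute algebra_simps)
        moreover have "2 * c * V k \<le> 2 * (g \<bullet> Q (y k)) + a * (g \<bullet> Q g)"
          using lyap[of "y k"] g2 eQ gQ unfolding V_def by linarith
        then have "a * (2 * c * V k) \<le> a * (2 * (g \<bullet> Q (y k)) + a * (g \<bullet> Q g))"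
          using a by (intro mult_left_mono) auto
        ultimately show ?thesis by (simp add: a_def algebra_simps)
      qed
      have mono: "V m \<le> V (m + n) \<and> V m * (1 + 2 * c * (\<Sum>k=m..<m+n. \<alpha> k)) \<le> V (m + n)" for n
      proof (induction n)
        case (Suc n)
        have "V (m + n) + 2 * c * \<alpha> (m + n) * V (m + n) \<le> V (m + Suc n)"
          using step[of "m + n"] by (simp add: algebra_simps)
        moreover have "2 * c * \<alpha> (m + n) * V m \<le> 2 * c * \<alpha> (m + n) * V (m + n)"
          using Suc c \<alpha>(1)[of "m + n"] by (intro mult_left_mono) auto
        moreover have "0 \<le> 2 * c * \<alpha> (m + n) * V m"
          using c \<alpha>(1)[of "m + n"] V0 by simp
        ultimately show ?case using Suc by (simp add: algebra_simps)
      qed simp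
      have bnd: "V k \<le> q * (2 * b)\<^sup>2" if "k \<ge> m" for k
      proof -
        have yb: "norm (y k) \<le> 2 * b" using dy(2)[OF that] rec that by force
        have "V k \<le> norm (y k) * norm (Q (y k))" unfolding V_def by (rule norm_cauchy_schwarz)
        also have "\<dots> \<le> norm (y k) * (q * norm (y k))"
          unfolding q_def by (intro mult_left_mono norm_blinfun) simp
        also have "\<dots> = q * (norm (y k))\<^sup>2" by (simp add: power2_eq_square)
        also have "\<dots> \<le> q * (2 * b)\<^sup>2"
          using yb h0(2) by (intro mult_left_mono power_mono) auto
        finally show ?thesis .
      qed
      define K where "K = q * (2 * b)\<^sup>2 / (V m * (2 * c)) + (\<Sum>k<m. \<alpha> k)"
      have "\<forall>\<^sub>F n in sequentially. K < (\<Sum>k<n. \<alpha> k)"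
        using \<alpha>(3) unfolding filterlim_at_top_dense by blast
      then obtain n where n: "K < (\<Sum>k<n. \<alpha> k)" "n \<ge> m"
        by (metis eventually_at_top_linorder le_cases order_refl)
      have "(\<Sum>k<n. \<alpha> k) = (\<Sum>k<m. \<alpha> k) + (\<Sum>k=m..<n. \<alpha> k)"
        using n(2) by (metis atLeast0LessThan le0 sum.atLeastLessThan_concat)
      then have "q * (2 * b)\<^sup>2 / (V m * (2 * c)) < (\<Sum>k=m..<n. \<alpha> k)"
        using n(1) by (simp add: K_def)
      then have "q * (2 * b)\<^sup>2 < V m * (2 * c * (\<Sum>k=m..<n. \<alpha> k))"
        using V0 c by (simp add: divide_less_eq mult_ac)
      also have "\<dots> \<le> V n"
        using mono[of "n - m"] n(2) V0 by (simp add: algebra_simps)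
      also have "\<dots> \<le> q * (2 * b)\<^sup>2" by (rule bnd[OF n(2)])
      finally show False by simp
    qed
  qed
qed

text \<open>The excess \<open>u - e\<close> is contracted by the factors \<open>1 - \<beta> k\<close>. While it is above \<open>e\<close> it drops by
  \<open>\<beta> k e\<close> in each step, so it falls below \<open>e\<close> at some time, and then stays there.\<close>

lemma averaged_sequence_eventually_small:
  fixes u :: "nat \<Rightarrow> real"
  assumes rec: "\<forall>\<^sub>F k in sequentially. u (Suc k) \<le> (1 - \<beta> k) * u k + \<beta> k * e"
    and \<beta>: "\<And>k. 0 < \<beta> k" "\<And>k. \<beta> k \<le> 1" "filterlim (\<lambda>n. \<Sum>k<n. \<beta> k) at_top sequentially"
    and e: "0 < e"
  shows "\<forall>\<^sub>F k in sequentially. u k \<le> 2 * e"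
proof -
  obtain m where m: "\<And>k. k \<ge> m \<Longrightarrow> u (Suc k) \<le> (1 - \<beta> k) * u k + \<beta> k * e"
    using rec unfolding eventually_sequentially by blast
  define w where "w k = u k - e" for k
  have w: "w (Suc k) \<le> (1 - \<beta> k) * w k" if "k \<ge> m" for k
    using m[OF that] by (simp add: w_def algebra_simps)
  have "\<exists>n\<ge>m. w n \<le> e"
  proof (rule ccontr)
    assume "\<not> ?thesis"
    then have big: "e < w n" if "n \<ge> m" for n using that by force
    have dec: "w (m + n) \<le> w m - e * (\<Sum>k=m..<m+n. \<beta> k)" for n
    proof (induction n)
      case (Suc n)
      have "w (m + Suc n) \<le> w (m + n) - \<beta> (m + n) * w (m + n)"
        using w[of "m + n"] by (simp add: algebra_simps)
      moreover have "\<beta> (m + n) * e \<le> \<beta> (m + n) * w (m + n)"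
        using big[of "m + n"] \<beta>(1)[of "m + n"] by (intro mult_left_mono) auto
      ultimately show ?case using Suc by (simp add: algebra_simps)
    qed simp
    define K where "K = w m / e + (\<Sum>k<m. \<beta> k)"
    have "\<forall>\<^sub>F n in sequentially. K < (\<Sum>k<n. \<beta> k)"
      using \<beta>(3) unfolding filterlim_at_top_dense by blast
    then obtain n where n: "K < (\<Sum>k<n. \<beta> k)" "n \<ge> m"
      by (metis eventually_at_top_linorder le_cases order_refl)
    have "(\<Sum>k<n. \<beta> k) = (\<Sum>k<m. \<beta> k) + (\<Sum>k=m..<n. \<beta> k)"
      using n(2) by (metis atLeast0LessThan le0 sum.atLeastLessThan_concat)
    then have "w m / e < (\<Sum>k=m..<n. \<beta> k)"
      using n(1) by (simp add: K_def)
    then have "w m - e * (\<Sum>k=m..<n. \<beta> k) < 0" using e by (simp add: field_simps)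
    then have "w n < 0" using dec[of "n - m"] n(2) by simp
    then show False using big[OF n(2)] e by simp
  qed
  then obtain n where n: "n \<ge> m" "w n \<le> e" by blast
  have "w k \<le> e" if "k \<ge> n" for k
    using that
  proof (induction k rule: dec_induct)
    case (step k)
    have "w (Suc k) \<le> (1 - \<beta> k) * w k" using w[of k] step n(1) by simp
    also have "\<dots> \<le> (1 - \<beta> k) * e" using step \<beta>(2)[of k] by (intro mult_left_mono) auto
    also have "\<dots> \<le> e" using \<beta>(1)[of k] e by (simp add: algebra_simps)
    finally show ?case .
  qed (rule n(2))
  then show ?thesis unfolding eventually_sequentially w_def by force
qed

text \<open>The translates by \<open>v / (n + 1)\<close> are pairwise disjoint, have equal measure and lie in a common ball.\<close>

lemma negligible_disjoint_translates:
  fixes S :: "'a::euclidean_space set"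
  assumes S: "S \<in> sets lborel" and bdd: "bounded S"
    and disj: "\<And>x t. x \<in> S \<Longrightarrow> t \<noteq> 0 \<Longrightarrow> x + t *\<^sub>R v \<notin> S"
  shows "S \<in> null_sets lborel"
proof -
  define A where "A n = (\<lambda>x. (1 / Suc n) *\<^sub>R v + x) ` S" for n :: nat
  have A_vimage: "A n = (\<lambda>x. - (1 / Suc n) *\<^sub>R v + x) -` S" for n
    unfolding A_def by (force simp: image_iff algebra_simps)
  have mA[measurable]: "A n \<in> sets borel" for n
    unfolding A_vimage using S by (intro measurable_sets_borel[of _ borel]) auto
  have eA: "emeasure lborel (A n) = emeasure lborel S" for n
  proof -
    have "emeasure lborel S = emeasure (distr lborel borel (\<lambda>x. - (1 / Suc n) *\<^sub>R v + x)) S"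
      by (simp only: lborel_distr_plus)
    also have "\<dots> = emeasure lborel (A n)"
      unfolding A_vimage using S by (subst emeasure_distr) auto
    finally show ?thesis by simp
  qed
  have disjA: "disjoint_family A"
    unfolding disjoint_family_on_def
  proof (intro ballI impI)
    fix m n :: nat assume "m \<noteq> n"
    then have ne: "1 / Suc n - 1 / Suc m \<noteq> (0::real)" by auto
    show "A m \<inter> A n = {}"
    proof (rule ccontr)
      assume "A m \<inter> A n \<noteq> {}"
      then obtain x y where xy: "x \<in> S" "y \<in> S" "(1 / Suc m) *\<^sub>R v + x = (1 / Suc n) *\<^sub>R v + y"
        unfolding A_def by blast
      have "x = (1 / Suc m) *\<^sub>R v + x - (1 / Suc m) *\<^sub>R v" by simp
      also have "\<dots> = y + (1 / Suc n - 1 / Suc m) *\<^sub>R v"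
        unfolding xy(3) by (simp add: scaleR_diff_left)
      finally show False using disj[OF xy(2) ne] xy(1) by simp
    qed
  qed
  obtain r where r: "\<And>x. x \<in> S \<Longrightarrow> norm x \<le> r"
    using bdd bounded_iff by blast
  have sub: "(\<Union>n. A n) \<subseteq> cball 0 (norm v + r)"
  proof safe
    fix n x assume "x \<in> A n"
    then obtain s where s: "s \<in> S" "x = (1 / Suc n) *\<^sub>R v + s" by (auto simp: A_def)
    have "norm x \<le> norm ((1 / Suc n) *\<^sub>R v) + norm s" unfolding s by (rule norm_triangle_ineq)
    also have "norm ((1 / Suc n) *\<^sub>R v) \<le> norm v"
      by (simp add: divide_le_eq mult_left_le_one_le mult_le_cancel_left1)
    finally show "x \<in> cball 0 (norm v + r)" using r[OF s(1)] by simp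
  qed
  have "(\<Sum>n. emeasure lborel (A n)) = emeasure lborel (\<Union>n. A n)"
    by (rule suminf_emeasure) (use disjA in auto)
  also have "\<dots> \<le> emeasure lborel (cball (0::'a) (norm v + r))"
    using sub by (intro emeasure_mono) auto
  also have "\<dots> < \<infinity>" by (rule emeasure_lborel_cball_finite)
  finally have "(\<Sum>n::nat. emeasure lborel S) < \<infinity>" by (simp only: eA)
  moreover have S_fin: "emeasure lborel S = ennreal (measure lborel S)"
    using emeasure_bounded_finite[OF bdd] by (intro emeasure_eq_ennreal_measure) auto
  ultimately have "summable (\<lambda>n::nat. measure lborel S)"
    by (intro summable_suminf_not_top) auto
  then have "emeasure lborel S = 0"
    using S_fin by (simp add: summable_const_iff)
  then show ?thesis using S by (intro null_setsI) auto
qed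

section \<open>Orbits of the proximal stochastic gradient method\<close>

lemma norm_blinfun_derivative_le_Lipschitz:
  fixes g :: "'a::real_normed_vector \<Rightarrow> 'b::real_normed_vector"
  assumes d: "(g has_derivative blinfun_apply B) (at x)" and L: "L-lipschitz_on UNIV g"
  shows "norm B \<le> L"
proof (rule field_le_epsilon)
  fix e :: real assume e: "0 < e"
  have L0: "0 \<le> L" using L by (rule lipschitz_on_nonneg)
  obtain r where r: "0 < r" "\<And>y. norm (y - x) < r \<Longrightarrow> norm (g y - g x - B (y - x)) \<le> e * norm (y - x)"
    using d e unfolding has_derivative_at_alt by blast
  show "norm B \<le> L + e"
  proof (rule norm_blinfun_bound)
    fix h
    show "norm (B h) \<le> (L + e) * norm h"
    proof (cases "h = 0")
      case False
      define c where "c = r / (2 * norm h)"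
      have c: "0 < c" using False r by (simp add: c_def)
      have ch: "norm ((x + c *\<^sub>R h) - x) < r" using False r c by (simp add: c_def)
      have "norm (g (x + c *\<^sub>R h) - g x) \<le> L * norm ((x + c *\<^sub>R h) - x)"
        using lipschitz_onD[OF L, of "x + c *\<^sub>R h" x] by (simp add: dist_norm)
      then have "norm (B (c *\<^sub>R h)) \<le> (L + e) * norm (c *\<^sub>R h)"
        using r(2)[OF ch] norm_triangle_ineq4[of "g (x + c *\<^sub>R h) - g x" "g (x + c *\<^sub>R h) - g x - B (c *\<^sub>R h)"]
        by (simp add: algebra_simps)
      then have "c * norm (B h) \<le> c * ((L + e) * norm h)" using c by (simp add: blinfun.scaleR_right mult_ac)
      then show ?thesis using c by simp
    qed simp
  qed (use L0 e in simp)
qed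

text \<open>The deterministic part of the problem: \<open>\<Omega>\<close> is the set of samples, and a sample path is any sequence in
  \<open>\<Omega>\<close>.\<close>

locale prox_sgd = prox_function \<phi> for \<phi> :: "'a::euclidean_space \<Rightarrow> ereal" +
  fixes f :: "'a \<Rightarrow> real" and F :: "'a \<Rightarrow> 's \<Rightarrow> real" and \<Omega> :: "'s set" and L lam :: real and \<alpha> :: "nat \<Rightarrow> real"
  assumes f: "C2_on f UNIV" and L: "L-lipschitz_on UNIV (grad f)" and lam: "0 < lam"
    and F: "s \<in> \<Omega> \<Longrightarrow> C2_on (\<lambda>x. F x s) UNIV"
    and FL: "s \<in> \<Omega> \<Longrightarrow> L-lipschitz_on UNIV (\<lambda>x. sgrad F x s)"
    and FH: "compact Q \<Longrightarrow> \<exists>K. \<forall>s\<in>\<Omega>. \<forall>x\<in>Q. \<forall>y\<in>Q. norm (shess F x s - shess F y s) \<le> K * norm (x - y)"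
    and \<alpha>: "0 < \<alpha> k" "\<alpha> k < inverse (L + inverse lam)"
    and \<alpha>_sum: "filterlim (\<lambda>n. \<Sum>k<n. \<alpha> k) at_top sequentially"
    and \<alpha>_sq: "summable (\<lambda>k. (\<alpha> k)\<^sup>2)"
begin

definition normal_map :: "'s \<Rightarrow> 'a \<Rightarrow> 'a" where
  "normal_map s w = sgrad F (prox lam \<phi> w) s + inverse lam *\<^sub>R (w - prox lam \<phi> w)"

text \<open>The first argument is the time at which the orbit starts; it selects the step sizes and the samples.\<close>

fun orbit :: "nat \<Rightarrow> (nat \<Rightarrow> 's) \<Rightarrow> 'a \<Rightarrow> nat \<Rightarrow> 'a" where
  "orbit m \<sigma> w 0 = w"
| "orbit m \<sigma> w (Suc n) = orbit m \<sigma> w n - \<alpha> (m + n) *\<^sub>R normal_map (\<sigma> (m + n)) (orbit m \<sigma> w n)"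

lemma L_nonneg: "0 \<le> L" using L by (rule lipschitz_on_nonneg)

lemma \<alpha>_tendsto: "\<alpha> \<longlonglongrightarrow> 0"
proof -
  have "(\<lambda>k. sqrt ((\<alpha> k)\<^sup>2)) \<longlonglongrightarrow> sqrt 0"
    by (intro tendsto_intros summable_LIMSEQ_zero[OF \<alpha>_sq])
  then show ?thesis using \<alpha>(1) by (simp add: abs_of_pos)
qed

lemma shess_bound: "s \<in> \<Omega> \<Longrightarrow> norm (shess F x s) \<le> L"
  by (rule norm_blinfun_derivative_le_Lipschitz[OF C2_on_UNIV_grad(2)[OF F] FL])

lemma hess_bound: "norm (hess f x) \<le> L"
  by (rule norm_blinfun_derivative_le_Lipschitz[OF C2_on_UNIV_grad(2)[OF f] L])

lemma sgrad_lip: "s \<in> \<Omega> \<Longrightarrow> norm (sgrad F x s - sgrad F y s) \<le> L * norm (x - y)"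
  using lipschitz_onD[OF FL, of s x y] by (simp add: dist_norm)

lemma normal_map_Lipschitz:
  assumes s: "s \<in> \<Omega>"
  shows "norm (normal_map s w - normal_map s w') \<le> (L + inverse lam) * norm (w - w')"
proof -
  let ?x = "prox lam \<phi> w" and ?x' = "prox lam \<phi> w'"
  have "norm (sgrad F ?x s - sgrad F ?x' s) \<le> L * norm (?x - ?x')" by (rule sgrad_lip[OF s])
  also have "\<dots> \<le> L * norm (w - w')" by (rule mult_left_mono[OF prox_nonexpansive(1)[OF lam] L_nonneg])
  finally have 1: "norm (sgrad F ?x s - sgrad F ?x' s) \<le> L * norm (w - w')" .
  have 2: "norm (inverse lam *\<^sub>R ((w - ?x) - (w' - ?x'))) \<le> inverse lam * norm (w - w')"
    using mult_left_mono[OF prox_nonexpansive(2)[OF lam, of w w'], of "inverse lam"] lam by simp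
  have "normal_map s w - normal_map s w' = (sgrad F ?x s - sgrad F ?x' s) + inverse lam *\<^sub>R ((w - ?x) - (w' - ?x'))"
    by (simp add: normal_map_def algebra_simps)
  then show ?thesis
    using 1 2 norm_triangle_ineq[of "sgrad F ?x s - sgrad F ?x' s" "inverse lam *\<^sub>R ((w - ?x) - (w' - ?x'))"]
    by (simp add: distrib_right)
qed

lemma step_distance_lower_bound:
  assumes s: "s \<in> \<Omega>"
  shows "(1 - \<alpha> k * (L + inverse lam)) * norm (w - w')
    \<le> norm ((w - \<alpha> k *\<^sub>R normal_map s w) - (w' - \<alpha> k *\<^sub>R normal_map s w'))"
proof -
  have "\<alpha> k * norm (normal_map s w - normal_map s w') \<le> \<alpha> k * ((L + inverse lam) * norm (w - w'))"
    using \<alpha>(1)[of k] by (intro mult_left_mono normal_map_Lipschitz[OF s]) auto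
  moreover have "norm (\<alpha> k *\<^sub>R (normal_map s w - normal_map s w')) = \<alpha> k * norm (normal_map s w - normal_map s w')"
    using \<alpha>(1)[of k] by simp
  moreover have "(w - \<alpha> k *\<^sub>R normal_map s w) - (w' - \<alpha> k *\<^sub>R normal_map s w')
      = (w - w') - \<alpha> k *\<^sub>R (normal_map s w - normal_map s w')" by (simp add: algebra_simps)
  ultimately show ?thesis
    using norm_triangle_ineq2[of "w - w'" "\<alpha> k *\<^sub>R (normal_map s w - normal_map s w')"]
    by (simp add: algebra_simps)
qed

lemma step_factor_pos: "0 < 1 - \<alpha> k * (L + inverse lam)"
proof -
  have p: "0 < L + inverse lam" using L_nonneg lam by (simp add: add_nonneg_pos)
  have "\<alpha> k * (L + inverse lam) < inverse (L + inverse lam) * (L + inverse lam)"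
    using \<alpha>(2) p by (rule mult_strict_right_mono)
  then show ?thesis using p by simp
qed

text \<open>The inverse of the step, defined on its range, is Lipschitz and therefore preserves null sets.\<close>

lemma step_preimage_negligible:
  assumes s: "s \<in> \<Omega>" and A: "negligible A"
  shows "negligible {w. w - \<alpha> k *\<^sub>R normal_map s w \<in> A}"
proof -
  define T where "T w = w - \<alpha> k *\<^sub>R normal_map s w" for w
  define c where "c = 1 - \<alpha> k * (L + inverse lam)"
  have c: "0 < c" unfolding c_def by (rule step_factor_pos)
  have ex: "c * norm (w - w') \<le> norm (T w - T w')" for w w'
    unfolding c_def T_def by (rule step_distance_lower_bound[OF s])
  have inj: "inj T"
  proof (rule injI)
    fix w w' assume "T w = T w'"
    then have "c * norm (w - w') \<le> 0" using ex[of w w'] by simp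
    then show "w = w'" using c by (simp add: mult_le_0_iff)
  qed
  have "negligible (inv T ` (A \<inter> range T))"
  proof (rule negligible_locally_Lipschitz_image)
    show "negligible (A \<inter> range T)" using A by (rule negligible_subset) auto
    fix u assume u: "u \<in> A \<inter> range T"
    have "norm (inv T y - inv T u) \<le> (1 / c) * norm (y - u)" if "y \<in> A \<inter> range T" for y
      using ex[of "inv T y" "inv T u"] that u c by (simp add: f_inv_into_f field_simps)
    then show "\<exists>S B. open S \<and> u \<in> S \<and> (\<forall>y\<in>(A \<inter> range T) \<inter> S. norm (inv T y - inv T u) \<le> B * norm (y - u))"
      by (intro exI[of _ UNIV] exI[of _ "1 / c"]) auto
  qed simp
  moreover have "{w. T w \<in> A} \<subseteq> inv T ` (A \<inter> range T)"
  proof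
    fix w assume "w \<in> {w. T w \<in> A}"
    then have "T w \<in> A \<inter> range T" by auto
    then show "w \<in> inv T ` (A \<inter> range T)" using inv_f_f[OF inj, of w] by force
  qed
  ultimately show ?thesis
    unfolding T_def[symmetric] by (rule negligible_subset)
qed

lemma orbit_preimage_negligible:
  assumes \<sigma>: "\<And>k. \<sigma> k \<in> \<Omega>" and A: "negligible A"
  shows "negligible {w. orbit 0 \<sigma> w m \<in> A}"
  using A
proof (induction m arbitrary: A)
  case (Suc m)
  show ?case using Suc.IH[OF step_preimage_negligible[OF \<sigma> Suc.prems, of m m]] by simp
qed simp

lemma orbit_shift: "orbit m \<sigma> (orbit 0 \<sigma> w m) n = orbit 0 \<sigma> w (m + n)"
  by (induction n) simp_all

lemma continuous_normal_map:
  assumes "s \<in> \<Omega>" shows "continuous_on UNIV (normal_map s)"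
proof (rule lipschitz_on_continuous_on)
  show "(L + inverse lam)-lipschitz_on UNIV (normal_map s)"
    using normal_map_Lipschitz[OF assms] L_nonneg lam by (intro lipschitz_onI) (auto simp: dist_norm)
qed

lemma continuous_orbit:
  assumes \<sigma>: "\<And>k. \<sigma> k \<in> \<Omega>" shows "continuous_on UNIV (\<lambda>w. orbit m \<sigma> w n)"
proof (induction n)
  case (Suc n)
  have "continuous_on UNIV (\<lambda>w. normal_map (\<sigma> (m + n)) (orbit m \<sigma> w n))"
    by (rule continuous_on_compose2[OF continuous_normal_map[OF \<sigma>] Suc]) simp
  then show ?case using Suc by (simp, intro continuous_intros)
qed simp

text \<open>The mean value inequality applied to \<open>sgrad F _ s - shess F x\<^sub>0 s\<close>.\<close>

lemma sgrad_linearization: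
  assumes s: "s \<in> \<Omega>" and K: "\<And>x. x \<in> ball x\<^sub>0 \<delta> \<Longrightarrow> norm (shess F x s - shess F x\<^sub>0 s) \<le> e"
    and xy: "x \<in> ball x\<^sub>0 \<delta>" "y \<in> ball x\<^sub>0 \<delta>"
  shows "norm (sgrad F x s - sgrad F y s - shess F x\<^sub>0 s (x - y)) \<le> e * norm (x - y)"
proof -
  let ?B = "shess F x\<^sub>0 s"
  have "norm ((sgrad F x s - ?B x) - (sgrad F y s - ?B y)) \<le> e * norm (x - y)"
  proof (rule differentiable_bound[OF convex_ball _ _ xy])
    fix u assume u: "u \<in> ball x\<^sub>0 \<delta>"
    have "((\<lambda>x. sgrad F x s - ?B x) has_derivative (\<lambda>h. shess F u s h - ?B h)) (at u)"
      by (intro has_derivative_diff C2_on_UNIV_grad(2)[OF F[OF s]] bounded_linear_imp_has_derivative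
          blinfun.bounded_linear_right)
    then show "((\<lambda>x. sgrad F x s - ?B x) has_derivative blinfun_apply (shess F u s - ?B)) (at u within ball x\<^sub>0 \<delta>)"
      by (auto intro: has_derivative_at_withinI simp: blinfun.diff_left[abs_def])
    show "onorm (blinfun_apply (shess F u s - ?B)) \<le> e"
      using K[OF u] by (simp add: norm_blinfun.rep_eq)
  qed
  then show ?thesis by (simp add: blinfun.diff_right algebra_simps)
qed

text \<open>The radius depends on the modulus of strict differentiability of \<open>prox\<close> and on the Lipschitz constant
  of the sampled Hessians, which is uniform in the sample; it is thus the same for all sample paths. Only
  the time from which two trapped orbits exclude each other depends on the path.\<close>

lemma saddle_repels:
  assumes linP: "linear P" and symP: "\<And>x y. P x \<bullet> y = x \<bullet> P y" and firm: "\<And>d. (norm (P d))\<^sup>2 \<le> d \<bullet> P d"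
    and sd: "strict_deriv (prox lam \<phi>) P z\<^sub>0" and p0: "prox lam \<phi> z\<^sub>0 = x\<^sub>0"
    and neg: "P v \<bullet> hess f x\<^sub>0 (P v) + inverse lam * (P v \<bullet> (v - P v)) < 0"
  obtains \<delta> where "0 < \<delta>" "\<And>\<sigma>. (\<And>k. \<sigma> k \<in> \<Omega>) \<Longrightarrow>
     summable (\<lambda>k. \<alpha> k *\<^sub>R (shess F x\<^sub>0 (\<sigma> k) - hess f x\<^sub>0)) \<Longrightarrow>
     \<forall>\<^sub>F m in sequentially. \<forall>w t. t \<noteq> 0 \<longrightarrow> (\<forall>n. orbit m \<sigma> w n \<in> ball z\<^sub>0 \<delta>) \<longrightarrow>
        (\<forall>n. orbit m \<sigma> (w + t *\<^sub>R v) n \<in> ball z\<^sub>0 \<delta>) \<longrightarrow> False"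
proof -
  define l where "l = inverse lam"
  have l: "0 < l" using lam by (simp add: l_def)
  obtain Q c \<kappa> where Q: "linear Q" "\<And>x y. Q x \<bullet> y = x \<bullet> Q y" and c: "0 < c" and \<kappa>: "0 < \<kappa>" and vQ: "0 < v \<bullet> Q v"
    and lyap: "\<And>d. 2 * c * (d \<bullet> Q d) + \<kappa> * (norm d)\<^sup>2 \<le> - 2 * ((hess f x\<^sub>0 (P d) + l *\<^sub>R (d - P d)) \<bullet> Q d)"
    using Lyapunov_form_exists[OF linP _ symP C2_on_UNIV_hess(2)[OF f] firm l, of x\<^sub>0 v] neg
    by (metis (no_types, lifting) l_def bounded_linear.linear blinfun.bounded_linear_right)
  have blQ: "bounded_linear Q" and blP: "bounded_linear P"
    using Q(1) linP by (simp_all add: linear_conv_bounded_linear)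
  define QQ where "QQ = Blinfun Q"
  define PP where "PP = Blinfun P"
  have QQ: "blinfun_apply QQ = Q" and PP: "blinfun_apply PP = P"
    unfolding QQ_def PP_def by (simp_all add: bounded_linear_Blinfun_apply blQ blP)
  define H where "H = (hess f x\<^sub>0 o\<^sub>L PP) + l *\<^sub>R (id_blinfun - PP)"
  have H: "H d = hess f x\<^sub>0 (P d) + l *\<^sub>R (d - P d)" for d
    by (simp add: H_def blinfun.add_left blinfun.scaleR_left blinfun.diff_left PP)
  define \<epsilon> where "\<epsilon> = \<kappa> / (16 * (norm QQ + 1))"
  have \<epsilon>0: "0 < \<epsilon>" using \<kappa> by (simp add: \<epsilon>_def add_nonneg_pos)
  have \<epsilon>Q: "16 * \<epsilon> * norm QQ \<le> \<kappa>"
  proof -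
    have "16 * \<epsilon> * norm QQ \<le> 16 * \<epsilon> * (norm QQ + 1)" using \<epsilon>0 by simp
    also have "\<dots> = \<kappa>" using norm_ge_zero[of QQ] by (simp add: \<epsilon>_def field_simps add_nonneg_eq_0_iff)
    finally show ?thesis .
  qed
  obtain K where K: "\<And>s x y. s \<in> \<Omega> \<Longrightarrow> x \<in> cball x\<^sub>0 1 \<Longrightarrow> y \<in> cball x\<^sub>0 1 \<Longrightarrow>
      norm (shess F x s - shess F y s) \<le> K * norm (x - y)"
    using FH[OF compact_cball, of x\<^sub>0 1] by blast
  define \<eta> where "\<eta> = \<epsilon> / (2 * (L + l))"
  have "B * (\<epsilon> / (2 * B)) = \<epsilon> / 2" if "0 < B" for B :: real using that by simp
  moreover have Ll: "0 < L + l" using L_nonneg l by simp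
  ultimately have \<eta>: "0 < \<eta>" "(L + l) * \<eta> = \<epsilon> / 2"
    unfolding \<eta>_def using \<epsilon>0 by (blast intro: divide_pos_pos mult_pos_pos zero_less_numeral)+
  obtain d1 where d1: "0 < d1" "\<And>w w'. w \<in> ball z\<^sub>0 d1 \<Longrightarrow> w' \<in> ball z\<^sub>0 d1 \<Longrightarrow>
     norm (prox lam \<phi> w - prox lam \<phi> w' - P (w - w')) \<le> \<eta> * norm (w - w')"
    using strict_derivD[OF sd \<eta>(1)] by blast
  define \<delta> where "\<delta> = min d1 (min 1 (\<epsilon> / (2 * (\<bar>K\<bar> + 1))))"
  have \<delta>: "0 < \<delta>" "\<delta> \<le> 1" "\<delta> \<le> d1" using d1 \<epsilon>0 by (auto simp: \<delta>_def)
  have "\<delta> \<le> \<epsilon> / (2 * (\<bar>K\<bar> + 1))" by (simp add: \<delta>_def)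
  then have "\<delta> * (\<bar>K\<bar> + 1) \<le> \<epsilon> / 2" by (simp add: field_simps)
  then have K\<delta>: "\<bar>K\<bar> * \<delta> \<le> \<epsilon> / 2" using \<delta>(1) by (simp add: algebra_simps)
  have err: "norm (normal_map s w - normal_map s w' - (H (w - w') + ((shess F x\<^sub>0 s - hess f x\<^sub>0) o\<^sub>L PP) (w - w')))
      \<le> \<epsilon> * norm (w - w')"
    if s: "s \<in> \<Omega>" and w: "w \<in> ball z\<^sub>0 \<delta>" "w' \<in> ball z\<^sub>0 \<delta>" for s w w'
  proof -
    let ?x = "prox lam \<phi> w" and ?x' = "prox lam \<phi> w'" and ?d = "w - w'"
    have xb: "prox lam \<phi> u \<in> ball x\<^sub>0 \<delta>" if "u \<in> ball z\<^sub>0 \<delta>" for u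
      using prox_nonexpansive(1)[OF lam, of z\<^sub>0 u] that unfolding p0 by (simp add: dist_norm)
    have n1: "norm (?x - ?x') \<le> norm ?d" by (rule prox_nonexpansive(1)[OF lam])
    have "norm (sgrad F ?x s - sgrad F ?x' s - shess F x\<^sub>0 s (?x - ?x')) \<le> \<epsilon> / 2 * norm (?x - ?x')"
    proof (rule sgrad_linearization[OF s _ xb[OF w(1)] xb[OF w(2)]])
      fix x assume x: "x \<in> ball x\<^sub>0 \<delta>"
      have "norm (shess F x s - shess F x\<^sub>0 s) \<le> K * norm (x - x\<^sub>0)"
        using x \<delta>(2) by (intro K[OF s]) auto
      also have "\<dots> \<le> \<bar>K\<bar> * norm (x - x\<^sub>0)" by (intro mult_right_mono) auto
      also have "\<dots> \<le> \<bar>K\<bar> * \<delta>" using x by (intro mult_left_mono) (auto simp: dist_norm norm_minus_commute)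
      finally show "norm (shess F x s - shess F x\<^sub>0 s) \<le> \<epsilon> / 2" using K\<delta> by simp
    qed
    also have "\<dots> \<le> \<epsilon> / 2 * norm ?d" using n1 \<epsilon>0 by (intro mult_left_mono) auto
    finally have 1: "norm (sgrad F ?x s - sgrad F ?x' s - shess F x\<^sub>0 s (?x - ?x')) \<le> \<epsilon> / 2 * norm ?d" .
    have p: "norm (?x - ?x' - P ?d) \<le> \<eta> * norm ?d" using w \<delta>(3) by (intro d1(2)) auto
    have "norm (shess F x\<^sub>0 s (?x - ?x' - P ?d)) \<le> norm (shess F x\<^sub>0 s) * norm (?x - ?x' - P ?d)" by (rule norm_blinfun)
    also have "\<dots> \<le> L * (\<eta> * norm ?d)" using L_nonneg by (intro mult_mono shess_bound[OF s] p) auto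
    finally have 2: "norm (shess F x\<^sub>0 s (?x - ?x' - P ?d)) \<le> L * (\<eta> * norm ?d)" .
    have 3: "norm (l *\<^sub>R (?x - ?x' - P ?d)) \<le> l * (\<eta> * norm ?d)"
      using mult_left_mono[OF p, of l] l by simp
    have eq: "normal_map s w - normal_map s w' - (H ?d + ((shess F x\<^sub>0 s - hess f x\<^sub>0) o\<^sub>L PP) ?d)
      = (sgrad F ?x s - sgrad F ?x' s - shess F x\<^sub>0 s (?x - ?x')) + shess F x\<^sub>0 s (?x - ?x' - P ?d)
        - l *\<^sub>R (?x - ?x' - P ?d)"
      unfolding H
      by (simp add: normal_map_def l_def[symmetric] PP blinfun.diff_left blinfun.diff_right blinfun.add_right
        linear_diff[OF linP] algebra_simps)
    have "L * (\<eta> * norm ?d) + l * (\<eta> * norm ?d) = ((L + l) * \<eta>) * norm ?d" by (simp add: algebra_simps)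
    then have 4: "L * (\<eta> * norm ?d) + l * (\<eta> * norm ?d) = \<epsilon> / 2 * norm ?d" unfolding \<eta>(2) .
    show ?thesis
      unfolding eq
      using 1 2 3 4
        norm_triangle_ineq4[of "(sgrad F ?x s - sgrad F ?x' s - shess F x\<^sub>0 s (?x - ?x')) + shess F x\<^sub>0 s (?x - ?x' - P ?d)" "l *\<^sub>R (?x - ?x' - P ?d)"]
        norm_triangle_ineq[of "sgrad F ?x s - sgrad F ?x' s - shess F x\<^sub>0 s (?x - ?x')" "shess F x\<^sub>0 s (?x - ?x' - P ?d)"]
      by linarith
  qed
  have "\<forall>\<^sub>F m in sequentially. \<forall>w t. t \<noteq> 0 \<longrightarrow> (\<forall>n. orbit m \<sigma> w n \<in> ball z\<^sub>0 \<delta>) \<longrightarrow>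
        (\<forall>n. orbit m \<sigma> (w + t *\<^sub>R v) n \<in> ball z\<^sub>0 \<delta>) \<longrightarrow> False"
    if \<sigma>: "\<And>k. \<sigma> k \<in> \<Omega>" and sm: "summable (\<lambda>k. \<alpha> k *\<^sub>R (shess F x\<^sub>0 (\<sigma> k) - hess f x\<^sub>0))" for \<sigma>
  proof -
    define N where "N k = (shess F x\<^sub>0 (\<sigma> k) - hess f x\<^sub>0) o\<^sub>L PP" for k
    have "bounded_linear (\<lambda>l. l o\<^sub>L PP)" by (intro bounded_linear_intros)
    from bounded_linear.summable[OF this sm]
    have smN: "summable (\<lambda>k. \<alpha> k *\<^sub>R N k)"
      by (simp add: N_def bounded_bilinear.scaleR_left[OF bounded_bilinear_blinfun_compose])
    define R where "R k = (\<Sum>i. \<alpha> i *\<^sub>R N i) - (\<Sum>i<k. \<alpha> i *\<^sub>R N i)" for k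
    have R1: "R (Suc k) = R k - \<alpha> k *\<^sub>R N k" for k by (simp add: R_def)
    have "R \<longlonglongrightarrow> (\<Sum>i. \<alpha> i *\<^sub>R N i) - (\<Sum>i. \<alpha> i *\<^sub>R N i)"
      unfolding R_def[abs_def] by (intro tendsto_intros summable_LIMSEQ[OF smN])
    then have R2: "R \<longlonglongrightarrow> 0" by simp
    have Nb: "norm (N k) \<le> 2 * L * norm PP" for k
    proof -
      have "norm (N k) \<le> norm (shess F x\<^sub>0 (\<sigma> k) - hess f x\<^sub>0) * norm PP"
        unfolding N_def by (rule norm_blinfun_compose)
      also have "norm (shess F x\<^sub>0 (\<sigma> k) - hess f x\<^sub>0) \<le> L + L"
        by (rule order_trans[OF norm_triangle_ineq4 add_mono[OF shess_bound[OF \<sigma>] hess_bound]])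
      then have "norm (shess F x\<^sub>0 (\<sigma> k) - hess f x\<^sub>0) * norm PP \<le> (2 * L) * norm PP"
        by (intro mult_right_mono) auto
      finally show ?thesis .
    qed
    have "\<forall>\<^sub>F m in sequentially. \<forall>d s t b. t \<noteq> 0 \<longrightarrow> d m = t *\<^sub>R v \<longrightarrow>
      (\<forall>k\<ge>m. d (Suc k) = d k - \<alpha> k *\<^sub>R (H (d k) + N k (d k) + s k) \<and>
       norm (s k) \<le> \<epsilon> * norm (d k) \<and> norm (d k) \<le> b) \<longrightarrow> False"
      by (rule perturbed_unstable_orbit_unbounded[of QQ c \<kappa> v H \<epsilon> \<alpha> N "2 * L * norm PP" R])
        (use Q(2) c \<kappa> vQ lyap \<epsilon>0 \<epsilon>Q \<alpha>(1) \<alpha>_tendsto \<alpha>_sum Nb R1 R2 in \<open>simp_all add: QQ H\<close>)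
    then show ?thesis
    proof eventually_elim
      case (elim m)
      show ?case
      proof (intro allI impI)
        fix w t assume t: "t \<noteq> 0" and a: "\<forall>n. orbit m \<sigma> w n \<in> ball z\<^sub>0 \<delta>"
          and b: "\<forall>n. orbit m \<sigma> (w + t *\<^sub>R v) n \<in> ball z\<^sub>0 \<delta>"
        define y where "y k = orbit m \<sigma> w (k - m)" for k
        define y' where "y' k = orbit m \<sigma> (w + t *\<^sub>R v) (k - m)" for k
        define d where "d k = y' k - y k" for k
        define s where "s k = normal_map (\<sigma> k) (y' k) - normal_map (\<sigma> k) (y k) - (H (d k) + N k (d k))" for k
        have "d m = t *\<^sub>R v" by (simp add: d_def y_def y'_def)
        moreover have "d (Suc k) = d k - \<alpha> k *\<^sub>R (H (d k) + N k (d k) + s k)" if "k \<ge> m" for k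
        proof -
          have "y (Suc k) = y k - \<alpha> k *\<^sub>R normal_map (\<sigma> k) (y k)"
            "y' (Suc k) = y' k - \<alpha> k *\<^sub>R normal_map (\<sigma> k) (y' k)"
            using that by (simp_all add: y_def y'_def Suc_diff_le)
          then have "d (Suc k) = d k - \<alpha> k *\<^sub>R (normal_map (\<sigma> k) (y' k) - normal_map (\<sigma> k) (y k))"
            by (simp add: d_def algebra_simps)
          then show ?thesis by (simp add: s_def)
        qed
        moreover have "norm (s k) \<le> \<epsilon> * norm (d k)" for k
          unfolding s_def d_def N_def by (rule err[OF \<sigma>]) (use a b in \<open>simp_all add: y_def y'_def\<close>)
        moreover have "norm (d k) \<le> 2 * \<delta>" for k
        proof -
          have "dist z\<^sub>0 (y k) < \<delta>" "dist z\<^sub>0 (y' k) < \<delta>" using a b by (simp_all add: y_def y'_def)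
          then show ?thesis using dist_triangle2[of "y' k" "y k" z\<^sub>0] by (simp add: d_def dist_norm norm_minus_commute)
        qed
        ultimately show False using elim t by blast
      qed
    qed
  qed
  with \<delta>(1) show thesis by (rule that)
qed

text \<open>An orbit that is eventually in the ball is trapped from some time \<open>m\<close> on which the repulsion acts. The
  points trapped from time \<open>m\<close> on are null by the translation argument, and null sets are pulled back to
  time \<open>0\<close>.\<close>

lemma trapped_starts_negligible:
  assumes \<sigma>: "\<And>k. \<sigma> k \<in> \<Omega>"
    and rep: "\<forall>\<^sub>F m in sequentially. \<forall>w t. t \<noteq> 0 \<longrightarrow> (\<forall>n. orbit m \<sigma> w n \<in> ball z\<^sub>0 \<delta>) \<longrightarrow>
        (\<forall>n. orbit m \<sigma> (w + t *\<^sub>R v) n \<in> ball z\<^sub>0 \<delta>) \<longrightarrow> False"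
  shows "negligible {w. \<forall>\<^sub>F n in sequentially. orbit 0 \<sigma> w n \<in> ball z\<^sub>0 \<delta>}"
proof -
  define A where "A m = {w. \<forall>n. orbit m \<sigma> w n \<in> ball z\<^sub>0 \<delta>}" for m
  from rep[unfolded eventually_sequentially]
  obtain m\<^sub>0 where m0': "\<forall>m\<ge>m\<^sub>0. \<forall>w t. t \<noteq> 0 \<longrightarrow> (\<forall>n. orbit m \<sigma> w n \<in> ball z\<^sub>0 \<delta>) \<longrightarrow>
        (\<forall>n. orbit m \<sigma> (w + t *\<^sub>R v) n \<in> ball z\<^sub>0 \<delta>) \<longrightarrow> False"
    by (elim exE)
  have m0: "w + t *\<^sub>R v \<notin> A m" if "m \<ge> m\<^sub>0" "t \<noteq> 0" "w \<in> A m" for m w t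
    using m0' that unfolding A_def mem_Collect_eq by metis
  have "negligible (A m)" if "m \<ge> m\<^sub>0" for m
  proof -
    have "A m = (\<Inter>n. (\<lambda>w. orbit m \<sigma> w n) -` ball z\<^sub>0 \<delta>)" by (auto simp: A_def)
    moreover have "(\<lambda>w. orbit m \<sigma> w n) -` ball z\<^sub>0 \<delta> \<in> sets borel" for n
      by (intro borel_open open_vimage open_ball) (rule continuous_orbit[OF \<sigma>])
    ultimately have "A m \<in> sets lborel" by (simp add: sets.countable_INT')
    moreover have "A m \<subseteq> ball z\<^sub>0 \<delta>" by (force simp: A_def dest: spec[of _ 0])
    then have "bounded (A m)" by (rule bounded_subset[OF bounded_ball])
    ultimately have "A m \<in> null_sets lborel"
      by (rule negligible_disjoint_translates) (use m0[OF that] in blast)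
    then show ?thesis by (simp add: negligible_iff_null_sets null_sets_completionI)
  qed
  then have "negligible {w. orbit 0 \<sigma> w m \<in> A m}" if "m \<ge> m\<^sub>0" for m
    using that by (intro orbit_preimage_negligible \<sigma>) auto
  then have "negligible (\<Union>m\<in>{m\<^sub>0..}. {w. orbit 0 \<sigma> w m \<in> A m})"
    by (intro negligible_countable_Union) auto
  moreover have "{w. \<forall>\<^sub>F n in sequentially. orbit 0 \<sigma> w n \<in> ball z\<^sub>0 \<delta>} \<subseteq> (\<Union>m\<in>{m\<^sub>0..}. {w. orbit 0 \<sigma> w m \<in> A m})"
  proof
    fix w assume "w \<in> {w. \<forall>\<^sub>F n in sequentially. orbit 0 \<sigma> w n \<in> ball z\<^sub>0 \<delta>}"
    then obtain M where M: "\<And>n. n \<ge> M \<Longrightarrow> orbit 0 \<sigma> w n \<in> ball z\<^sub>0 \<delta>"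
      unfolding eventually_sequentially by blast
    have "orbit 0 \<sigma> w (max M m\<^sub>0) \<in> A (max M m\<^sub>0)"
      unfolding A_def mem_Collect_eq orbit_shift using M by auto
    then show "w \<in> (\<Union>m\<in>{m\<^sub>0..}. {w. orbit 0 \<sigma> w m \<in> A m})" by (intro UN_I[of "max M m\<^sub>0"]) auto
  qed
  ultimately show ?thesis by (rule negligible_subset)
qed

text \<open>The sequence \<open>z\<close> is a moving average, with weights \<open>\<beta> k = \<alpha> k / lam\<close>, of
  \<open>prox (z k) - lam \<nabla>f(prox (z k); \<sigma> k)\<close>. By the Lipschitz bound this differs little from
  \<open>x\<^sub>0 - lam \<nabla>f(x\<^sub>0)\<close> minus \<open>lam\<close> times the noise at a fixed point \<open>y\<close> close to \<open>x\<^sub>0\<close>, and the series of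
  that noise converges.\<close>

lemma prox_convergence_imp_convergence:
  assumes \<sigma>: "\<And>k. \<sigma> k \<in> \<Omega>"
    and noise: "\<And>r. 0 < r \<Longrightarrow> \<exists>y. dist y x\<^sub>0 < r \<and> summable (\<lambda>k. \<alpha> k *\<^sub>R (sgrad F y (\<sigma> k) - grad f y))"
    and z: "\<And>k. z (Suc k) = z k - \<alpha> k *\<^sub>R normal_map (\<sigma> k) (z k)"
    and x: "(\<lambda>k. prox lam \<phi> (z k)) \<longlonglongrightarrow> x\<^sub>0"
  shows "z \<longlonglongrightarrow> x\<^sub>0 - lam *\<^sub>R grad f x\<^sub>0"
proof (rule LIMSEQ_I)
  fix e :: real assume e: "0 < e"
  define z\<^sub>0 where "z\<^sub>0 = x\<^sub>0 - lam *\<^sub>R grad f x\<^sub>0"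
  define \<beta> where "\<beta> k = \<alpha> k * inverse lam" for k
  have \<beta>: "0 < \<beta> k" "\<beta> k \<le> 1" for k
  proof -
    show "0 < \<beta> k" using \<alpha>(1)[of k] lam by (simp add: \<beta>_def)
    have "\<beta> k \<le> \<alpha> k * (L + inverse lam)"
      unfolding \<beta>_def using \<alpha>(1)[of k] L_nonneg by (intro mult_left_mono) auto
    then show "\<beta> k \<le> 1" using step_factor_pos[of k] by linarith
  qed
  have \<beta>_sum: "filterlim (\<lambda>n. \<Sum>k<n. \<beta> k) at_top sequentially"
    unfolding \<beta>_def sum_distrib_right[symmetric]
    by (rule filterlim_at_top_mult_tendsto_pos[OF tendsto_const _ \<alpha>_sum]) (use lam in simp)
  define e' where "e' = e / 10"
  have e': "0 < e'" using e by (simp add: e'_def)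
  \<comment> \<open>\<open>D r\<close> bounds the distance of the averaged quantity from its limit if \<open>prox (z k)\<close> and \<open>y\<close> are within
      \<open>r\<close> of \<open>x\<^sub>0\<close>.\<close>
  define D where "D = 4 * lam * L + 1"
  have D: "1 \<le> D" using lam L_nonneg by (simp add: D_def)
  define r where "r = e' / D"
  have r: "0 < r" using e' D by (simp add: r_def)
  obtain y where y: "dist y x\<^sub>0 < r" "summable (\<lambda>k. \<alpha> k *\<^sub>R (sgrad F y (\<sigma> k) - grad f y))"
    using noise[OF r] by blast
  define n where "n k = sgrad F y (\<sigma> k) - grad f y" for k
  define \<rho> where "\<rho> k = (\<Sum>i. \<alpha> i *\<^sub>R n i) - (\<Sum>i<k. \<alpha> i *\<^sub>R n i)" for k
  have "\<rho> \<longlonglongrightarrow> (\<Sum>i. \<alpha> i *\<^sub>R n i) - (\<Sum>i. \<alpha> i *\<^sub>R n i)"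
    unfolding \<rho>_def[abs_def] n_def by (intro tendsto_intros summable_LIMSEQ[OF y(2)])
  then have \<rho>0: "\<rho> \<longlonglongrightarrow> 0" by simp
  have \<rho>S: "\<rho> (Suc k) = \<rho> k - \<alpha> k *\<^sub>R n k" for k by (simp add: \<rho>_def)
  define x where "x k = prox lam \<phi> (z k)" for k
  define u where "u k = z k - z\<^sub>0 - \<rho> k" for k
  define b where "b k = (x k - x\<^sub>0) - lam *\<^sub>R (sgrad F (x k) (\<sigma> k) - sgrad F y (\<sigma> k)) - lam *\<^sub>R (grad f y - grad f x\<^sub>0)" for k
  have rec: "u (Suc k) = (1 - \<beta> k) *\<^sub>R u k + \<beta> k *\<^sub>R (b k - \<rho> k)" for k
  proof -
    have a: "\<alpha> k = \<beta> k * lam" using lam by (simp add: \<beta>_def)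
    have ll: "\<alpha> k *\<^sub>R (inverse lam *\<^sub>R c) = \<beta> k *\<^sub>R c" for c :: 'a by (simp add: \<beta>_def)
    have "u (Suc k) = z k - \<alpha> k *\<^sub>R sgrad F (x k) (\<sigma> k) - \<beta> k *\<^sub>R (z k - x k) - z\<^sub>0 - \<rho> k + \<alpha> k *\<^sub>R n k"
      unfolding u_def \<rho>S z normal_map_def scaleR_add_right ll by (simp add: x_def algebra_simps)
    also have "\<dots> = (1 - \<beta> k) *\<^sub>R u k + \<beta> k *\<^sub>R (b k - \<rho> k)"
      unfolding u_def b_def n_def z\<^sub>0_def a by (simp add: algebra_simps)
    finally show ?thesis .
  qed
  have "\<forall>\<^sub>F k in sequentially. dist (x k) x\<^sub>0 < r"
    using x r unfolding x_def[symmetric] by (rule tendstoD)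
  moreover have "\<forall>\<^sub>F k in sequentially. dist (\<rho> k) 0 < e'" using \<rho>0 e' by (rule tendstoD)
  ultimately have ev: "\<forall>\<^sub>F k in sequentially. norm (u (Suc k)) \<le> (1 - \<beta> k) * norm (u k) + \<beta> k * (2 * e') \<and> norm (\<rho> k) < e'"
  proof eventually_elim
    case (elim k)
    have 1: "norm (sgrad F (x k) (\<sigma> k) - sgrad F y (\<sigma> k)) \<le> L * (2 * r)"
    proof -
      have "norm (x k - y) \<le> 2 * r"
        using elim(1) y(1) dist_triangle2[of "x k" y x\<^sub>0] by (simp add: dist_norm)
      then show ?thesis using order_trans[OF sgrad_lip[OF \<sigma>] mult_left_mono[OF _ L_nonneg]] by blast
    qed
    have 2: "norm (grad f y - grad f x\<^sub>0) \<le> L * (2 * r)"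
    proof -
      have "norm (grad f y - grad f x\<^sub>0) \<le> L * norm (y - x\<^sub>0)"
        using lipschitz_onD[OF L, of y x\<^sub>0] by (simp add: dist_norm)
      also have "\<dots> \<le> L * (2 * r)" using y(1) r L_nonneg by (intro mult_left_mono) (auto simp: dist_norm)
      finally show ?thesis .
    qed
    have "norm (b k) \<le> norm (x k - x\<^sub>0) + lam * norm (sgrad F (x k) (\<sigma> k) - sgrad F y (\<sigma> k)) + lam * norm (grad f y - grad f x\<^sub>0)"
      unfolding b_def
      using norm_triangle_ineq4[of "(x k - x\<^sub>0) - lam *\<^sub>R (sgrad F (x k) (\<sigma> k) - sgrad F y (\<sigma> k))" "lam *\<^sub>R (grad f y - grad f x\<^sub>0)"]
        norm_triangle_ineq4[of "x k - x\<^sub>0" "lam *\<^sub>R (sgrad F (x k) (\<sigma> k) - sgrad F y (\<sigma> k))"] lam by simp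
    also have "\<dots> \<le> r + lam * (L * (2 * r)) + lam * (L * (2 * r))"
      using elim(1) 1 2 lam by (intro add_mono mult_left_mono) (auto simp: dist_norm)
    also have "\<dots> = D * r" by (simp add: D_def algebra_simps)
    also have "\<dots> = e'" using D by (simp add: r_def)
    finally have b: "norm (b k) \<le> e'" .
    have "norm (u (Suc k)) \<le> norm ((1 - \<beta> k) *\<^sub>R u k) + norm (\<beta> k *\<^sub>R (b k - \<rho> k))"
      unfolding rec by (rule norm_triangle_ineq)
    also have "\<dots> = (1 - \<beta> k) * norm (u k) + \<beta> k * norm (b k - \<rho> k)" using \<beta>[of k] by simp
    also have "norm (b k - \<rho> k) \<le> 2 * e'" using norm_triangle_ineq4[of "b k" "\<rho> k"] b elim(2) by simp
    then have "(1 - \<beta> k) * norm (u k) + \<beta> k * norm (b k - \<rho> k) \<le> (1 - \<beta> k) * norm (u k) + \<beta> k * (2 * e')"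
      using \<beta>(1)[of k] by simp
    finally show ?case using elim(2) by simp
  qed
  then have "\<forall>\<^sub>F k in sequentially. norm (u (Suc k)) \<le> (1 - \<beta> k) * norm (u k) + \<beta> k * (2 * e')"
    by (rule eventually_mono) simp
  then have "\<forall>\<^sub>F k in sequentially. norm (u k) \<le> 2 * (2 * e')"
    by (rule averaged_sequence_eventually_small[OF _ \<beta> \<beta>_sum]) (use e' in simp)
  then have "\<forall>\<^sub>F k in sequentially. norm (z k - z\<^sub>0) < e"
    using ev
  proof eventually_elim
    case (elim k)
    have "norm (z k - z\<^sub>0) \<le> norm (u k) + norm (\<rho> k)"
      using norm_triangle_ineq[of "u k" "\<rho> k"] by (simp add: u_def)
    then show ?case using elim e by (simp add: e'_def)
  qed
  then show "\<exists>n\<^sub>0. \<forall>k\<ge>n\<^sub>0. norm (z k - (x\<^sub>0 - lam *\<^sub>R grad f x\<^sub>0)) < e"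
    unfolding eventually_sequentially z\<^sub>0_def .
qed

end

section \<open>Avoidance of active strict saddles\<close>

lemma (in prob_space) weighted_iid_noise_summable:
  fixes h :: "'s \<Rightarrow> real" and \<xi> :: "nat \<Rightarrow> 'a \<Rightarrow> 's" and \<alpha> :: "nat \<Rightarrow> real"
  assumes ind: "indep_vars (\<lambda>_. \<Xi>) \<xi> UNIV" and id: "\<And>k. distr M \<Xi> (\<xi> k) = \<Xi>"
    and h[measurable]: "h \<in> borel_measurable \<Xi>"
    and sq: "\<And>k. integrable M (\<lambda>\<omega>. (h (\<xi> k \<omega>))\<^sup>2)" and mean: "\<And>k. expectation (\<lambda>\<omega>. h (\<xi> k \<omega>)) = 0"
    and \<alpha>: "summable (\<lambda>k. (\<alpha> k)\<^sup>2)"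
  shows "AE \<omega> in M. summable (\<lambda>k. \<alpha> k * h (\<xi> k \<omega>))"
proof (rule Kolmogorov_convergence)
  have \<xi>[measurable]: "\<xi> k \<in> measurable M \<Xi>" for k using ind by (auto simp: indep_vars_def)
  show "indep_vars (\<lambda>_. borel) (\<lambda>k \<omega>. \<alpha> k * h (\<xi> k \<omega>)) UNIV"
    by (rule indep_vars_compose2[OF ind, of "\<lambda>k s. \<alpha> k * h s"]) measurable
  show "integrable M (\<lambda>\<omega>. (\<alpha> k * h (\<xi> k \<omega>))\<^sup>2)" for k
    using sq[of k] by (simp add: power_mult_distrib)
  show "expectation (\<lambda>\<omega>. \<alpha> k * h (\<xi> k \<omega>)) = 0" for k
    using mean[of k] by simp
  have "expectation (\<lambda>\<omega>. (h (\<xi> k \<omega>))\<^sup>2) = (LINT s|\<Xi>. (h s)\<^sup>2)" for k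
    using integral_distr[OF \<xi>, of "\<lambda>s. (h s)\<^sup>2" k] by (simp add: id)
  then have "expectation (\<lambda>\<omega>. (\<alpha> k * h (\<xi> k \<omega>))\<^sup>2) = (\<alpha> k)\<^sup>2 * (LINT s|\<Xi>. (h s)\<^sup>2)" for k
    by (simp add: power_mult_distrib)
  then show "summable (\<lambda>k. expectation (\<lambda>\<omega>. (\<alpha> k * h (\<xi> k \<omega>))\<^sup>2))"
    using \<alpha> by (simp add: summable_mult2)
qed

lemma summable_euclidean_componentwise:
  fixes v :: "nat \<Rightarrow> 'a::euclidean_space"
  assumes "\<And>b. b \<in> Basis \<Longrightarrow> summable (\<lambda>k. \<alpha> k * (v k \<bullet> b))"
  shows "summable (\<lambda>k. \<alpha> k *\<^sub>R v k)"
proof -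
  have "summable (\<lambda>k. \<Sum>b\<in>Basis. (\<alpha> k * (v k \<bullet> b)) *\<^sub>R b)"
    by (intro summable_sum bounded_linear.summable[OF bounded_linear_scaleR_left] assms)
  moreover have "(\<Sum>b\<in>Basis. (\<alpha> k * (v k \<bullet> b)) *\<^sub>R b) = \<alpha> k *\<^sub>R v k" for k
    by (simp only: scaleR_scaleR[symmetric] scaleR_sum_right[symmetric] euclidean_representation)
  ultimately show ?thesis by simp
qed

lemma summable_blinfun_componentwise:
  fixes l :: "nat \<Rightarrow> 'a::euclidean_space \<Rightarrow>\<^sub>L 'b::euclidean_space"
  assumes "\<And>i j. i \<in> Basis \<Longrightarrow> j \<in> Basis \<Longrightarrow> summable (\<lambda>k. \<alpha> k * (l k j \<bullet> i))"
  shows "summable (\<lambda>k. \<alpha> k *\<^sub>R l k)"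
proof -
  define E where "E i j = Blinfun (\<lambda>x :: 'a. (x \<bullet> j) *\<^sub>R i)" for i :: 'b and j :: 'a
  have "bounded_linear (\<lambda>x :: 'a. (x \<bullet> j) *\<^sub>R i)" for i :: 'b and j :: 'a
    by (intro bounded_linear_intros)
  then have E: "blinfun_apply (E i j) x = (x \<bullet> j) *\<^sub>R i" for i j x
    by (simp add: E_def bounded_linear_Blinfun_apply)
  have "summable (\<lambda>k. \<Sum>i\<in>Basis. \<Sum>j\<in>Basis. (\<alpha> k * (l k j \<bullet> i)) *\<^sub>R E i j)"
    by (intro summable_sum bounded_linear.summable[OF bounded_linear_scaleR_left] assms)
  moreover have "(\<Sum>i\<in>Basis. \<Sum>j\<in>Basis. (\<alpha> k * (l k j \<bullet> i)) *\<^sub>R E i j) = \<alpha> k *\<^sub>R l k" for k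
  proof (rule blinfun_eqI)
    fix x
    have "blinfun_apply (\<Sum>i\<in>Basis. \<Sum>j\<in>Basis. (\<alpha> k * (l k j \<bullet> i)) *\<^sub>R E i j) x
        = (\<Sum>i\<in>Basis. (\<Sum>j\<in>Basis. (\<alpha> k * (l k j \<bullet> i)) * (x \<bullet> j)) *\<^sub>R i)"
      by (simp add: blinfun.sum_left blinfun.scaleR_left E scaleR_sum_left)
    also have "\<dots> = (\<Sum>i\<in>Basis. ((\<alpha> k *\<^sub>R l k (\<Sum>j\<in>Basis. (x \<bullet> j) *\<^sub>R j)) \<bullet> i) *\<^sub>R i)"
      by (simp add: blinfun.sum_right blinfun.scaleR_right inner_sum_left sum_distrib_left mult_ac)
    also have "\<dots> = blinfun_apply (\<alpha> k *\<^sub>R l k) x"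
      by (simp only: euclidean_representation blinfun.scaleR_left)
    finally show "blinfun_apply (\<Sum>i\<in>Basis. \<Sum>j\<in>Basis. (\<alpha> k * (l k j \<bullet> i)) *\<^sub>R E i j) x = blinfun_apply (\<alpha> k *\<^sub>R l k) x" .
  qed
  ultimately show ?thesis by simp
qed

text \<open>Fubini's theorem: the joint law is a product, and its first factor is absolutely continuous.\<close>

lemma (in prob_space) independent_start_avoids_null_sections:
  fixes z\<^sub>0 :: "'a \<Rightarrow> 'b::euclidean_space" and Y :: "'a \<Rightarrow> 'c"
  assumes dist: "distributed M lborel z\<^sub>0 p" and Y: "Y \<in> measurable M N"
    and ind: "indep_set (sets (vimage_algebra (space M) z\<^sub>0 borel)) (sets (vimage_algebra (space M) Y N))"
    and B: "B \<in> sets (borel \<Otimes>\<^sub>M N)"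
    and null: "AE \<omega> in M. negligible {w. (w, Y \<omega>) \<in> B}"
  shows "AE \<omega> in M. (z\<^sub>0 \<omega>, Y \<omega>) \<notin> B"
proof -
  have z[measurable]: "z\<^sub>0 \<in> borel_measurable M" using distributed_measurable[OF dist] by simp
  note Y[measurable]
  define \<mu> where "\<mu> = distr M borel z\<^sub>0"
  define \<nu> where "\<nu> = distr M N Y"
  interpret \<mu>: prob_space \<mu> unfolding \<mu>_def by (rule prob_space_distr) simp
  interpret \<nu>: prob_space \<nu> unfolding \<nu>_def by (rule prob_space_distr) simp
  interpret pair_sigma_finite \<mu> \<nu> ..
  have joint: "\<mu> \<Otimes>\<^sub>M \<nu> = distr M (borel \<Otimes>\<^sub>M N) (\<lambda>\<omega>. (z\<^sub>0 \<omega>, Y \<omega>))"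
  proof (rule pair_measure_eqI)
    show "sigma_finite_measure \<mu>" "sigma_finite_measure \<nu>" by unfold_locales
    show "sets (\<mu> \<Otimes>\<^sub>M \<nu>) = sets (distr M (borel \<Otimes>\<^sub>M N) (\<lambda>\<omega>. (z\<^sub>0 \<omega>, Y \<omega>)))"
      by (simp add: \<mu>_def \<nu>_def cong: sets_pair_measure_cong)
    fix A C assume A: "A \<in> sets \<mu>" and C: "C \<in> sets \<nu>"
    then have A'[measurable]: "A \<in> sets borel" and C'[measurable]: "C \<in> sets N" by (simp_all add: \<mu>_def \<nu>_def)
    have "prob ((z\<^sub>0 -` A \<inter> space M) \<inter> (Y -` C \<inter> space M)) = prob (z\<^sub>0 -` A \<inter> space M) * prob (Y -` C \<inter> space M)"
      by (rule indep_setD[OF ind]) (auto intro: in_vimage_algebra)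
    moreover have "(z\<^sub>0 -` A \<inter> space M) \<inter> (Y -` C \<inter> space M) = (\<lambda>\<omega>. (z\<^sub>0 \<omega>, Y \<omega>)) -` (A \<times> C) \<inter> space M" by auto
    ultimately show "emeasure \<mu> A * emeasure \<nu> C = emeasure (distr M (borel \<Otimes>\<^sub>M N) (\<lambda>\<omega>. (z\<^sub>0 \<omega>, Y \<omega>))) (A \<times> C)"
      unfolding \<mu>_def \<nu>_def
      by (simp add: emeasure_distr emeasure_eq_measure ennreal_mult'[symmetric])
  qed
  have \<mu>_dens: "\<mu> = density lborel p"
    using distributed_distr_eq_density[OF dist] by (simp add: \<mu>_def cong: distr_cong)
  have ac: "absolutely_continuous lborel \<mu>"
    unfolding \<mu>_dens by (rule absolutely_continuousI_density[OF distributed_borel_measurable[OF dist]])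
  have "sets (\<mu> \<Otimes>\<^sub>M \<nu>) = sets (borel \<Otimes>\<^sub>M N)"
    by (intro sets_pair_measure_cong) (simp_all add: \<mu>_def \<nu>_def)
  then have B': "B \<in> sets (\<mu> \<Otimes>\<^sub>M \<nu>)" using B by simp
  have sec: "emeasure \<mu> ((\<lambda>w. (w, Y \<omega>)) -` B) = 0"
    if \<omega>: "negligible {w. (w, Y \<omega>) \<in> B}" for \<omega>
  proof -
    have "(\<lambda>w. (w, Y \<omega>)) -` B \<in> sets borel" using sets_Pair2[OF B] by simp
    moreover have "(\<lambda>w. (w, Y \<omega>)) -` B = {w. (w, Y \<omega>) \<in> B}" by auto
    ultimately have "(\<lambda>w. (w, Y \<omega>)) -` B \<in> null_sets lborel"
      using \<omega> by (simp add: negligible_iff_null_sets null_sets_completion_iff)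
    then have "(\<lambda>w. (w, Y \<omega>)) -` B \<in> null_sets \<mu>"
      using ac unfolding absolutely_continuous_def by blast
    then show ?thesis by blast
  qed
  have "emeasure (\<mu> \<Otimes>\<^sub>M \<nu>) B = (\<integral>\<^sup>+y. emeasure \<mu> ((\<lambda>w. (w, y)) -` B) \<partial>\<nu>)"
    by (rule emeasure_pair_measure_alt2[OF B'])
  also have "\<dots> = (\<integral>\<^sup>+\<omega>. emeasure \<mu> ((\<lambda>w. (w, Y \<omega>)) -` B) \<partial>M)"
    unfolding \<nu>_def
  proof (rule nn_integral_distr[OF Y])
    show "(\<lambda>y. emeasure \<mu> ((\<lambda>w. (w, y)) -` B)) \<in> borel_measurable (distr M N Y)"
      using measurable_emeasure_Pair2[OF B'] by (simp add: \<nu>_def)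
  qed
  also have "\<dots> = (\<integral>\<^sup>+\<omega>. 0 \<partial>M)"
    by (rule nn_integral_cong_AE) (use null sec in auto)
  finally have "emeasure (\<mu> \<Otimes>\<^sub>M \<nu>) B = 0" by simp
  then have "emeasure M ((\<lambda>\<omega>. (z\<^sub>0 \<omega>, Y \<omega>)) -` B \<inter> space M) = 0"
    unfolding joint using B by (subst (asm) emeasure_distr) auto
  then have "(\<lambda>\<omega>. (z\<^sub>0 \<omega>, Y \<omega>)) -` B \<inter> space M \<in> null_sets M"
    using measurable_sets[OF _ B, of "\<lambda>\<omega>. (z\<^sub>0 \<omega>, Y \<omega>)" M] by (intro null_setsI) auto
  then show ?thesis by (rule AE_I') auto
qed

context prox_sgd
begin

lemma active_saddle_repels:
  assumes "x\<^sub>0 \<in> active_strict_saddles (\<lambda>y. ereal (f y) + \<phi> y)"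
  shows "\<exists>\<delta>>0. \<forall>\<sigma>. (\<forall>k. \<sigma> k \<in> \<Omega>) \<longrightarrow> summable (\<lambda>k. \<alpha> k *\<^sub>R (shess F x\<^sub>0 (\<sigma> k) - hess f x\<^sub>0)) \<longrightarrow>
    negligible {w. \<forall>\<^sub>F n in sequentially. orbit 0 \<sigma> w n \<in> ball (x\<^sub>0 - lam *\<^sub>R grad f x\<^sub>0) \<delta>}"
proof -
  obtain P v where P: "linear P" "\<And>x y. P x \<bullet> y = x \<bullet> P y" "\<And>d. (norm (P d))\<^sup>2 \<le> d \<bullet> P d"
    "strict_deriv (prox lam \<phi>) P (x\<^sub>0 - lam *\<^sub>R grad f x\<^sub>0)"
    "prox lam \<phi> (x\<^sub>0 - lam *\<^sub>R grad f x\<^sub>0) = x\<^sub>0"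
    "P v \<bullet> hess f x\<^sub>0 (P v) + inverse lam * (P v \<bullet> (v - P v)) < 0"
    using active_strict_saddle_prox_derivative[OF f L lam assms] by blast
  obtain \<delta> where \<delta>: "0 < \<delta>" "\<And>\<sigma>. (\<And>k. \<sigma> k \<in> \<Omega>) \<Longrightarrow>
     summable (\<lambda>k. \<alpha> k *\<^sub>R (shess F x\<^sub>0 (\<sigma> k) - hess f x\<^sub>0)) \<Longrightarrow>
     \<forall>\<^sub>F m in sequentially. \<forall>w t. t \<noteq> 0 \<longrightarrow> (\<forall>n. orbit m \<sigma> w n \<in> ball (x\<^sub>0 - lam *\<^sub>R grad f x\<^sub>0) \<delta>) \<longrightarrow>
        (\<forall>n. orbit m \<sigma> (w + t *\<^sub>R v) n \<in> ball (x\<^sub>0 - lam *\<^sub>R grad f x\<^sub>0) \<delta>) \<longrightarrow> False"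
    by (rule saddle_repels[OF P]) blast
  show ?thesis
  proof (intro exI conjI allI impI)
    show "0 < \<delta>" by fact
    fix \<sigma> assume \<sigma>: "\<forall>k. \<sigma> k \<in> \<Omega>" "summable (\<lambda>k. \<alpha> k *\<^sub>R (shess F x\<^sub>0 (\<sigma> k) - hess f x\<^sub>0))"
    show "negligible {w. \<forall>\<^sub>F n in sequentially. orbit 0 \<sigma> w n \<in> ball (x\<^sub>0 - lam *\<^sub>R grad f x\<^sub>0) \<delta>}"
      by (rule trapped_starts_negligible[OF _ \<delta>(2)]) (use \<sigma> in auto)
  qed
qed

lemma orbit_jointly_measurable:
  assumes sp: "\<Omega> = space \<Xi>" and jm: "(\<lambda>(x, s). sgrad F x s) \<in> borel_measurable (borel \<Otimes>\<^sub>M \<Xi>)"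
  shows "(\<lambda>p. orbit 0 (snd p) (fst p) n) \<in> borel_measurable (borel \<Otimes>\<^sub>M (\<Pi>\<^sub>M k\<in>UNIV. \<Xi>))"
proof (induction n)
  case (Suc n)
  have pm[measurable]: "prox lam \<phi> \<in> borel_measurable borel"
    by (intro borel_measurable_continuous_onI continuous_on_prox[OF lam])
  note Suc[measurable]
  have "(\<lambda>p. (prox lam \<phi> (orbit 0 (snd p) (fst p) n), snd p n)) \<in> (borel \<Otimes>\<^sub>M (\<Pi>\<^sub>M k\<in>UNIV. \<Xi>)) \<rightarrow>\<^sub>M (borel \<Otimes>\<^sub>M \<Xi>)"
    by measurable
  from measurable_compose[OF this jm]
  have [measurable]: "(\<lambda>p. sgrad F (prox lam \<phi> (orbit 0 (snd p) (fst p) n)) (snd p n)) \<in> borel_measurable (borel \<Otimes>\<^sub>M (\<Pi>\<^sub>M k\<in>UNIV. \<Xi>))"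
    by simp
  show ?case unfolding orbit.simps normal_map_def add_0 by measurable
qed simp

end

theorem corollary4p16:
  fixes f :: "'a::euclidean_space \<Rightarrow> real"
    and \<phi> :: "'a \<Rightarrow> ereal"
    and \<psi> :: "'a \<Rightarrow> ereal"
    and F :: "'a \<Rightarrow> 's \<Rightarrow> real"
    and \<Xi> :: "'s measure"
    and M :: "'w measure"
    and \<xi> :: "nat \<Rightarrow> 'w \<Rightarrow> 's"
    and z x :: "nat \<Rightarrow> 'w \<Rightarrow> 'a"
    and p :: "'a \<Rightarrow> ennreal"
    and L lam q :: real
    and \<alpha> :: "nat \<Rightarrow> real"
  assumes "\<psi> = (\<lambda>y. ereal (f y) + \<phi> y)"
    and "prob_space M"
    and "composite_regularity L f \<phi> F \<Xi>"
    and "sample_loss q f F \<Xi> M \<xi>"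
    and "bounded_variance f \<phi> F \<Xi> M \<xi> (z 0) x"
    and "lam > 0"
    and "normal_map_prox_sgd F \<phi> lam \<alpha> M \<xi> z x"
    and "step_size_condition L lam q \<alpha>"
    and "distributed M lborel (z 0) p"
    and "indep_of_samples M \<Xi> (z 0) \<xi>"
  shows "AE \<omega> in M. \<not> (\<exists>l\<in>active_strict_saddles \<psi>. (\<lambda>k. x k \<omega>) \<longlonglongrightarrow> l)"
proof -
  interpret M: prob_space M by fact
  note reg = assms(3)[unfolded composite_regularity_def]
  note smp = assms(4)[unfolded sample_loss_def]
  have ind: "M.indep_vars (\<lambda>_. \<Xi>) \<xi> UNIV" and law': "\<forall>k. distr M \<Xi> (\<xi> k) = \<Xi>"
    and F_C2: "\<forall>s\<in>space \<Xi>. C2_on (\<lambda>x. F x s) UNIV"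
    and jg: "(\<lambda>(x, s). sgrad F x s) \<in> borel_measurable (borel \<Otimes>\<^sub>M \<Xi>)"
    and jh: "(\<lambda>(x, s). shess F x s) \<in> borel_measurable (borel \<Otimes>\<^sub>M \<Xi>)"
    and F_hess: "\<forall>Q. compact Q \<longrightarrow> (\<exists>LQ. \<forall>s\<in>space \<Xi>. \<forall>x\<in>Q. \<forall>y\<in>Q.
        norm (shess F x s - shess F y s) \<le> LQ * norm (x - y))"
    and Eg': "\<forall>x k. integrable M (\<lambda>\<omega>. sgrad F x (\<xi> k \<omega>)) \<and> (LINT \<omega>|M. sgrad F x (\<xi> k \<omega>)) = grad f x"
    and Eh': "\<forall>x k. integrable M (\<lambda>\<omega>. shess F x (\<xi> k \<omega>)) \<and> (LINT \<omega>|M. shess F x (\<xi> k \<omega>)) = hess f x"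
    and Vg': "\<forall>x k. integrable M (\<lambda>\<omega>. (norm (sgrad F x (\<xi> k \<omega>) - grad f x))\<^sup>2)"
    using smp by - (elim conjE, assumption)+
  have law: "distr M \<Xi> (\<xi> k) = \<Xi>"
    and Eg: "integrable M (\<lambda>\<omega>. sgrad F y (\<xi> k \<omega>))" "(LINT \<omega>|M. sgrad F y (\<xi> k \<omega>)) = grad f y"
    and Eh: "integrable M (\<lambda>\<omega>. shess F y (\<xi> k \<omega>))" "(LINT \<omega>|M. shess F y (\<xi> k \<omega>)) = hess f y"
    and Vg: "integrable M (\<lambda>\<omega>. (norm (sgrad F y (\<xi> k \<omega>) - grad f y))\<^sup>2)" for y k
    using law' Eg' Eh' Vg' by blast+
  note steps = assms(8)[unfolded step_size_condition_def]
  have \<alpha>_sq: "summable (\<lambda>k. (\<alpha> k)\<^sup>2)" using steps by blast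
  interpret prox_sgd \<phi> f F "space \<Xi>" L lam \<alpha>
  proof
    show "proper_fun \<phi>" "closed_fun \<phi>" "convex_fun \<phi>" "C2_on f UNIV" "L-lipschitz_on UNIV (grad f)"
      using reg by blast+
    show "\<exists>c::real. \<forall>y. ereal c \<le> \<phi> y"
      using assms(5) unfolding bounded_variance_def by blast
    show "0 < lam" by fact
    show "C2_on (\<lambda>x. F x s) UNIV" if "s \<in> space \<Xi>" for s using F_C2 that by blast
    show "L-lipschitz_on UNIV (\<lambda>x. sgrad F x s)" if "s \<in> space \<Xi>" for s using reg that by blast
    show "\<exists>K. \<forall>s\<in>space \<Xi>. \<forall>x\<in>Q. \<forall>y\<in>Q. norm (shess F x s - shess F y s) \<le> K * norm (x - y)"
      if "compact Q" for Q using F_hess that by blast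
    show "0 < \<alpha> k" "\<alpha> k < inverse (L + inverse lam)" for k using steps by auto
    show "filterlim (\<lambda>n. \<Sum>k<n. \<alpha> k) at_top sequentially" using steps by blast
    show "summable (\<lambda>k. (\<alpha> k)\<^sup>2)" by (rule \<alpha>_sq)
  qed
  have \<xi>m[measurable]: "\<xi> k \<in> measurable M \<Xi>" for k using ind by (auto simp: M.indep_vars_def)
  have \<xi>sp: "\<xi> k \<omega> \<in> space \<Xi>" if "\<omega> \<in> space M" for k \<omega> using measurable_space[OF \<xi>m that] .
  have gm[measurable]: "(\<lambda>s. sgrad F y s) \<in> borel_measurable \<Xi>" for y
    using measurable_compose[OF measurable_Pair1' jg, of y] by simp
  have hm[measurable]: "(\<lambda>s. shess F y s) \<in> borel_measurable \<Xi>" for y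
    using measurable_compose[OF measurable_Pair1' jh, of y] by simp
  have grad_noise: "AE \<omega> in M. summable (\<lambda>k. \<alpha> k *\<^sub>R (sgrad F y (\<xi> k \<omega>) - grad f y))" for y
  proof -
    have "AE \<omega> in M. \<forall>b\<in>Basis. summable (\<lambda>k. \<alpha> k * ((sgrad F y (\<xi> k \<omega>) - grad f y) \<bullet> b))"
    proof (rule AE_finite_allI)
      fix b :: 'a assume b: "b \<in> Basis"
      show "AE \<omega> in M. summable (\<lambda>k. \<alpha> k * ((sgrad F y (\<xi> k \<omega>) - grad f y) \<bullet> b))"
      proof (rule M.weighted_iid_noise_summable[OF ind law _ _ _ \<alpha>_sq, where h="\<lambda>s. (sgrad F y s - grad f y) \<bullet> b"])
        show "(\<lambda>s. (sgrad F y s - grad f y) \<bullet> b) \<in> borel_measurable \<Xi>" by measurable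
        show "integrable M (\<lambda>\<omega>. ((sgrad F y (\<xi> k \<omega>) - grad f y) \<bullet> b)\<^sup>2)" for k
        proof (rule Bochner_Integration.integrable_bound[OF Vg[of k y]])
          show "AE \<omega> in M. norm (((sgrad F y (\<xi> k \<omega>) - grad f y) \<bullet> b)\<^sup>2) \<le> norm ((norm (sgrad F y (\<xi> k \<omega>) - grad f y))\<^sup>2)"
            using Basis_le_norm[OF b] by (intro AE_I2) (simp add: abs_le_square_iff[symmetric])
        qed measurable
        show "M.expectation (\<lambda>\<omega>. (sgrad F y (\<xi> k \<omega>) - grad f y) \<bullet> b) = 0" for k
          using Eg[of k y] by (simp add: inner_diff_left M.prob_space)
      qed
    qed simp
    then show ?thesis
      by eventually_elim (rule summable_euclidean_componentwise, blast)
  qed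
  have hess_noise: "AE \<omega> in M. summable (\<lambda>k. \<alpha> k *\<^sub>R (shess F y (\<xi> k \<omega>) - hess f y))" for y
  proof -
    have "AE \<omega> in M. \<forall>i\<in>Basis. \<forall>j\<in>Basis. summable (\<lambda>k. \<alpha> k * ((shess F y (\<xi> k \<omega>) - hess f y) j \<bullet> i))"
    proof (intro AE_finite_allI)
      fix i j :: 'a assume i: "i \<in> Basis" and j: "j \<in> Basis"
      have T: "bounded_linear (\<lambda>l :: 'a \<Rightarrow>\<^sub>L 'a. l j \<bullet> i)" by (intro bounded_linear_intros)
      have m: "(\<lambda>s. (shess F y s - hess f y) j \<bullet> i) \<in> borel_measurable \<Xi>"
        by (rule measurable_compose[OF _ borel_measurable_continuous_onI[OF linear_continuous_on[OF T]]]) measurable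
      show "AE \<omega> in M. summable (\<lambda>k. \<alpha> k * ((shess F y (\<xi> k \<omega>) - hess f y) j \<bullet> i))"
      proof (rule M.weighted_iid_noise_summable[OF ind law m _ _ \<alpha>_sq])
        show "integrable M (\<lambda>\<omega>. ((shess F y (\<xi> k \<omega>) - hess f y) j \<bullet> i)\<^sup>2)" for k
        proof (rule M.integrable_const_bound[of _ "(2 * L)\<^sup>2"])
          have "\<bar>(shess F y (\<xi> k \<omega>) - hess f y) j \<bullet> i\<bar> \<le> 2 * L" if "\<omega> \<in> space M" for \<omega>
          proof -
            have "\<bar>(shess F y (\<xi> k \<omega>) - hess f y) j \<bullet> i\<bar> \<le> norm ((shess F y (\<xi> k \<omega>) - hess f y) j)"
              by (rule Basis_le_norm[OF i])
            also have "\<dots> \<le> norm (shess F y (\<xi> k \<omega>) - hess f y)"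
              using norm_blinfun[of "shess F y (\<xi> k \<omega>) - hess f y" j] j by simp
            also have "\<dots> \<le> 2 * L"
              using norm_triangle_ineq4[of "shess F y (\<xi> k \<omega>)" "hess f y"] shess_bound[OF \<xi>sp[OF that, of k], of y]
                hess_bound[of y] by linarith
            finally show ?thesis .
          qed
          then have "((shess F y (\<xi> k \<omega>) - hess f y) j \<bullet> i)\<^sup>2 \<le> (2 * L)\<^sup>2" if "\<omega> \<in> space M" for \<omega>
            using that L_nonneg by (intro iffD1[OF abs_le_square_iff]) simp
          then show "AE \<omega> in M. norm (((shess F y (\<xi> k \<omega>) - hess f y) j \<bullet> i)\<^sup>2) \<le> (2 * L)\<^sup>2"
            by (intro AE_I2) (simp only: real_norm_def abs_power2)
          show "(\<lambda>\<omega>. ((shess F y (\<xi> k \<omega>) - hess f y) j \<bullet> i)\<^sup>2) \<in> borel_measurable M"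
            by (intro borel_measurable_power measurable_compose[OF \<xi>m m])
        qed
        have "M.expectation (\<lambda>\<omega>. shess F y (\<xi> k \<omega>) - hess f y) = 0" for k
          using Eh[of k y] by (simp add: M.prob_space)
        then show "M.expectation (\<lambda>\<omega>. (shess F y (\<xi> k \<omega>) - hess f y) j \<bullet> i) = 0" for k
          using integral_bounded_linear[OF T, of M "\<lambda>\<omega>. shess F y (\<xi> k \<omega>) - hess f y"] Eh(1)[of k y] by simp
      qed
    qed simp_all
    then show ?thesis
      by eventually_elim (rule summable_blinfun_componentwise, blast)
  qed
  define X where "X = active_strict_saddles \<psi>"
  define c where "c y = y - lam *\<^sub>R grad f y" for y
  have "\<forall>y\<in>X. \<exists>\<delta>>0. \<forall>\<sigma>. (\<forall>k. \<sigma> k \<in> space \<Xi>) \<longrightarrow> summable (\<lambda>k. \<alpha> k *\<^sub>R (shess F y (\<sigma> k) - hess f y)) \<longrightarrow>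
    negligible {w. \<forall>\<^sub>F n in sequentially. orbit 0 \<sigma> w n \<in> ball (c y) \<delta>}"
    unfolding X_def c_def assms(1) using active_saddle_repels by blast
  from bchoice[OF this] obtain \<delta> where \<delta>': "\<forall>y\<in>X. 0 < \<delta> y \<and> (\<forall>\<sigma>. (\<forall>k. \<sigma> k \<in> space \<Xi>) \<longrightarrow>
      summable (\<lambda>k. \<alpha> k *\<^sub>R (shess F y (\<sigma> k) - hess f y)) \<longrightarrow>
      negligible {w. \<forall>\<^sub>F n in sequentially. orbit 0 \<sigma> w n \<in> ball (c y) (\<delta> y)})"
    by (elim exE)
  have \<delta>: "0 < \<delta> y" if "y \<in> X" for y using bspec[OF \<delta>' that] by (rule conjunct1)
  have null: "negligible {w. \<forall>\<^sub>F n in sequentially. orbit 0 \<sigma> w n \<in> ball (c y) (\<delta> y)}"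
    if "y \<in> X" "\<forall>k. \<sigma> k \<in> space \<Xi>" "summable (\<lambda>k. \<alpha> k *\<^sub>R (shess F y (\<sigma> k) - hess f y))" for y \<sigma>
    using conjunct2[OF bspec[OF \<delta>' that(1)]] that(2,3) by simp
  obtain \<F> where \<F>: "\<F> \<subseteq> (\<lambda>y. ball (c y) (\<delta> y)) ` X" "countable \<F>" "\<Union>\<F> = (\<Union>y\<in>X. ball (c y) (\<delta> y))"
    using Lindelof[of "(\<lambda>y. ball (c y) (\<delta> y)) ` X"] by (metis (no_types, lifting) imageE open_ball)
  then obtain X' where X': "countable X'" "X' \<subseteq> X" "\<F> = (\<lambda>y. ball (c y) (\<delta> y)) ` X'"
    using countable_subset_image[of \<F> "\<lambda>y. ball (c y) (\<delta> y)" X] by blast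
  obtain D :: "'a set" where D: "countable D" "\<And>U. open U \<Longrightarrow> U \<noteq> {} \<Longrightarrow> \<exists>d\<in>D. d \<in> U"
    by (rule countable_dense_setE) blast
  define Y where "Y \<omega> = (\<lambda>k. \<xi> k \<omega>)" for \<omega>
  define N where "N = (\<Pi>\<^sub>M k\<in>(UNIV::nat set). \<Xi>)"
  have Ym: "Y \<in> measurable M N"
    unfolding Y_def N_def by (rule measurable_PiM_single') (auto simp: \<xi>sp)
  \<comment> \<open>The set \<open>X\<close> may fail to be measurable; \<open>B\<close> is a measurable set of pairs of a start and a sample path
      that contains the pairs of interest, and almost all of its sections are null.\<close>
  define B where "B = (\<Union>y\<in>X'. {p \<in> space (borel \<Otimes>\<^sub>M N). \<exists>m. \<forall>n\<ge>m. orbit 0 (snd p) (fst p) n \<in> ball (c y) (\<delta> y)})"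
  have Bm: "B \<in> sets (borel \<Otimes>\<^sub>M N)"
    unfolding B_def
  proof (rule sets.countable_UN''[OF X'(1)])
    fix y
    have "{p \<in> space (borel \<Otimes>\<^sub>M N). orbit 0 (snd p) (fst p) n \<in> ball (c y) (\<delta> y)} \<in> sets (borel \<Otimes>\<^sub>M N)" for n
    proof -
      have m: "(\<lambda>p. orbit 0 (snd p) (fst p) n) \<in> borel_measurable (borel \<Otimes>\<^sub>M N)"
        unfolding N_def by (rule orbit_jointly_measurable[OF refl jg])
      have "(\<lambda>p. orbit 0 (snd p) (fst p) n) -` ball (c y) (\<delta> y) \<inter> space (borel \<Otimes>\<^sub>M N) \<in> sets (borel \<Otimes>\<^sub>M N)"
        by (rule measurable_sets[OF m]) simp
      moreover have "{p \<in> space (borel \<Otimes>\<^sub>M N). orbit 0 (snd p) (fst p) n \<in> ball (c y) (\<delta> y)}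
          = (\<lambda>p. orbit 0 (snd p) (fst p) n) -` ball (c y) (\<delta> y) \<inter> space (borel \<Otimes>\<^sub>M N)" by blast
      ultimately show ?thesis by (simp only:)
    qed
    then show "{p \<in> space (borel \<Otimes>\<^sub>M N). \<exists>m. \<forall>n\<ge>m. orbit 0 (snd p) (fst p) n \<in> ball (c y) (\<delta> y)} \<in> sets (borel \<Otimes>\<^sub>M N)"
      by (intro sets.sets_Collect_countable_Ex sets.sets_Collect_countable_All sets.sets_Collect_imp sets.sets_Collect_const)
  qed
  have good: "AE \<omega> in M. \<omega> \<in> space M \<and> (\<forall>y\<in>D. summable (\<lambda>k. \<alpha> k *\<^sub>R (sgrad F y (\<xi> k \<omega>) - grad f y))) \<and>
      (\<forall>y\<in>X'. summable (\<lambda>k. \<alpha> k *\<^sub>R (shess F y (\<xi> k \<omega>) - hess f y)))"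
    by (intro AE_conjI AE_space) (use grad_noise hess_noise D(1) X'(1) in \<open>simp_all add: AE_ball_countable\<close>)
  have "AE \<omega> in M. negligible {w. (w, Y \<omega>) \<in> B}"
    using good
  proof eventually_elim
    case (elim \<omega>)
    have "{w. (w, Y \<omega>) \<in> B} \<subseteq> (\<Union>y\<in>X'. {w. \<forall>\<^sub>F n in sequentially. orbit 0 (Y \<omega>) w n \<in> ball (c y) (\<delta> y)})"
      unfolding B_def eventually_sequentially by auto
    moreover have "negligible (\<Union>y\<in>X'. {w. \<forall>\<^sub>F n in sequentially. orbit 0 (Y \<omega>) w n \<in> ball (c y) (\<delta> y)})"
    proof (rule negligible_countable_Union)
      show "countable ((\<lambda>y. {w. \<forall>\<^sub>F n in sequentially. orbit 0 (Y \<omega>) w n \<in> ball (c y) (\<delta> y)}) ` X')"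
        using X'(1) by simp
      fix S assume "S \<in> (\<lambda>y. {w. \<forall>\<^sub>F n in sequentially. orbit 0 (Y \<omega>) w n \<in> ball (c y) (\<delta> y)}) ` X'"
      then obtain y where y: "y \<in> X'" "S = {w. \<forall>\<^sub>F n in sequentially. orbit 0 (Y \<omega>) w n \<in> ball (c y) (\<delta> y)}" by blast
      show "negligible S"
        unfolding y(2) by (rule null) (use y X'(2) elim \<xi>sp in \<open>auto simp: Y_def\<close>)
    qed
    ultimately show ?case by (rule negligible_subset[rotated])
  qed
  then have "AE \<omega> in M. (z 0 \<omega>, Y \<omega>) \<notin> B"
    using assms(10) unfolding indep_of_samples_def N_def[symmetric] Y_def[symmetric]
    by (intro M.independent_start_avoids_null_sections[OF assms(9) Ym _ Bm])
  with good show ?thesis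
  proof eventually_elim
    case (elim \<omega>)
    show ?case
    proof
      assume "\<exists>l\<in>active_strict_saddles \<psi>. (\<lambda>k. x k \<omega>) \<longlonglongrightarrow> l"
      then obtain l where l: "l \<in> X" "(\<lambda>k. x k \<omega>) \<longlonglongrightarrow> l" unfolding X_def by blast
      have \<omega>: "\<omega> \<in> space M" using elim by simp
      have xz: "x k \<omega> = prox lam \<phi> (z k \<omega>)"
        and zS: "z (Suc k) \<omega> = z k \<omega> - \<alpha> k *\<^sub>R normal_map (\<xi> k \<omega>) (z k \<omega>)" for k
        using assms(7) \<omega> unfolding normal_map_prox_sgd_def normal_map_def by simp_all
      have orb: "orbit 0 (Y \<omega>) (z 0 \<omega>) k = z k \<omega>" for k
        by (induction k) (simp_all add: zS Y_def)
      have "(\<lambda>k. z k \<omega>) \<longlonglongrightarrow> l - lam *\<^sub>R grad f l"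
      proof (rule prox_convergence_imp_convergence[where \<sigma>="\<lambda>k. \<xi> k \<omega>"])
        show "\<xi> k \<omega> \<in> space \<Xi>" for k by (rule \<xi>sp[OF \<omega>])
        show "\<exists>y. dist y l < r \<and> summable (\<lambda>k. \<alpha> k *\<^sub>R (sgrad F y (\<xi> k \<omega>) - grad f y))" if "0 < r" for r
          using D(2)[of "ball l r"] that elim by (auto simp: dist_commute)
        show "(\<lambda>k. prox lam \<phi> (z k \<omega>)) \<longlonglongrightarrow> l" using l(2) by (simp add: xz)
      qed (rule zS)
      then have zl: "(\<lambda>k. z k \<omega>) \<longlonglongrightarrow> c l" by (simp add: c_def)
      have "c l \<in> (\<Union>y\<in>X. ball (c y) (\<delta> y))" using l(1) \<delta>[OF l(1)] by (intro UN_I[of l]) simp_all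
      then have "c l \<in> (\<Union>y\<in>X'. ball (c y) (\<delta> y))" unfolding \<F>(3)[symmetric] X'(3) .
      then obtain y where y: "y \<in> X'" "c l \<in> ball (c y) (\<delta> y)" by blast
      have "\<forall>\<^sub>F k in sequentially. z k \<omega> \<in> ball (c y) (\<delta> y)"
        using zl y(2) open_ball unfolding tendsto_def by blast
      then obtain m where "\<And>k. k \<ge> m \<Longrightarrow> z k \<omega> \<in> ball (c y) (\<delta> y)"
        unfolding eventually_sequentially by blast
      moreover have "(z 0 \<omega>, Y \<omega>) \<in> space (borel \<Otimes>\<^sub>M N)"
        using measurable_space[OF Ym \<omega>] by (simp add: space_pair_measure)
      ultimately have "(z 0 \<omega>, Y \<omega>) \<in> B"
        unfolding B_def using y(1) by (auto simp: orb)
      then show False using elim by simp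
    qed
  qed
qed

end
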